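(* The following condition is equivalent to the Fermat-Wiles theorem (i.e. to the assertion that $x^n+y^n\ne z^n$ for all $x,y,z,n\in\mathbb{N}$ with $n\ge 3$): for all $x,y,z,n\in\mathbb{N}$ with $n\ge3$, $$\lim_{\tau\to\infty}\left\{\frac{\Gamma\left(\left[\frac{x^n+y^n}{z^n}\frac{\tau}{1-c}\right]^1\right)}{\Gamma\left(\frac{x^n+y^n}{z^n}\frac{\tau}{1-c}\right)}\right\}^{\frac1\tau}\neq e.$$
   Context: $\Gamma$ is Euler's Gamma-function, $c$ is Euler's constant ($c=0.5772\ldots$), $e$ is the base of natural logarithms, $\zeta$ is the Riemann zeta-function, $\mathbb{N}=\{1,2,3,\dots\}$. The numbers $\frac{x^n+y^n}{z^n}$ with $x,y,z,n\in\mathbb{N}$, $n\ge 3$, are called Fermat's rationals. Jacob's ladder: fix a smooth, increasing, unbounded function $\mu$ on a half-line $[y_0,\infty)$ with $\mu(y)\ge 7y\ln y$. For all sufficiently large $T$ let $\varphi(T)$ be the solution $X=\varphi(T)$ of $\int_0^{\mu(X)}|\zeta(\frac12+it)|^2e^{-2t/X}\,dt=\int_0^T|\zeta(\frac12+it)|^2\,dt$, and put $\varphi_1(T)=\frac12\varphi(T)$ (a Jacob's ladder). The function $\varphi_1$ is continuous, strictly increasing and unbounded for large $T$; for large $T$, $[T]^1=\varphi_1^{-1}(T)$ denotes the value of its inverse function. *)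

theory Defs
  imports "HOL-Complex_Analysis.Complex_Analysis"
begin

(* By the identity theorem the two conditions determine the function on -{1}; its value at the
   pole 1 is left unspecified. *)
definition riemann_zeta :: "complex \<Rightarrow> complex" where
  "riemann_zeta = (SOME f. f holomorphic_on - {1} \<and>
     (\<forall>s. Re s > 1 \<longrightarrow> (\<lambda>n. 1 / of_nat (Suc n) powr s) sums f s))"

(* Derivatives are taken within the half-line, hence one-sided at its left endpoint. *)
definition smooth_on_half_line :: "real \<Rightarrow> (real \<Rightarrow> real) \<Rightarrow> bool" where
  "smooth_on_half_line a f \<longleftrightarrow> (\<exists>D :: nat \<Rightarrow> real \<Rightarrow> real. (\<forall>y\<ge>a. D 0 y = f y) \<and>
     (\<forall>k. \<forall>y\<ge>a. (D k has_real_derivative D (Suc k) y) (at y within {a..})))"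

definition ladder_equation :: "(real \<Rightarrow> real) \<Rightarrow> real \<Rightarrow> real \<Rightarrow> bool" where
  "ladder_equation \<mu> T X \<longleftrightarrow>
     integral {0..\<mu> X} (\<lambda>t. (cmod (riemann_zeta (Complex (1/2) t)))\<^sup>2 * exp (- 2 * t / X)) =
     integral {0..T} (\<lambda>t. (cmod (riemann_zeta (Complex (1/2) t)))\<^sup>2)"

(* For admissible mu the left-hand side of the equation is continuous and unbounded in X, and
   strictly increasing once it is positive. So the set of T > 0 for which the equation has a
   unique solution is an unbounded half-line, which serves as the domain of the ladder. *)
definition ladder_domain :: "real \<Rightarrow> (real \<Rightarrow> real) \<Rightarrow> real set" where
  "ladder_domain y0 \<mu> = {T. T > 0 \<and> (\<exists>!X. X \<ge> y0 \<and> ladder_equation \<mu> T X)}"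

definition ladder_phi :: "real \<Rightarrow> (real \<Rightarrow> real) \<Rightarrow> real \<Rightarrow> real" where
  "ladder_phi y0 \<mu> T = (THE X. X \<ge> y0 \<and> ladder_equation \<mu> T X)"

definition jacobs_ladder :: "real \<Rightarrow> (real \<Rightarrow> real) \<Rightarrow> real \<Rightarrow> real" where
  "jacobs_ladder y0 \<mu> T = ladder_phi y0 \<mu> T / 2"

(* The value of the inverse function of the ladder; meaningful for all large arguments. *)
definition reverse_iterate :: "real \<Rightarrow> (real \<Rightarrow> real) \<Rightarrow> real \<Rightarrow> real" where
  "reverse_iterate y0 \<mu> = the_inv_into (ladder_domain y0 \<mu>) (jacobs_ladder y0 \<mu>)"

definition fermat_rational :: "nat \<Rightarrow> nat \<Rightarrow> nat \<Rightarrow> nat \<Rightarrow> real" where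
  "fermat_rational x y z n = (real x ^ n + real y ^ n) / real z ^ n"

end

theory Submission
  imports Defs "HOL-Real_Asymp.Real_Asymp"
begin

text \<open>
  Let \<open>f t = |zeta (1/2 + i t)|^2\<close> and let \<open>c\<close> be Euler's constant. Since \<open>n powr (- 1/2 - i t)\<close> integrates against
  a sech kernel to a Cauchy kernel, cutting off both zeta factors (sum minus integral) expresses the Laplace
  transform of \<open>f\<close> through the digamma function. The reflection formula then identifies it, up to a small error
  and also for complex \<open>s\<close> near 0, with the Laplace transform of the divisor measure with mass
  \<open>2 pi d n\<close> at \<open>2 pi n\<close>. Smoothing with Poisson distribution functions, whose Laplace coefficients are controlled by
  Cauchy's estimate and whose tails by Chernoff's bound, transfers Dirichlet's divisor asymptotics to
  \<open>integral f over [0, T] = T ln T + a T + o(T)\<close>, and comparison with the harmonic numbers gives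
  \<open>v ln v + (a + 1 - c) v + o(v)\<close> for the damped integral with \<open>X = 2 v\<close>. Equating the two,
  \<open>[v]^1 - v\<close> is asymptotic to \<open>(1 - c) v / ln v\<close>, so \<open>ln Gamma [v]^1 - ln Gamma v\<close> is asymptotic to \<open>(1 - c) v\<close>.
  For \<open>v = r t / (1 - c)\<close> the limit is therefore \<open>exp r\<close>, which equals \<open>e\<close> only for \<open>r = 1\<close>.
\<close>

section \<open>The Riemann zeta function on the critical line\<close>

text \<open>The two sides of the ladder equation agree in their leading terms, so everything hinges
  on the linear ones: the mean square is needed with error \<open>o(T)\<close>. A Tauberian theorem
  that looks at the Laplace transform on the real axis only yields the leading order. Hence the
  comparison at complex \<open>s\<close> up to the imaginary axis, with an error
  \<open>|s|^2 / (Re s) powr (5/2)\<close>: in the variable \<open>w\<close> with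
  \<open>z = s (1 - w)\<close>, Cauchy circles of radius \<open>1 - 1/m\<close> then cost only
  powers of \<open>m\<close>, and a power of \<open>ln T\<close> is large enough for
  \<open>m\<close> to make the Poisson smoothing sharp. The constant \<open>a\<close> cancels in the
  ladder equation. What survives is the gain \<open>1 - c\<close> from averaging
  \<open>t ln t\<close> against an exponential density, that is, the integral of
  \<open>u ln u exp (- u)\<close> over \<open>u > 0\<close>. The derivatives of
  \<open>T ln T\<close> and of \<open>ln Gamma\<close> are both of order \<open>ln\<close>, so the
  logarithm lost in solving for \<open>[v]^1 - v\<close> is regained in the Gamma quotient; this is
  why the exponent \<open>1 / t\<close> leads to a finite limit.\<close>

text \<open>\<open>zeta_rem K s n\<close> is the error of order \<open>n powr (- s - K - 1)\<close> in the binomial expansion of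
  \<open>n powr (1 - s) - (n + 1) powr (1 - s)\<close>. Summing that expansion over \<open>n\<close> expresses
  \<open>(s - 1) * \<zeta> s\<close> by \<open>\<zeta> (s + 1), \<dots>, \<zeta> (s + K)\<close> and a series that converges for \<open>Re s > - K\<close>.\<close>

definition zeta_rem :: "nat \<Rightarrow> complex \<Rightarrow> nat \<Rightarrow> complex" where
  "zeta_rem K s n = of_nat n powr (1 - s) - of_nat (Suc n) powr (1 - s) +
     (\<Sum>j=1..Suc K. ((1 - s) gchoose j) * of_nat n powr (1 - s - of_nat j))"

text \<open>Taylor's theorem on the segment from 0 to 1, where \<open>1 + z\<close> lies between 1
  and 2; hence the power of 2. The factor \<open>1 / fact k\<close> is given away. The bound depends
  on \<open>a\<close> only through \<open>norm a\<close> and \<open>|Re a|\<close>, which makes the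
  estimates of \<open>zeta_rem\<close> locally uniform in \<open>s\<close>.\<close>

lemma norm_one_plus_powr_binomial_remainder:
  fixes a :: complex and x :: real
  assumes x: "0 \<le> x" "x \<le> 1"
  shows "norm ((1 + of_real x) powr a - (\<Sum>j\<le>k. (a gchoose j) * of_real x ^ j)) \<le>
    (\<Prod>i<Suc k. norm a + real i) * 2 powr (\<bar>Re a\<bar> + real (Suc k)) * x ^ Suc k"
proof -
  define f where "f = (\<lambda>j z. (\<Prod>i<j. a - of_nat i) * (1 + z) powr (a - of_nat j))"
  define S where "S = closed_segment (0::complex) 1"
  have S_eq: "S = of_real ` {0..1}"
    unfolding S_def using closed_segment_of_real[of 0 1] by (simp add: closed_segment_eq_real_ivl)
  define B where "B = (\<Prod>i<Suc k. norm a + real i) * 2 powr (\<bar>Re a\<bar> + real (Suc k))"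
  have "norm (f 0 (of_real x) - (\<Sum>i\<le>k. f i 0 * (of_real x - 0) ^ i / fact i)) \<le> B * norm (of_real x - 0 :: complex) ^ Suc k / fact k"
  proof (rule complex_Taylor[of S])
    show "convex S" by (simp add: S_def)
    fix j z assume z: "z \<in> S"
    then obtain y where y: "z = of_real y" "0 \<le> y" "y \<le> 1" by (auto simp: S_eq)
    have nz: "1 + z \<notin> \<real>\<^sub>\<le>\<^sub>0" using y by (auto simp: complex_nonpos_Reals_iff)
    have "((\<lambda>z. (1 + z) powr (a - of_nat j)) has_field_derivative (a - of_nat j) * (1 + z) powr (a - of_nat j - 1)) (at z within S)"
      by (rule derivative_eq_intros refl | (use nz in simp))+
    from DERIV_cmult[OF this, of "\<Prod>i<j. a - of_nat i"]
    show "(f j has_field_derivative f (Suc j) z) (at z within S)"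
      unfolding f_def by (simp add: algebra_simps)
  next
    fix z assume z: "z \<in> S"
    then obtain y where y: "z = of_real y" "0 \<le> y" "y \<le> 1" by (auto simp: S_eq)
    have "norm (\<Prod>i<Suc k. a - of_nat i) \<le> (\<Prod>i<Suc k. norm a + real i)"
      unfolding prod_norm [symmetric]
      by (intro prod_mono) (auto intro: norm_triangle_ineq4[THEN order_trans])
    moreover have "norm ((1 + z) powr (a - of_nat (Suc k))) \<le> 2 powr (\<bar>Re a\<bar> + real (Suc k))"
    proof -
      have "1 + z = of_real (1 + y)" using y by simp
      hence "norm ((1 + z) powr (a - of_nat (Suc k))) = (1 + y) powr (Re a - real (Suc k))"
        using y by (subst \<open>1 + z = _\<close>, subst norm_powr_real_powr) auto
      also have "\<dots> \<le> (1 + y) powr (\<bar>Re a\<bar> + real (Suc k))" using y by (intro powr_mono) auto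
      also have "\<dots> \<le> 2 powr (\<bar>Re a\<bar> + real (Suc k))" using y by (intro powr_mono2) auto
      finally show ?thesis .
    qed
    ultimately show "norm (f (Suc k) z) \<le> B"
      unfolding f_def B_def norm_mult by (intro mult_mono prod_nonneg) auto
  qed (use x in \<open>auto simp: S_eq\<close>)
  also have "\<dots> \<le> B * x ^ Suc k / 1"
  proof -
    have "B \<ge> 0" unfolding B_def by (intro mult_nonneg_nonneg prod_nonneg) auto
    hence "B * x ^ Suc k / fact k \<le> B * x ^ Suc k / 1"
      using x by (intro divide_left_mono) auto
    thus ?thesis using x by simp
  qed
  finally show ?thesis
    by (simp add: f_def B_def gbinomial_prod_rev atLeast0LessThan)
qed

text \<open>Factoring out \<open>n powr (1 - s)\<close> leaves the binomial remainder at
  \<open>x = 1 / n\<close>; each further order of the expansion gains a factor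
  \<open>1 / n\<close>.\<close>

lemma norm_zeta_rem_le:
  assumes n: "n \<ge> 1"
  shows "norm (zeta_rem K s n) \<le> (\<Prod>i<Suc (Suc K). norm (1 - s) + real i) *
    2 powr (\<bar>1 - Re s\<bar> + real (Suc (Suc K))) * real n powr (- Re s - real K - 1)"
proof -
  define a where "a = 1 - s"
  define T where "T = (1 + of_real (1 / real n)) powr a - (\<Sum>j\<le>Suc K. (a gchoose j) * of_real (1 / real n) ^ j)"
  have "of_nat (Suc n) powr a = (of_nat n powr a) * (1 + of_real (1 / real n)) powr a"
  proof -
    have "complex_of_nat (Suc n) = of_real (real n) * of_real (1 + 1 / real n)"
      using n by (subst of_real_mult [symmetric]) (simp add: field_simps)
    also have "\<dots> powr a = of_real (real n) powr a * of_real (1 + 1 / real n) powr a"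
      by (subst powr_times_real) auto
    finally show ?thesis by simp
  qed
  moreover have "(\<Sum>j=1..Suc K. (a gchoose j) * of_nat n powr (a - of_nat j)) =
                 of_nat n powr a * (\<Sum>j\<le>Suc K. (a gchoose j) * of_real (1 / real n) ^ j) - of_nat n powr a"
  proof -
    have "(\<Sum>j\<le>Suc K. (a gchoose j) * of_real (1 / real n) ^ j) = 1 + (\<Sum>j=1..Suc K. (a gchoose j) * of_real (1 / real n) ^ j)"
      by (simp add: atMost_atLeast0 sum.atLeast_Suc_atMost del: sum.cl_ivl_Suc)
    moreover have "of_nat n powr (a - of_nat j) = of_nat n powr a * of_real (1 / real n) ^ j" for j
      using n by (simp add: powr_diff power_divide)
    ultimately show ?thesis
      by (simp add: sum_distrib_left algebra_simps del: sum.cl_ivl_Suc)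
  qed
  ultimately have "zeta_rem K s n = - (of_nat n powr a * T)"
    by (simp add: zeta_rem_def a_def [symmetric] T_def algebra_simps del: sum.cl_ivl_Suc of_nat_Suc)
  hence "norm (zeta_rem K s n) = real n powr Re a * norm T"
    using n by (simp add: norm_mult norm_powr_real_powr)
  also have "\<dots> \<le> real n powr Re a * ((\<Prod>i<Suc (Suc K). norm a + real i) * 2 powr (\<bar>Re a\<bar> + real (Suc (Suc K))) * (1 / real n) ^ Suc (Suc K))"
    unfolding T_def using n by (intro mult_left_mono norm_one_plus_powr_binomial_remainder) auto
  also have "real n powr (- Re s - real K - 1) = real n powr Re a * (1 / real n) ^ Suc (Suc K)"
  proof -
    have e: "- Re s - real K - 1 = Re a - real (Suc (Suc K))" by (simp add: a_def)
    show ?thesis unfolding e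
      using n by (subst powr_diff, subst powr_realpow) (auto simp: power_divide)
  qed
  hence "real n powr Re a * ((\<Prod>i<Suc (Suc K). norm a + real i) * 2 powr (\<bar>Re a\<bar> + real (Suc (Suc K))) * (1 / real n) ^ Suc (Suc K)) =
     (\<Prod>i<Suc (Suc K). norm a + real i) * 2 powr (\<bar>Re a\<bar> + real (Suc (Suc K))) * real n powr (- Re s - real K - 1)"
    by (simp only: mult_ac)
  finally show ?thesis by (simp add: a_def)
qed

text \<open>The majorant has exponent \<open>- c - K - 1\<close>, and \<open>c > - K\<close> is
  exactly its summability.\<close>

lemma uniform_limit_zeta_rem:
  assumes "\<And>s. s \<in> A \<Longrightarrow> norm s \<le> B" "\<And>s. s \<in> A \<Longrightarrow> Re s \<ge> c" "c > - real K"
  shows "uniform_limit A (\<lambda>N s. \<Sum>n<N. zeta_rem K s (Suc n)) (\<lambda>s. \<Sum>n. zeta_rem K s (Suc n)) sequentially"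
proof (rule Weierstrass_m_test)
  define M where "M = (\<Prod>i<Suc (Suc K). (1 + B) + real i) * 2 powr ((1 + B) + real (Suc (Suc K)))"
  show "summable (\<lambda>n. M * real (Suc n) powr (- c - real K - 1))"
    using assms(3) by (intro summable_mult) (subst summable_Suc_iff, simp add: summable_real_powr_iff)
  fix n s assume s: "s \<in> A"
  have B: "norm s \<le> B" using assms s by auto
  have nB: "norm (1 - s) \<le> 1 + B" using norm_triangle_ineq4[of 1 s] B by simp
  have rB: "\<bar>1 - Re s\<bar> \<le> 1 + B" using abs_Re_le_cmod[of "1 - s"] nB by simp
  have "norm (zeta_rem K s (Suc n)) \<le> (\<Prod>i<Suc (Suc K). norm (1 - s) + real i) *
    2 powr (\<bar>1 - Re s\<bar> + real (Suc (Suc K))) * real (Suc n) powr (- Re s - real K - 1)"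
    by (rule norm_zeta_rem_le) auto
  also have "\<dots> \<le> M * real (Suc n) powr (- c - real K - 1)"
    unfolding M_def using nB rB assms(2)[OF s]
    by (intro mult_mono prod_mono powr_mono prod_nonneg mult_nonneg_nonneg) (auto intro: order_trans[OF norm_ge_zero nB])
  finally show "norm (zeta_rem K s (Suc n)) \<le> M * real (Suc n) powr (- c - real K - 1)" .
qed

lemma sums_zeta_rem:
  assumes "Re s > - real K"
  shows "(\<lambda>n. zeta_rem K s (Suc n)) sums (\<Sum>n. zeta_rem K s (Suc n))"
  using tendsto_uniform_limitI[OF uniform_limit_zeta_rem[of "{s}" "norm s" "Re s" K], of s] assms
  by (simp add: sums_def)

lemma holomorphic_suminf_zeta_rem: "(\<lambda>s. \<Sum>n. zeta_rem K s (Suc n)) holomorphic_on {s. Re s > - real K}"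
proof (rule holomorphic_uniform_sequence)
  show "open {s. Re s > - real K}" by (rule open_halfspace_Re_gt)
  show "(\<lambda>s. \<Sum>n<N. zeta_rem K s (Suc n)) holomorphic_on {s. Re s > - real K}" for N
    unfolding zeta_rem_def gbinomial_prod_rev by (intro holomorphic_intros) auto
  fix s assume s: "s \<in> {s. Re s > - real K}"
  define d where "d = (Re s + real K) / 2"
  have d: "d > 0" using s by (simp add: d_def)
  have Re: "Re z \<ge> Re s - d" if "z \<in> cball s d" for z
    using that abs_Re_le_cmod[of "s - z"] by (simp add: dist_norm)
  have Nm: "norm z \<le> norm s + d" if "z \<in> cball s d" for z
    using that norm_triangle_ineq2[of z s] by (simp add: dist_norm norm_minus_commute)
  have "Re s - d > - real K" using s by (simp add: d_def field_simps)
  thus "\<exists>d>0. cball s d \<subseteq> {s. Re s > - real K} \<and>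
     uniform_limit (cball s d) (\<lambda>N s. \<Sum>n<N. zeta_rem K s (Suc n)) (\<lambda>s. \<Sum>n. zeta_rem K s (Suc n)) sequentially"
    using d Re Nm by (intro exI[of _ d] conjI uniform_limit_zeta_rem[of _ "norm s + d" "Re s - d"]) (auto, smt (verit) Re mem_cball)
qed

section \<open>Analytic continuation of the zeta function\<close>

text \<open>The bare series is kept apart from \<open>riemann_zeta\<close>: nothing is known about
  the chosen function until some continuation has been shown to exist.\<close>

definition dirichlet_zeta :: "complex \<Rightarrow> complex" where
  "dirichlet_zeta s = (\<Sum>n. 1 / of_nat (Suc n) powr s)"

lemma sums_dirichlet_zeta:
  assumes "Re s > 1"
  shows "(\<lambda>n. 1 / of_nat (Suc n) powr s) sums dirichlet_zeta s"
proof -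
  have "summable (\<lambda>n. 1 / of_nat (Suc n) powr s)"
  proof (rule summable_comparison_test)
    show "summable (\<lambda>n. real (Suc n) powr (- Re s))"
      using assms by (subst summable_Suc_iff) (simp add: summable_real_powr_iff)
    show "\<exists>N. \<forall>n\<ge>N. norm (1 / of_nat (Suc n) powr s) \<le> real (Suc n) powr (- Re s)"
      by (auto simp: norm_divide norm_powr_real_powr powr_minus divide_simps simp del: of_nat_Suc)
  qed
  thus ?thesis by (simp add: dirichlet_zeta_def summable_sums)
qed

text \<open>The differences telescope and the binomial terms regroup into partial sums of shifted
  zeta series. No convergence is involved, so the identity serves for \<open>Re s > 1\<close> and,
  with \<open>K = 0\<close>, for the cut-off function in the critical strip.\<close>

lemma sum_zeta_rem_telescope:
  "(\<Sum>n<N. zeta_rem K s (Suc n)) = 1 - of_nat (Suc N) powr (1 - s) +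
     (\<Sum>j=1..Suc K. ((1 - s) gchoose j) * (\<Sum>n<N. 1 / of_nat (Suc n) powr (s + of_nat j - 1)))"
proof -
  have "(\<Sum>n<N. of_nat (Suc n) powr (1 - s) - of_nat (Suc (Suc n)) powr (1 - s)) = 1 - of_nat (Suc N) powr (1 - s)"
    by (induction N) simp_all
  moreover have "(\<Sum>n<N. \<Sum>j=1..Suc K. ((1 - s) gchoose j) * of_nat (Suc n) powr (1 - s - of_nat j)) =
       (\<Sum>j=1..Suc K. ((1 - s) gchoose j) * (\<Sum>n<N. 1 / of_nat (Suc n) powr (s + of_nat j - 1)))"
  proof (subst sum.swap, intro sum.cong refl)
    fix j
    have "of_nat (Suc n) powr (1 - s - of_nat j) = 1 / of_nat (Suc n) powr (s + of_nat j - 1)" for n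
    proof -
      have "1 - s - of_nat j = - (s + of_nat j - 1)" by simp
      thus ?thesis by (simp only: powr_minus) (simp add: divide_inverse)
    qed
    thus "(\<Sum>n<N. ((1 - s) gchoose j) * of_nat (Suc n) powr (1 - s - of_nat j)) = ((1 - s) gchoose j) * (\<Sum>n<N. 1 / of_nat (Suc n) powr (s + of_nat j - 1))"
      by (simp add: sum_distrib_left del: of_nat_Suc)
  qed
  ultimately show ?thesis unfolding zeta_rem_def sum.distrib by simp
qed

lemma tendsto_Suc_powr_0:
  assumes "Re a < 0"
  shows "(\<lambda>N. of_nat (Suc N) powr a) \<longlonglongrightarrow> 0"
proof (rule tendsto_norm_zero_cancel)
  have "(\<lambda>N. real (Suc N) powr Re a) \<longlonglongrightarrow> 0" using assms by real_asymp
  thus "(\<lambda>N. norm (of_nat (Suc N) powr a)) \<longlonglongrightarrow> 0"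
    by (subst norm_powr_real_powr) (auto simp del: of_nat_Suc)
qed

text \<open>The term \<open>j = 1\<close> of the telescoped sum is \<open>1 - s\<close> times the
  zeta series itself and moves to the left; the other terms contain zeta only at arguments further
  to the right.\<close>

lemma dirichlet_zeta_recursion:
  assumes s: "Re s > 1"
  shows "(s - 1) * dirichlet_zeta s = 1 - (\<Sum>n. zeta_rem K s (Suc n)) + (\<Sum>j=2..Suc K. ((1 - s) gchoose j) * dirichlet_zeta (s + of_nat j - 1))"
proof -
  have "(\<lambda>N. \<Sum>n<N. zeta_rem K s (Suc n)) \<longlonglongrightarrow> 1 - 0 + (\<Sum>j=1..Suc K. ((1 - s) gchoose j) * dirichlet_zeta (s + of_nat j - 1))"
    unfolding sum_zeta_rem_telescope using s
    by (intro tendsto_intros tendsto_Suc_powr_0 sums_dirichlet_zeta[unfolded sums_def]) auto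
  moreover have "(\<lambda>N. \<Sum>n<N. zeta_rem K s (Suc n)) \<longlonglongrightarrow> (\<Sum>n. zeta_rem K s (Suc n))"
    using sums_zeta_rem[of K s] s unfolding sums_def by auto
  ultimately have "(\<Sum>n. zeta_rem K s (Suc n)) = 1 + (\<Sum>j=1..Suc K. ((1 - s) gchoose j) * dirichlet_zeta (s + of_nat j - 1))"
    using LIMSEQ_unique by fastforce
  also have "{1..Suc K} = insert 1 {2..Suc K}" by auto
  finally show ?thesis by (simp add: algebra_simps)
qed

text \<open>Continuing \<open>(s - 1) * zeta s\<close> instead of zeta removes the pole. The
  recursion moves the boundary one unit to the left at each step, since it calls the previous
  function only at \<open>s + 1, s + 2, ...\<close>.\<close>

lemma zeta_continuation_halfplane:
  "\<exists>Z. Z holomorphic_on {s. Re s > 1 - real K} \<and> (\<forall>s. Re s > 1 \<longrightarrow> Z s = (s - 1) * dirichlet_zeta s)"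
proof (induction K)
  case 0
  have "(\<lambda>s. 1 - (\<Sum>n. zeta_rem 0 s (Suc n))) holomorphic_on {s. Re s > 1 - real 0}"
    by (intro holomorphic_intros holomorphic_on_subset[OF holomorphic_suminf_zeta_rem]) auto
  moreover have "\<forall>s. Re s > 1 \<longrightarrow> 1 - (\<Sum>n. zeta_rem 0 s (Suc n)) = (s - 1) * dirichlet_zeta s"
    using dirichlet_zeta_recursion[of _ 0] by simp
  ultimately show ?case by blast
next
  case (Suc K)
  then obtain Z where Z: "Z holomorphic_on {s. Re s > 1 - real K}" "\<And>s. Re s > 1 \<Longrightarrow> Z s = (s - 1) * dirichlet_zeta s" by blast
  \<comment> \<open>Zeta at \<open>s + j - 1\<close> has its pole where
    \<open>s + j - 2 = 0\<close>; this is, up to sign, the last factor of the binomial coefficient.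
    \<open>E j\<close> is the coefficient with that factor removed, so that \<open>Z\<close> can
    take the place of zeta.\<close>
  define E where "E = (\<lambda>j (s::complex). - (\<Prod>i<j-1. 1 - s - of_nat i) / fact j)"
  have E: "((1 - s) gchoose j) = E j s * (s + of_nat j - 1 - 1)" if j2: "j \<ge> 2" for j s
  proof -
    obtain i where i: "j = Suc i" using j2 by (cases j) simp_all
    define P where "P = (\<Prod>k<i. 1 - s - of_nat k)"
    have 1: "((1 - s) gchoose j) = P * (1 - s - of_nat i) / fact j"
      by (simp add: i gbinomial_prod_rev atLeast0LessThan P_def del: fact_Suc)
    have 2: "E j s = - P / fact j"
      by (simp add: E_def i P_def del: fact_Suc)
    have 3: "s + of_nat j - 1 - 1 = - (1 - s - of_nat i)" by (simp add: i)
    show ?thesis unfolding 1 2 3 by (simp only: times_divide_eq_left minus_mult_minus)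
  qed
  define Z' where "Z' = (\<lambda>s. 1 - (\<Sum>n. zeta_rem K s (Suc n)) + (\<Sum>j=2..Suc K. E j s * Z (s + of_nat j - 1)))"
  have "Z' holomorphic_on {s. Re s > 1 - real (Suc K)}"
    unfolding Z'_def
  proof (intro holomorphic_intros holomorphic_on_subset[OF holomorphic_suminf_zeta_rem])
    fix j assume j: "j \<in> {2..Suc K}"
    show "E j holomorphic_on {s. Re s > 1 - real (Suc K)}" unfolding E_def by (intro holomorphic_intros) auto
    have "(Z \<circ> (\<lambda>s. s + of_nat j - 1)) holomorphic_on {s. Re s > 1 - real (Suc K)}"
      by (intro holomorphic_on_compose_gen[OF _ Z(1)] holomorphic_intros) (use j in auto)
    thus "(\<lambda>s. Z (s + of_nat j - 1)) holomorphic_on {s. Re s > 1 - real (Suc K)}" by (simp add: o_def)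
  qed auto
  moreover have "Z' s = (s - 1) * dirichlet_zeta s" if s: "Re s > 1" for s
    unfolding dirichlet_zeta_recursion[OF s, of K] Z'_def using s E
    by (intro arg_cong2[of _ _ _ _ "(+)"] sum.cong refl) (auto simp: Z(2))
  ultimately show ?case by blast
qed

lemma zeta_continuation:
  "\<exists>f. f holomorphic_on - {1} \<and> (\<forall>s. Re s > 1 \<longrightarrow> (\<lambda>n. 1 / of_nat (Suc n) powr s) sums f s)"
proof -
  obtain Z where Z: "\<And>K. Z K holomorphic_on {s. Re s > 1 - real K}" "\<And>K s. Re s > 1 \<Longrightarrow> Z K s = (s - 1) * dirichlet_zeta s"
    using zeta_continuation_halfplane by metis
  have agree: "Z K s = Z K' s" if "K \<le> K'" "Re s > 1 - real K" for K K' s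
  proof (rule analytic_continuation_open[of "{s. Re s > 1}" "{s. Re s > 1 - real K}" "Z K" "Z K'" s])
    show "Z K' holomorphic_on {s. Re s > 1 - real K}"
      by (rule holomorphic_on_subset[OF Z(1)]) (use that in auto)
    show "{s. Re s > 1} \<noteq> {}" by (auto intro!: exI[of _ 2])
  qed (use that Z in \<open>auto simp: open_halfspace_Re_gt intro!: convex_connected convex_halfspace_Re_gt\<close>)
  \<comment> \<open>Some half-plane that contains \<open>s\<close>; which one is immaterial by
    \<open>agree\<close>.\<close>
  define k where "k = (\<lambda>s. nat \<lceil>2 - Re s\<rceil>)"
  have k: "Re s > 1 - real (k s)" for s unfolding k_def by linarith
  define f where "f = (\<lambda>s. Z (k s) s / (s - 1))"
  have f_eq: "f s = Z K s / (s - 1)" if "Re s > 1 - real K" for K s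
  proof -
    have "Z (k s) s = Z K s"
      using agree[of K "k s" s, OF _ that] agree[of "k s" K s, OF _ k] by (metis nle_le)
    thus ?thesis by (simp add: f_def)
  qed
  have "f holomorphic_on (\<Union>K. {s. Re s > 1 - real K} - {1})"
  proof (rule holomorphic_on_UN_open)
    fix K
    have "(\<lambda>s. Z K s / (s - 1)) holomorphic_on {s. Re s > 1 - real K} - {1}"
      by (intro holomorphic_intros holomorphic_on_subset[OF Z(1)]) auto
    thus "f holomorphic_on {s. Re s > 1 - real K} - {1}"
      by (rule holomorphic_transform) (auto simp: f_eq)
  qed (auto intro!: open_delete open_halfspace_Re_gt)
  also have "(\<Union>K. {s. Re s > 1 - real K} - {1}) = - {1}" using k by auto
  finally have "f holomorphic_on - {1}" .
  moreover have "(\<lambda>n. 1 / of_nat (Suc n) powr s) sums f s" if "Re s > 1" for s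
  proof -
    have "f s = dirichlet_zeta s" using that f_eq[of 0 s] Z(2)[OF that, of 0] by auto
    thus ?thesis using sums_dirichlet_zeta[OF that] by simp
  qed
  ultimately show ?thesis by blast
qed

lemma riemann_zeta_spec:
  "riemann_zeta holomorphic_on - {1} \<and> (\<forall>s. Re s > 1 \<longrightarrow> (\<lambda>n. 1 / of_nat (Suc n) powr s) sums riemann_zeta s)"
  unfolding riemann_zeta_def by (rule someI_ex[OF zeta_continuation])

section \<open>Cut-off zeta functions and growth on the critical line\<close>

text \<open>On the critical line \<open>(N + 1) powr (1 - s) / (1 - s)\<close> is the integral of
  \<open>u powr (- s)\<close> over \<open>0 < u < N + 1\<close>, so this is sum minus integral of
  one and the same function. The limit \<open>N + 1\<close> instead of \<open>N\<close> is what the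
  telescoping sum leaves.\<close>

definition zeta_cutoff :: "nat \<Rightarrow> complex \<Rightarrow> complex" where
  "zeta_cutoff N s = (\<Sum>n<N. 1 / of_nat (Suc n) powr s) - of_nat (Suc N) powr (1 - s) / (1 - s)"

lemma zeta_cutoff_eq:
  assumes "s \<noteq> 1"
  shows "zeta_cutoff N s = ((\<Sum>n<N. zeta_rem 0 s (Suc n)) - 1) / (1 - s)"
  unfolding sum_zeta_rem_telescope using assms by (simp add: zeta_cutoff_def field_simps)

text \<open>The case \<open>K = 0\<close> of the recursion, carried from \<open>Re s > 1\<close> to
  the half-plane \<open>Re s > 0\<close> without the point 1, which is still connected.\<close>

lemma riemann_zeta_eq_zeta_rem:
  assumes "Re s > 0" "s \<noteq> 1"
  shows "(s - 1) * riemann_zeta s = 1 - (\<Sum>n. zeta_rem 0 s (Suc n))"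
proof (rule analytic_continuation_open[of "{s. Re s > 1}" "{s. Re s > 0} - {1}"
    "\<lambda>s. (s - 1) * riemann_zeta s" "\<lambda>s. 1 - (\<Sum>n. zeta_rem 0 s (Suc n))"])
  show "connected ({s. Re s > 0} - {1::complex})"
    by (intro connected_open_delete open_halfspace_Re_gt convex_connected convex_halfspace_Re_gt) auto
  show "{s. Re s > 1} \<noteq> {}" by (auto intro!: exI[of _ 2])
  show "(\<lambda>s. (s - 1) * riemann_zeta s) holomorphic_on {s. Re s > 0} - {1}"
    by (intro holomorphic_intros holomorphic_on_subset[OF conjunct1[OF riemann_zeta_spec]]) auto
  show "(\<lambda>s. 1 - (\<Sum>n. zeta_rem 0 s (Suc n))) holomorphic_on {s. Re s > 0} - {1}"
    by (intro holomorphic_intros holomorphic_on_subset[OF holomorphic_suminf_zeta_rem]) auto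
  fix z assume "z \<in> {s. Re s > 1}"
  hence z: "Re z > 1" by simp
  hence "riemann_zeta z = dirichlet_zeta z"
    using riemann_zeta_spec sums_dirichlet_zeta sums_unique2 by blast
  thus "(z - 1) * riemann_zeta z = 1 - (\<Sum>n. zeta_rem 0 z (Suc n))"
    using dirichlet_zeta_recursion[OF z, of 0] by simp
qed (use assms in \<open>auto simp: open_halfspace_Re_gt intro!: open_delete\<close>)

lemma zeta_cutoff_tendsto:
  assumes "Re s > 0" "s \<noteq> 1"
  shows "(\<lambda>N. zeta_cutoff N s) \<longlonglongrightarrow> riemann_zeta s"
proof -
  have "(\<lambda>N. ((\<Sum>n<N. zeta_rem 0 s (Suc n)) - 1) / (1 - s)) \<longlonglongrightarrow> ((\<Sum>n. zeta_rem 0 s (Suc n)) - 1) / (1 - s)"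
    using assms by (intro tendsto_intros sums_zeta_rem[unfolded sums_def]) auto
  also have "((\<Sum>n. zeta_rem 0 s (Suc n)) - 1) / (1 - s) = riemann_zeta s"
    using riemann_zeta_eq_zeta_rem[OF assms] assms by (simp add: field_simps)
  finally show ?thesis using assms by (simp add: zeta_cutoff_eq)
qed

text \<open>Uniformity in \<open>N\<close> is the point: this is the dominating function when zeta
  is replaced by its cut-offs under an integral. The remainder terms are quadratic in
  \<open>norm (1 - s)\<close>, and division by \<open>1 - s\<close> leaves linear growth.\<close>

lemma zeta_cutoff_critical_line_bound:
  "\<exists>C>0. \<forall>N t. norm (zeta_cutoff N (1/2 + \<i> * of_real t)) \<le> C * (1 + \<bar>t\<bar>)"
proof -
  define S where "S = (\<Sum>n. real (Suc n) powr (- 3/2))"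
  have sm: "summable (\<lambda>n. real (Suc n) powr (- 3/2))"
    by (subst summable_Suc_iff) (simp add: summable_real_powr_iff)
  have S0: "S \<ge> 0" unfolding S_def by (intro suminf_nonneg sm) auto
  define D where "D = 2 powr (5/2) * S"
  have D0: "D \<ge> 0" using S0 by (simp add: D_def)
  have "norm (zeta_cutoff N (1/2 + \<i> * of_real t)) \<le> (2 + 2 * D) * (1 + \<bar>t\<bar>)" for N t
  proof -
    define s where "s = 1/2 + \<i> * complex_of_real t"
    have Re: "Re s = 1/2" by (simp add: s_def)
    have s1: "s \<noteq> 1" using Re by auto
    have a1: "norm (1 - s) \<ge> 1/2" using abs_Re_le_cmod[of "1 - s"] Re by simp
    have a2: "norm (1 - s) \<le> 1/2 + \<bar>t\<bar>" 
    proof -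
      have "1 - s = 1/2 - \<i> * of_real t" by (simp add: s_def)
      thus ?thesis using norm_triangle_ineq4[of "1/2" "\<i> * of_real t"] by (simp add: norm_mult)
    qed
    have "norm (\<Sum>n<N. zeta_rem 0 s (Suc n)) \<le> (\<Sum>n<N. norm (1 - s) * (norm (1 - s) + 1) * (2 powr (5/2) * real (Suc n) powr (- 3/2)))"
    proof (intro sum_norm_le)
      fix n
      have "norm (zeta_rem 0 s (Suc n)) \<le> (\<Prod>i<Suc (Suc 0). norm (1 - s) + real i) *
        2 powr (\<bar>1 - Re s\<bar> + real (Suc (Suc 0))) * real (Suc n) powr (- Re s - real 0 - 1)"
        by (rule norm_zeta_rem_le) auto
      also have "\<dots> = norm (1 - s) * (norm (1 - s) + 1) * (2 powr (5/2) * real (Suc n) powr (- 3/2))"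
        by (simp add: Re lessThan_Suc mult_ac)
      finally show "norm (zeta_rem 0 s (Suc n)) \<le> norm (1 - s) * (norm (1 - s) + 1) * (2 powr (5/2) * real (Suc n) powr (- 3/2))" .
    qed
    also have "\<dots> = norm (1 - s) * (norm (1 - s) + 1) * (2 powr (5/2) * (\<Sum>n<N. real (Suc n) powr (- 3/2)))"
      by (simp add: sum_distrib_left)
    also have "\<dots> \<le> norm (1 - s) * (norm (1 - s) + 1) * D"
      unfolding D_def S_def by (intro mult_left_mono sum_le_suminf sm) auto
    finally have 1: "norm (\<Sum>n<N. zeta_rem 0 s (Suc n)) \<le> norm (1 - s) * (norm (1 - s) + 1) * D" .
    have "norm (zeta_cutoff N s) \<le> (norm (\<Sum>n<N. zeta_rem 0 s (Suc n)) + 1) / norm (1 - s)"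
      unfolding zeta_cutoff_eq[OF s1] norm_divide by (intro divide_right_mono norm_triangle_ineq4[THEN order_trans]) auto
    also have "\<dots> \<le> (norm (1 - s) * (norm (1 - s) + 1) * D + 1) / norm (1 - s)"
      using 1 by (intro divide_right_mono) auto
    also have "\<dots> = (norm (1 - s) + 1) * D + 1 / norm (1 - s)"
      using s1 by (simp add: add_divide_distrib)
    also have "\<dots> \<le> (3/2 + \<bar>t\<bar>) * D + 2"
    proof -
      have "1 / norm (1 - s) \<le> 2" using a1 s1 by (simp add: field_simps)
      moreover have "(norm (1 - s) + 1) * D \<le> (3/2 + \<bar>t\<bar>) * D"
        using a2 D0 by (intro mult_right_mono) auto
      ultimately show ?thesis by simp
    qed
    also have "\<dots> \<le> (2 + 2 * D) * (1 + \<bar>t\<bar>)"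
      using D0 by (simp add: algebra_simps)
    finally show ?thesis by (simp add: s_def)
  qed
  moreover have "2 + 2 * D > 0" using D0 by simp
  ultimately show ?thesis by blast
qed

definition zeta_half :: "real \<Rightarrow> complex" where
  "zeta_half t = riemann_zeta (1/2 + \<i> * of_real t)"

lemma zeta_cutoff_half_tendsto: "(\<lambda>N. zeta_cutoff N (1/2 + \<i> * of_real t)) \<longlonglongrightarrow> zeta_half t"
  unfolding zeta_half_def by (rule zeta_cutoff_tendsto) (auto simp: complex_eq_iff)

lemma zeta_half_bound: "\<exists>C>0. \<forall>t. norm (zeta_half t) \<le> C * (1 + \<bar>t\<bar>)"
proof -
  obtain C where C: "C > 0" "\<And>N t. norm (zeta_cutoff N (1/2 + \<i> * of_real t)) \<le> C * (1 + \<bar>t\<bar>)"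
    using zeta_cutoff_critical_line_bound by blast
  have "norm (zeta_half t) \<le> C * (1 + \<bar>t\<bar>)" for t
    by (rule Lim_norm_ubound[OF _ zeta_cutoff_half_tendsto]) (use C in auto)
  thus ?thesis using C by blast
qed

text \<open>The Dirichlet coefficients are real. This turns
  \<open>zeta_half (- t) * zeta_half t\<close> into the square of the absolute value.\<close>

lemma zeta_half_uminus: "zeta_half (- t) = cnj (zeta_half t)"
proof (rule LIMSEQ_unique[OF zeta_cutoff_half_tendsto])
  have "cnj (zeta_cutoff N (1/2 + \<i> * of_real t)) = zeta_cutoff N (1/2 + \<i> * of_real (-t))" for N
    unfolding zeta_cutoff_def by (simp add: cnj_powr complex_nonpos_Reals_iff del: of_nat_Suc)
  thus "(\<lambda>N. zeta_cutoff N (1/2 + \<i> * of_real (-t))) \<longlonglongrightarrow> cnj (zeta_half t)"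
    using tendsto_cnj[OF zeta_cutoff_half_tendsto[of t]] by simp
qed

lemma continuous_on_zeta_half: "continuous_on A zeta_half"
  unfolding zeta_half_def
  by (rule continuous_on_compose2[OF holomorphic_on_imp_continuous_on[OF conjunct1[OF riemann_zeta_spec]]])
     (auto intro!: continuous_intros simp: complex_eq_iff)

lemma zeta_half_measurable [measurable]: "zeta_half \<in> borel_measurable borel"
  by (intro borel_measurable_continuous_onI continuous_on_zeta_half)

text \<open>If zeta vanished on a piece of the critical line, the identity theorem would force it to
  vanish at 2. The lemma is what makes the mean squares strictly increasing.\<close>

lemma zeta_half_not_const_0:
  assumes "a < b"
  shows "\<exists>t\<in>{a..b}. zeta_half t \<noteq> 0"
proof (rule ccontr)
  assume *: "\<not> ?thesis"
  define U where "U = (\<lambda>t. 1/2 + \<i> * complex_of_real t) ` {a..b}"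
  define x where "x = 1/2 + \<i> * complex_of_real a"
  have "x islimpt U"
  proof (rule islimptI)
    fix T assume T: "x \<in> T" "open T"
    then obtain e where e: "e > 0" "ball x e \<subseteq> T" using openE by blast
    define t where "t = a + min (b - a) (e/2)"
    have t: "a < t" "t \<le> b" "t - a < e" using e assms by (auto simp: t_def)
    have "dist x (1/2 + \<i> * complex_of_real t) = norm (\<i> * complex_of_real (a - t))"
      by (simp add: x_def dist_norm algebra_simps)
    also have "\<dots> = t - a" using t by (simp only: norm_mult norm_of_real) simp
    finally show "\<exists>y\<in>U. y \<in> T \<and> y \<noteq> x"
      using e t by (intro bexI[of _ "1/2 + \<i> * complex_of_real t"]) (auto simp: U_def x_def)
  qed
  have "riemann_zeta 2 = 0"
  proof (rule analytic_continuation[of riemann_zeta "- {1}" U x])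
    show "connected (- {1::complex})" by (rule connected_punctured_universe) simp
    show "U \<subseteq> - {1}" "x \<in> - {1}" by (auto simp: U_def x_def complex_eq_iff)
    show "riemann_zeta z = 0" if "z \<in> U" for z using that * by (auto simp: U_def zeta_half_def)
  qed (use riemann_zeta_spec \<open>x islimpt U\<close> in auto)
  moreover have "(\<lambda>n. 1 / of_nat (Suc n) powr (2::complex)) sums riemann_zeta 2"
    by (rule riemann_zeta_spec[THEN conjunct2, rule_format]) simp
  ultimately have "(\<lambda>n. 1 / of_nat (Suc n) powr (2::complex)) sums 0" by simp
  from sums_Re[OF this] have "(\<lambda>n. Re (1 / of_nat (Suc n) powr (2::complex))) sums 0" by simp
  also have "(\<lambda>n. Re (1 / of_nat (Suc n) powr (2::complex))) = (\<lambda>n. 1 / real (Suc n) ^ 2)"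
  proof
    fix n
    have "1 / of_nat (Suc n) powr (2::complex) = of_real (1 / real (Suc n) ^ 2)"
      by (simp add: powr_numeral del: of_nat_Suc)
    thus "Re (1 / of_nat (Suc n) powr (2::complex)) = 1 / real (Suc n) ^ 2" by (simp only: Re_complex_of_real)
  qed
  finally have s: "(\<lambda>n. 1 / real (Suc n) ^ 2) sums 0" .
  have "sum (\<lambda>n. 1 / real (Suc n) ^ 2) {..<1} \<le> suminf (\<lambda>n. 1 / real (Suc n) ^ 2)"
    by (rule sum_le_suminf) (use s in \<open>auto simp: sums_iff\<close>)
  thus False using s by (simp add: sums_iff)
qed

section \<open>The kernel exp (- s t) / (1 + exp (- 2 pi t))\<close>

lemma integrable_exp_abs:
  fixes m :: real assumes "m > 0"
  shows "integrable lborel (\<lambda>t::real. exp (- m * \<bar>t\<bar>))"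
proof -
  have "(\<lambda>t::real. exp (- m * t)) integrable_on {0..}"
    by (rule integrable_on_exp_minus_to_infinity[OF assms])
  hence "(\<lambda>t::real. exp (- m * t)) absolutely_integrable_on {0..}"
    by (intro nonnegative_absolutely_integrable_1) auto
  hence "integrable lebesgue (\<lambda>t::real. indicator {0..} t * exp (- m * t))"
    by (simp add: set_integrable_def)
  hence 1: "integrable lborel (\<lambda>t::real. indicator {0..} t * exp (- m * t))"
    by (subst (asm) integrable_completion) auto
  have 2: "integrable lborel (\<lambda>t::real. indicator {0..} (-t) * exp (- m * (-t)))"
    using lborel_integrable_real_affine[OF 1, of "-1" 0] by simp
  have "integrable lborel (\<lambda>t::real. indicator {0..} t * exp (- m * t) + indicator {0..} (-t) * exp (- m * (-t)))"
    by (rule Bochner_Integration.integrable_add[OF 1 2])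
  thus ?thesis
    by (rule Bochner_Integration.integrable_bound)
       (auto simp: indicator_def abs_if split: if_splits)
qed

lemma poly_exp_le_exp:
  fixes m :: real assumes "m > 0"
  shows "\<exists>C\<ge>0. \<forall>x\<ge>0. (1 + x) ^ k * exp (- m * x) \<le> C * exp (- (m / 2) * x)"
proof -
  have "((\<lambda>x. (1 + x) ^ k * exp (- (m/2) * x)) \<longlongrightarrow> 0) at_top"
    using assms by real_asymp
  hence "eventually (\<lambda>x. (1 + x) ^ k * exp (- (m/2) * x) < 1) at_top"
    by (rule order_tendstoD) simp
  then obtain x0 where x0: "\<And>x. x \<ge> x0 \<Longrightarrow> (1 + x) ^ k * exp (- (m/2) * x) < 1"
    by (auto simp: eventually_at_top_linorder)
  define C where "C = max 1 ((1 + max x0 0) ^ k)"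
  have "(1 + x) ^ k * exp (- (m/2) * x) \<le> C" if "x \<ge> 0" for x
  proof (cases "x \<ge> x0")
    case True thus ?thesis unfolding C_def by (intro max.coboundedI1 less_imp_le[OF x0])
  next
    case False
    have "(1 + x) ^ k * exp (- (m/2) * x) \<le> (1 + max x0 0) ^ k * 1"
      using that False assms by (intro mult_mono power_mono) auto
    thus ?thesis by (auto simp: C_def)
  qed note C = this
  have "(1 + x) ^ k * exp (- m * x) \<le> C * exp (- (m / 2) * x)" if "x \<ge> 0" for x
  proof -
    have "(1 + x) ^ k * exp (- m * x) = ((1 + x) ^ k * exp (- (m/2) * x)) * exp (- (m / 2) * x)"
      by (simp add: mult_exp_exp)
    also have "\<dots> \<le> C * exp (- (m / 2) * x)"
      using C[OF that] by (intro mult_right_mono) auto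
    finally show ?thesis .
  qed
  moreover have "C \<ge> 0" by (simp add: C_def)
  ultimately show ?thesis by blast
qed

lemma integrable_poly_exp_abs:
  fixes m :: real assumes "m > 0"
  shows "integrable lborel (\<lambda>t::real. (1 + \<bar>t\<bar>) ^ k * exp (- m * \<bar>t\<bar>))"
proof -
  obtain C where C: "C \<ge> 0" "\<And>x. x \<ge> 0 \<Longrightarrow> (1 + x) ^ k * exp (- m * x) \<le> C * exp (- (m / 2) * x)"
    using poly_exp_le_exp[OF assms, of k] by blast
  have "integrable lborel (\<lambda>t::real. C * exp (- (m / 2) * \<bar>t\<bar>))"
    using integrable_exp_abs[of "m/2"] assms by simp
  thus ?thesis
    by (rule Bochner_Integration.integrable_bound) (use C in \<open>auto simp: abs_mult\<close>)
qed

text \<open>Equal to \<open>exp ((pi - s) t) / (2 cosh (pi t))\<close>. It replaces the Laplace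
  kernel \<open>exp (- s t)\<close> on \<open>t >= 0\<close> by an analytic one on the whole line;
  for \<open>s\<close> in \<open>small_sector\<close> the two differ by at most
  \<open>exp (- pi |t|)\<close>.\<close>

definition sech_kernel :: "complex \<Rightarrow> real \<Rightarrow> complex" where
  "sech_kernel s t = exp (- s * of_real t) / (1 + exp (- 2 * of_real pi * of_real t))"

lemma one_plus_exp_real_neq_0: "1 + exp (- 2 * of_real pi * of_real t :: complex) \<noteq> 0"
proof -
  have "1 + exp (- 2 * of_real pi * of_real t :: complex) = of_real (1 + exp (- 2 * pi * t))"
    by (simp flip: exp_of_real)
  also have "\<dots> \<noteq> 0" using exp_gt_zero[of "- 2 * pi * t"] by (subst of_real_eq_0_iff) linarith
  finally show ?thesis .
qed

lemma norm_sech_kernel: "norm (sech_kernel s t) = exp (- Re s * t) / (1 + exp (- 2 * pi * t))"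
proof -
  have "1 + exp (- 2 * of_real pi * of_real t :: complex) = of_real (1 + exp (- 2 * pi * t))"
    by (simp flip: exp_of_real)
  moreover have "norm (of_real (1 + exp (- 2 * pi * t)) :: complex) = 1 + exp (- 2 * pi * t)"
    by (subst norm_of_real) (simp add: add_nonneg_nonneg)
  ultimately show ?thesis by (simp add: sech_kernel_def norm_divide)
qed

lemma norm_sech_kernel_le:
  assumes "0 < Re s" "Re s < 2 * pi"
  shows "norm (sech_kernel s t) \<le> exp (- min (Re s) (2 * pi - Re s) * \<bar>t\<bar>)"
proof (cases "t \<ge> 0")
  case True
  have "norm (sech_kernel s t) \<le> exp (- Re s * t) / 1"
    unfolding norm_sech_kernel by (intro divide_left_mono) (auto simp: add_pos_nonneg)
  also have "\<dots> \<le> exp (- min (Re s) (2 * pi - Re s) * \<bar>t\<bar>)"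
    using True by (auto simp: min_def intro!: mult_right_mono)
  finally show ?thesis .
next
  case False
  have "norm (sech_kernel s t) \<le> exp (- Re s * t) / exp (- 2 * pi * t)"
    unfolding norm_sech_kernel by (intro divide_left_mono) (auto intro!: mult_pos_pos add_pos_pos)
  also have "\<dots> = exp ((2 * pi - Re s) * t)"
    by (subst exp_diff [symmetric]) (simp add: algebra_simps)
  also have "\<dots> \<le> exp (- min (Re s) (2 * pi - Re s) * \<bar>t\<bar>)"
  proof -
    have "(2 * pi - Re s) * t \<le> min (Re s) (2 * pi - Re s) * t"
      using False by (intro mult_right_mono_neg) auto
    thus ?thesis using False by simp
  qed
  finally show ?thesis .
qed

lemma continuous_sech_kernel [continuous_intros]:
  "continuous_on A (\<lambda>t. sech_kernel s t)"
  unfolding sech_kernel_def by (intro continuous_intros ballI one_plus_exp_real_neq_0)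

lemma borel_measurable_sech_kernel [measurable]: "sech_kernel s \<in> borel_measurable borel"
  using continuous_sech_kernel[of UNIV s] by (intro borel_measurable_continuous_onI) simp

lemma integrable_poly_sech_kernel:
  assumes "0 < Re s" "Re s < 2 * pi"
  shows "integrable lborel (\<lambda>t. (1 + \<bar>t\<bar>) ^ k * norm (sech_kernel s t))"
proof -
  define m where "m = min (Re s) (2 * pi - Re s)"
  have "m > 0" using assms by (auto simp: m_def)
  show ?thesis
    by (rule Bochner_Integration.integrable_bound[OF integrable_poly_exp_abs[OF \<open>m > 0\<close>, of k]])
       (use norm_sech_kernel_le[OF assms] in \<open>auto simp: m_def abs_mult intro!: mult_left_mono\<close>)
qed

lemma integrable_sech_kernel:
  assumes "0 < Re s" "Re s < 2 * pi"
  shows "integrable lborel (sech_kernel s)"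
proof (rule integrable_norm_cancel)
  show "integrable lborel (\<lambda>t. norm (sech_kernel s t))"
    using integrable_poly_sech_kernel[OF assms, of 0] by simp
qed simp

text \<open>The integrand \<open>F\<close> satisfies \<open>F (z + \<i>) = exp (- s * \<i>) * F z\<close>, and its only pole in the strip
  \<open>0 \<le> Im z \<le> 1\<close> is \<open>\<i> / 2\<close>.\<close>

lemma integral_sech_kernel:
  assumes s: "0 < Re s" "Re s < 2 * pi"
  shows "(\<integral>t. sech_kernel s t \<partial>lborel) = 1 / (2 * sin (s / 2))"
proof -
  define F where "F = (\<lambda>z::complex. exp (- s * z) / (1 + exp (- 2 * of_real pi * z)))"
  define D where "D = {z::complex. 1 + exp (- 2 * of_real pi * z) = 0}"
  have D_iff: "z \<in> D \<longleftrightarrow> Re z = 0 \<and> (\<exists>k::int. Im z = of_int k + 1/2)" for z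
  proof -
    have "z \<in> D \<longleftrightarrow> exp (- 2 * of_real pi * z) = exp (of_real pi * \<i>)"
      by (auto simp: D_def add_eq_0_iff)
    also have "\<dots> \<longleftrightarrow> (\<exists>n::int. - 2 * of_real pi * z = of_real pi * \<i> + of_int (2 * n) * of_real pi * \<i>)"
      unfolding exp_eq by simp
    also have "\<dots> \<longleftrightarrow> (\<exists>n::int. Re z = 0 \<and> Im z = - of_int n - 1/2)"
    proof (intro ex_cong1)
      fix n :: int
      have "- 2 * of_real pi * z = of_real pi * \<i> + of_int (2 * n) * of_real pi * \<i> \<longleftrightarrow>
            Re z = 0 \<and> - 2 * pi * Im z = pi + 2 * of_int n * pi"
        by (simp add: complex_eq_iff)
      also have "- 2 * pi * Im z = pi + 2 * of_int n * pi \<longleftrightarrow> Im z = - of_int n - 1/2"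
      proof -
        have "- 2 * pi * Im z - (pi + 2 * of_int n * pi) = (-2 * pi) * (Im z - (- of_int n - 1/2))"
          by (simp add: algebra_simps)
        moreover have "(-2 * pi) * (Im z - (- of_int n - 1/2)) = 0 \<longleftrightarrow> Im z - (- of_int n - 1/2) = 0"
          unfolding mult_eq_0_iff by simp
        ultimately show ?thesis by (metis eq_iff_diff_eq_0)
      qed
      finally show "- 2 * of_real pi * z = of_real pi * \<i> + of_int (2 * n) * of_real pi * \<i> \<longleftrightarrow>
            Re z = 0 \<and> Im z = - of_int n - 1/2" .
    qed
    also have "\<dots> \<longleftrightarrow> Re z = 0 \<and> (\<exists>k::int. Im z = of_int k + 1/2)"
    proof -
      have "(\<exists>n::int. Im z = - of_int n - 1/2) \<longleftrightarrow> (\<exists>k::int. Im z = of_int k + 1/2)" 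
      proof safe
        fix n :: int assume "Im z = - of_int n - 1/2"
        thus "\<exists>k::int. Im z = of_int k + 1/2" by (intro exI[of _ "-n-1"]) simp
      next
        fix n :: int assume "Im z = of_int n + 1/2"
        thus "\<exists>n::int. Im z = - of_int n - 1/2" by (intro exI[of _ "-n-1"]) simp
      qed
      thus ?thesis by simp
    qed
    finally show ?thesis .
  qed
  \<comment> \<open>A margin of 1/4 around the strip leaves the neighbouring poles
    \<open>- \<i> / 2\<close> and \<open>3 \<i> / 2\<close> outside.\<close>
  define S where "S = {z::complex. Im z < 5/4} \<inter> {z. Im z > -1/4}"
  have S_open: "open S" unfolding S_def by (intro open_Int open_halfspace_Im_lt open_halfspace_Im_gt)
  have S_conn: "connected S" unfolding S_def
    by (intro convex_connected convex_Int convex_halfspace_Im_lt convex_halfspace_Im_gt)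
  have DS: "D \<inter> S = {\<i>/2}"
  proof -
    have "z = \<i>/2" if "z \<in> D" "z \<in> S" for z
    proof -
      from that obtain k :: int where k: "Re z = 0" "Im z = of_int k + 1/2" by (auto simp: D_iff)
      with that have "of_int k < (1::real)" "of_int k > (-1::real)" by (auto simp: S_def)
      hence "k = 0" by linarith
      thus ?thesis using k by (simp add: complex_eq_iff)
    qed
    moreover have "\<i>/2 \<in> D" by (subst D_iff) (auto intro!: exI[of _ 0])
    ultimately show ?thesis by (auto simp: S_def)
  qed
  have holo: "F holomorphic_on S - {\<i>/2}"
    unfolding F_def using DS by (intro holomorphic_intros) (auto simp: D_def)
  have res: "residue F (\<i>/2) = exp (- s * (\<i>/2)) / (2 * of_real pi)"
    unfolding F_def
  proof (rule residue_simple_pole_deriv[OF _ _ S_open S_conn])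
    show "((\<lambda>z. 1 + exp (- 2 * of_real pi * z)) has_field_derivative 2 * of_real pi) (at (\<i>/2))"
    proof -
      have "exp (- (of_real pi * \<i>)) = (-1::complex)" by (simp add: exp_minus)
      thus ?thesis by (auto intro!: derivative_eq_intros simp: exp_minus)
    qed
    have "\<i>/2 \<in> D" using DS by blast
    thus "1 + exp (- 2 * of_real pi * (\<i>/2)) = 0" unfolding D_def by (rule CollectD)
  qed (auto intro!: holomorphic_intros simp: S_def)
  define I where "I = (\<lambda>R. integral {-R..R} (\<lambda>t. F (of_real t)))"
  \<comment> \<open>The two horizontal sides combine to \<open>(1 - exp (- s * \<i>)) * I R\<close>,
    the subtracted term is \<open>2 pi \<i>\<close> times the residue, and the right-hand side
    bounds the two vertical sides.\<close>
  have main: "norm ((1 - exp (- s * \<i>)) * I R - \<i> * exp (- s * (\<i>/2))) \<le>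
      exp (norm s) * (exp (- Re s * R) + exp (Re s * R) * exp (- 2 * pi * R)) / (1 - exp (- 2 * pi * R))" if R: "R > 0" for R
  proof -
    have "R * pi > 0" using R by simp
    hence pos1: "0 < 1 - exp (- 2 * pi * R)" and pos2: "0 < exp (2 * pi * R) - 1" by simp_all
    let ?a = "- of_real R :: complex" and ?b = "of_real R :: complex"
    let ?c = "of_real R + \<i>" and ?d = "- of_real R + \<i>"
    have rp: "rectpath ?a ?c = linepath ?a ?b +++ linepath ?b ?c +++ linepath ?c ?d +++ linepath ?d ?a"
      by (simp add: rectpath_def Let_def complex_eq_iff Complex_eq)
    have img: "path_image (rectpath ?a ?c) \<subseteq> S - {\<i>/2}"
      using R by (subst path_image_rectpath) (auto simp: S_def)
    have inbox: "\<i>/2 \<in> box ?a ?c" using R by (simp add: in_box_complex_iff)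
    have 1: "contour_integral (rectpath ?a ?c) F = 2 * pi * \<i> * (\<Sum>p\<in>{\<i>/2}. winding_number (rectpath ?a ?c) p * residue F p)"
    proof (rule Residue_theorem[OF S_open S_conn _ holo])
      show "\<forall>z. z \<notin> S \<longrightarrow> winding_number (rectpath ?a ?c) z = 0"
      proof safe
        fix z assume "z \<notin> S"
        thus "winding_number (rectpath ?a ?c) z = 0" using R
          by (intro winding_number_rectpath_outside) (auto simp: S_def in_cbox_complex_iff)
      qed
    qed (use img in auto)
    have seg: "closed_segment ?a ?b \<subseteq> S - {\<i>/2}" "closed_segment ?b ?c \<subseteq> S - {\<i>/2}" 
              "closed_segment ?c ?d \<subseteq> S - {\<i>/2}" "closed_segment ?d ?a \<subseteq> S - {\<i>/2}"
      using img unfolding rp by (auto simp: path_image_join)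
    have ci: "F contour_integrable_on linepath x y" if "closed_segment x y \<subseteq> S - {\<i>/2}" for x y
      by (intro contour_integrable_continuous_linepath holomorphic_on_imp_continuous_on holomorphic_on_subset[OF holo] that)
    have 2: "contour_integral (rectpath ?a ?c) F = contour_integral (linepath ?a ?b) F + contour_integral (linepath ?b ?c) F
         + contour_integral (linepath ?c ?d) F + contour_integral (linepath ?d ?a) F"
      unfolding rp using seg by (simp add: ci)
    have 3: "contour_integral (linepath ?a ?b) F = I R"
      using R by (subst contour_integral_linepath_Reals_eq) (auto simp: I_def)
    have shift: "F (z + \<i>) = exp (- s * \<i>) * F z" for z
    proof -
      have "exp (- 2 * of_real pi * (z + \<i>)) = exp (- 2 * of_real pi * z) * exp (-(2 * of_real pi * \<i>))"
        by (subst exp_add [symmetric]) (simp add: algebra_simps)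
      also have "exp (-(2 * of_real pi * \<i>)) = 1" by (simp add: exp_minus)
      finally show ?thesis
        unfolding F_def by (simp add: algebra_simps exp_diff exp_minus exp_add divide_simps)
    qed
    have 4: "contour_integral (linepath ?c ?d) F = - exp (- s * \<i>) * I R"
    proof -
      have "contour_integral (linepath ?d ?c) F = exp (- s * \<i>) * contour_integral (linepath ?a ?b) F"
      proof -
        have "contour_integral (linepath ?d ?c) F = integral {0..1} (\<lambda>x. F (linepath ?d ?c x) * (?c - ?d))"
          by (simp add: contour_integral_integral)
        also have "\<dots> = integral {0..1} (\<lambda>x. exp (- s * \<i>) * (F (linepath ?a ?b x) * (?b - ?a)))"
        proof (intro integral_cong)
          fix x :: real
          have "linepath ?d ?c x = linepath ?a ?b x + \<i>" by (simp add: linepath_def algebra_simps scaleR_conv_of_real)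
          thus "F (linepath ?d ?c x) * (?c - ?d) = exp (- s * \<i>) * (F (linepath ?a ?b x) * (?b - ?a))"
            by (simp only: shift) (simp add: algebra_simps)
        qed
        also have "\<dots> = exp (- s * \<i>) * contour_integral (linepath ?a ?b) F"
          by (simp add: contour_integral_integral)
        finally show ?thesis .
      qed
      moreover have "contour_integral (linepath ?c ?d) F = - contour_integral (linepath ?d ?c) F"
        by (rule contour_integral_reverse_linepath, rule continuous_on_subset[OF holomorphic_on_imp_continuous_on[OF holo] seg(3)])
      ultimately show ?thesis by (simp add: 3)
    qed
    have bnd: "norm (F z) \<le> exp (norm s) * exp (- Re s * Re z) * norm (1 / (1 + exp (- 2 * of_real pi * z)))" 
      if "Im z \<in> {0..1}" for z
    proof -
      have "\<bar>Im s * Im z\<bar> \<le> norm s * 1" unfolding abs_mult using that by (intro mult_mono abs_Im_le_cmod) auto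
      hence "exp (- Re s * Re z + Im s * Im z) \<le> exp (norm s + (- Re s * Re z))" by simp
      hence "norm (exp (- s * z)) \<le> exp (norm s) * exp (- Re s * Re z)" by (simp flip: exp_add)
      hence "norm (exp (- s * z)) / norm (1 + exp (- 2 * of_real pi * z)) \<le>
             exp (norm s) * exp (- Re s * Re z) / norm (1 + exp (- 2 * of_real pi * z))"
        by (intro divide_right_mono) auto
      thus ?thesis unfolding F_def norm_divide norm_one by (simp only: times_divide_eq_right mult_1_right)
    qed
    have 5: "norm (contour_integral (linepath ?b ?c) F) \<le> exp (norm s) * exp (- Re s * R) / (1 - exp (- 2 * pi * R))"
    proof -
      have "norm (contour_integral (linepath ?b ?c) F) \<le> exp (norm s) * exp (- Re s * R) / (1 - exp (- 2 * pi * R)) * norm (?c - ?b)"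
      proof (rule contour_integral_bound_linepath)
        fix z assume "z \<in> closed_segment ?b ?c"
        hence z: "Re z = R" "Im z \<in> {0..1}" by (auto simp: closed_segment_same_Re closed_segment_eq_real_ivl)
        have n: "1 - exp (- 2 * pi * R) \<le> norm (1 + exp (- 2 * of_real pi * z))"
          using norm_diff_ineq[of 1 "exp (- 2 * of_real pi * z)"] z by simp
        have "norm (1 / (1 + exp (- 2 * of_real pi * z))) \<le> 1 / (1 - exp (- 2 * pi * R))"
          unfolding norm_divide norm_one by (intro frac_le n) (use pos1 pos2 in auto)
        hence "exp (norm s) * exp (- Re s * Re z) * norm (1 / (1 + exp (- 2 * of_real pi * z))) \<le> exp (norm s) * exp (- Re s * R) * (1 / (1 - exp (- 2 * pi * R)))"
          using z by (intro mult_mono) (use pos1 in auto)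
        thus "norm (F z) \<le> exp (norm s) * exp (- Re s * R) / (1 - exp (- 2 * pi * R))" using bnd[OF z(2)] by simp
      qed (use pos1 ci seg in auto)
      thus ?thesis by simp
    qed
    have 6: "norm (contour_integral (linepath ?d ?a) F) \<le> exp (norm s) * (exp (Re s * R) * exp (- 2 * pi * R)) / (1 - exp (- 2 * pi * R))"
    proof -
      have "norm (contour_integral (linepath ?d ?a) F) \<le> exp (norm s) * (exp (Re s * R) * exp (- 2 * pi * R)) / (1 - exp (- 2 * pi * R)) * norm (?a - ?d)"
      proof (rule contour_integral_bound_linepath)
        fix z assume "z \<in> closed_segment ?d ?a"
        hence z: "Re z = -R" "Im z \<in> {0..1}" by (auto simp: closed_segment_same_Re closed_segment_eq_real_ivl)
        have n: "exp (2 * pi * R) - 1 \<le> norm (1 + exp (- 2 * of_real pi * z))"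
          using norm_diff_ineq[of "exp (- 2 * of_real pi * z)" 1] z by (simp add: add.commute)
        have "norm (1 / (1 + exp (- 2 * of_real pi * z))) \<le> 1 / (exp (2 * pi * R) - 1)"
          unfolding norm_divide norm_one by (intro frac_le n) (use pos1 pos2 in auto)
        also have "\<dots> = exp (- 2 * pi * R) / (1 - exp (- 2 * pi * R))"
          using R by (simp add: exp_minus field_simps)
        finally have "exp (norm s) * exp (- Re s * Re z) * norm (1 / (1 + exp (- 2 * of_real pi * z))) \<le> exp (norm s) * exp (Re s * R) * (exp (- 2 * pi * R) / (1 - exp (- 2 * pi * R)))"
          using z by (intro mult_mono) (use pos1 in auto)
        thus "norm (F z) \<le> exp (norm s) * (exp (Re s * R) * exp (- 2 * pi * R)) / (1 - exp (- 2 * pi * R))" using bnd[OF z(2)] by simp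
      qed (use pos1 ci seg in auto)
      thus ?thesis by simp
    qed
    have "(1 - exp (- s * \<i>)) * I R - \<i> * exp (- s * (\<i>/2)) = 
          - (contour_integral (linepath ?b ?c) F + contour_integral (linepath ?d ?a) F)"
    proof -
      have "contour_integral (rectpath ?a ?c) F = \<i> * exp (- s * (\<i>/2))"
      proof -
        have w: "(\<Sum>p\<in>{\<i>/2}. winding_number (rectpath ?a ?c) p * residue F p) = residue F (\<i>/2)"
          using winding_number_rectpath[OF inbox] by simp
        show ?thesis unfolding 1 w res by (simp add: field_simps)
      qed
      with 2 3 4 show ?thesis by (simp only: ring_distribs) (simp add: algebra_simps)
    qed
    also have "norm \<dots> \<le> exp (norm s) * exp (- Re s * R) / (1 - exp (- 2 * pi * R)) + 
      exp (norm s) * (exp (Re s * R) * exp (- 2 * pi * R)) / (1 - exp (- 2 * pi * R))"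
      unfolding norm_minus_cancel using 5 6 by (rule norm_triangle_le[OF add_mono])
    finally show ?thesis by (simp add: add_divide_distrib distrib_left)
  qed
  have lim1: "((\<lambda>R. exp (norm s) * (exp (- Re s * R) + exp (Re s * R) * exp (- 2 * pi * R)) / (1 - exp (- 2 * pi * R))) \<longlongrightarrow> 0) at_top"
  proof -
    have "((\<lambda>R. exp (norm s) * (exp (- Re s * R) + exp (- (2 * pi - Re s) * R)) / (1 - exp (- 2 * pi * R))) \<longlongrightarrow> exp (norm s) * (0 + 0) / (1 - 0)) at_top"
      by (intro tendsto_intros) (use s in \<open>(real_asymp | simp)\<close>)+
    moreover have "exp (Re s * R) * exp (- 2 * pi * R) = exp (- (2 * pi - Re s) * R)" for R
      by (simp flip: exp_add add: algebra_simps)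
    ultimately show ?thesis by simp
  qed
  have "((\<lambda>R. (1 - exp (- s * \<i>)) * I R - \<i> * exp (- s * (\<i>/2))) \<longlongrightarrow> 0) at_top"
    by (rule Lim_null_comparison[OF _ lim1]) (use main in \<open>auto intro!: eventually_mono[OF eventually_gt_at_top[of 0]]\<close>)
  hence lim2: "((\<lambda>R. (1 - exp (- s * \<i>)) * I R) \<longlongrightarrow> \<i> * exp (- s * (\<i>/2))) at_top"
    by (simp add: LIM_zero_iff)
  have FK: "F (of_real t) = sech_kernel s t" for t by (simp add: F_def sech_kernel_def)
  have int: "integrable lborel (sech_kernel s)" by (rule integrable_sech_kernel[OF s])
  have "((\<lambda>R. \<integral>t. indicator {-R..R} t *\<^sub>R sech_kernel s t \<partial>lborel) \<longlongrightarrow> (\<integral>t. sech_kernel s t \<partial>lborel)) at_top"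
  proof (rule integral_dominated_convergence_at_top[where w = "\<lambda>t. norm (sech_kernel s t)"])
    show "AE t in lborel. ((\<lambda>R. indicator {-R..R} t *\<^sub>R sech_kernel s t) \<longlongrightarrow> sech_kernel s t) at_top"
    proof (intro AE_I2 tendsto_eventually)
      fix t show "\<forall>\<^sub>F R in at_top. indicator {-R..R} t *\<^sub>R sech_kernel s t = sech_kernel s t"
        by (rule eventually_mono[OF eventually_ge_at_top[of "\<bar>t\<bar>"]]) (auto simp: indicator_def)
    qed
  qed (use int in \<open>auto simp: indicator_def\<close>)
  also have "(\<lambda>R. \<integral>t. indicator {-R..R} t *\<^sub>R sech_kernel s t \<partial>lborel) = I"
  proof
    fix R :: real
    have "set_integrable lborel {-R..R} (sech_kernel s)"
      using integrable_mult_indicator[OF _ int, of "{-R..R}"] by (simp add: set_integrable_def)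
    from set_borel_integral_eq_integral(2)[OF this]
    show "(\<integral>t. indicator {-R..R} t *\<^sub>R sech_kernel s t \<partial>lborel) = I R"
      by (simp add: I_def FK set_lebesgue_integral_def)
  qed
  finally have "((\<lambda>R. (1 - exp (- s * \<i>)) * I R) \<longlongrightarrow> (1 - exp (- s * \<i>)) * (\<integral>t. sech_kernel s t \<partial>lborel)) at_top"
    by (intro tendsto_intros)
  from tendsto_unique[OF _ this lim2] have eq: "(1 - exp (- s * \<i>)) * (\<integral>t. sech_kernel s t \<partial>lborel) = \<i> * exp (- s * (\<i>/2))" by simp
  have "1 - exp (- s * \<i>) = 2 * \<i> * exp (- s * (\<i>/2)) * sin (s/2)"
  proof -
    have e1: "exp (- s * (\<i>/2)) * exp (\<i> * (s/2)) = 1" by (simp flip: exp_add)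
    have e2: "exp (- s * (\<i>/2)) * exp (- (\<i> * (s/2))) = exp (- s * \<i>)" by (simp flip: exp_add add: field_simps)
    have "2 * \<i> * exp (- s * (\<i>/2)) * sin (s/2) = exp (- s * (\<i>/2)) * exp (\<i> * (s/2)) - exp (- s * (\<i>/2)) * exp (- (\<i> * (s/2)))"
    proof -
      have "2 * \<i> * A * ((E1 - E2) / (2 * \<i>)) = A * E1 - A * E2" for A E1 E2 :: complex
        by (simp add: field_simps)
      thus ?thesis unfolding sin_exp_eq .
    qed
    thus ?thesis unfolding e1 e2 by simp
  qed
  with eq have "2 * sin (s/2) * (\<integral>t. sech_kernel s t \<partial>lborel) = 1" by (simp add: mult.assoc)
  \<comment> \<open>A product equal to 1 has no vanishing factor, so \<open>sin (s / 2)\<close>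
    needs no argument of its own.\<close>
  moreover from this have "2 * sin (s/2) \<noteq> 0" by fastforce
  ultimately show ?thesis by (intro eq_divide_imp) (simp_all add: mult_ac)
qed

section \<open>A Tauberian comparison theorem\<close>

definition poisson_density :: "nat \<Rightarrow> real \<Rightarrow> real" where
  "poisson_density j u = exp (- u) * (u ^ j / fact j)"

text \<open>The probability that a Poisson variable of mean \<open>u\<close> is at most
  \<open>m\<close>. As a function of \<open>u\<close> it is a smooth step that falls from 1 to 0
  near \<open>u = m\<close>, so the integral of \<open>poisson_cdf m (s * X)\<close> is a smoothed
  version of \<open>cumul\<close> at \<open>m / s\<close>.\<close>

definition poisson_cdf :: "nat \<Rightarrow> real \<Rightarrow> real" where
  "poisson_cdf m u = (\<Sum>j\<le>m. poisson_density j u)"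

lemma poisson_density_nonneg: "u \<ge> 0 \<Longrightarrow> poisson_density j u \<ge> 0"
  by (simp add: poisson_density_def)

lemma exp_sums_real: "(\<lambda>j. u ^ j / fact j) sums exp (u::real)"
  using exp_converges[of u] by (simp add: scaleR_conv_of_real divide_inverse mult_ac)

lemma sum_exp_series_le:
  assumes "u \<ge> (0::real)"
  shows "(\<Sum>j\<le>m. u ^ j / fact j) \<le> exp u"
proof -
  have "(\<Sum>j\<in>{..m}. u ^ j / fact j) \<le> (\<Sum>j. u ^ j / fact j)"
    by (rule sum_le_suminf) (use exp_sums_real[of u] assms in \<open>auto simp: sums_iff\<close>)
  thus ?thesis using exp_sums_real[of u] by (simp add: sums_iff)
qed

lemma poisson_cdf_nonneg: "u \<ge> 0 \<Longrightarrow> poisson_cdf m u \<ge> 0"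
  unfolding poisson_cdf_def by (intro sum_nonneg poisson_density_nonneg)

lemma poisson_cdf_eq: "poisson_cdf m u = exp (- u) * (\<Sum>j\<le>m. u ^ j / fact j)"
  by (simp add: poisson_cdf_def poisson_density_def sum_distrib_left)

lemma poisson_cdf_le_1:
  assumes "u \<ge> 0" shows "poisson_cdf m u \<le> 1"
proof -
  have "poisson_cdf m u \<le> exp (- u) * exp u"
    unfolding poisson_cdf_eq by (intro mult_left_mono sum_exp_series_le assms) auto
  thus ?thesis by (simp flip: exp_add)
qed

lemma poisson_density_le:
  assumes "u \<ge> 0" shows "poisson_density j u \<le> 2 ^ j * exp (- (u / 2))"
proof -
  have "(u / 2) ^ j / fact j \<le> (\<Sum>i\<le>j. (u / 2) ^ i / fact i)"
    using assms by (intro member_le_sum) auto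
  also have "\<dots> \<le> exp (u / 2)" using assms by (intro sum_exp_series_le) auto
  finally have "2 ^ j * ((u / 2) ^ j / fact j) * exp (- u) \<le> 2 ^ j * exp (u / 2) * exp (- u)"
    by (intro mult_right_mono mult_left_mono) auto
  moreover have "exp (u / 2) * exp (- u) = exp (- (u / 2))" by (simp flip: exp_add)
  moreover have "2 ^ j * ((u / 2) ^ j / fact j) * exp (- u) = poisson_density j u"
    by (simp add: poisson_density_def power_divide)
  ultimately show ?thesis by (simp only: mult.assoc)
qed

text \<open>Chernoff bounds, with the exponential tilts \<open>1 + h\<close> and \<open>1 - h\<close>.\<close>

lemma poisson_cdf_lower:
  assumes u: "0 \<le> u" "u \<le> real m * (1 - 2 * h)" and h: "0 < h" "h \<le> 1/4"
  shows "1 - exp (- real m * h\<^sup>2) \<le> poisson_cdf m u"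
proof -
  define y where "y = 1 + h"
  have y: "y > 0" "y \<ge> 1" using h by (auto simp: y_def)
  have 1: "(\<lambda>j. u ^ j / fact j - (if j \<in> {..m} then u ^ j / fact j else 0)) sums (exp u - (\<Sum>j\<in>{..m}. u ^ j / fact j))"
    by (intro sums_diff exp_sums_real sums_If_finite_set) auto
  have 2: "(\<lambda>j. (u * y) ^ j / fact j / y ^ m) sums (exp (u * y) / y ^ m)"
    by (intro sums_divide exp_sums_real)
  have "exp u - (\<Sum>j\<in>{..m}. u ^ j / fact j) \<le> exp (u * y) / y ^ m"
  proof (rule sums_le[OF _ 1 2])
    fix j
    show "u ^ j / fact j - (if j \<in> {..m} then u ^ j / fact j else 0) \<le> (u * y) ^ j / fact j / y ^ m"
    proof (cases "j \<le> m")
      case True thus ?thesis using u y by simp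
    next
      case False
      hence "y ^ m \<le> y ^ j" using y by (intro power_increasing) auto
      hence "u ^ j / fact j * y ^ m \<le> u ^ j / fact j * y ^ j" using u by (intro mult_left_mono) auto
      thus ?thesis using False y by (simp add: power_mult_distrib pos_le_divide_eq)
    qed
  qed
  hence "exp (-u) * (exp u - (\<Sum>j\<in>{..m}. u ^ j / fact j)) \<le> exp (-u) * (exp (u * y) / y ^ m)"
    by (intro mult_left_mono) auto
  hence "1 - poisson_cdf m u \<le> exp (-u) * (exp (u * y) / y ^ m)"
    by (simp add: poisson_cdf_eq right_diff_distrib flip: exp_add)
  also have "y ^ m = exp (real m * ln y)" using y by (simp add: exp_of_nat_mult)
  also have "exp (-u) * (exp (u * y) / exp (real m * ln y)) = exp (u * h - real m * ln y)"
    by (simp add: y_def exp_diff[symmetric] flip: exp_add) (simp add: algebra_simps)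
  also have "\<dots> \<le> exp (- real m * h\<^sup>2)"
  proof -
    have "real m * (h - h\<^sup>2) \<le> real m * ln y"
      using ln_one_plus_pos_lower_bound[of h] h unfolding y_def by (intro mult_left_mono) auto
    moreover have "u * h \<le> real m * (1 - 2 * h) * h" using u h by (intro mult_right_mono) auto
    ultimately show ?thesis by (simp add: algebra_simps power2_eq_square)
  qed
  finally show ?thesis by simp
qed

text \<open>Half of the Chernoff exponent is kept as decay in \<open>u\<close>: integrated over
  \<open>u = s * X\<close>, that factor becomes a Laplace transform at \<open>s * h^2 / 4\<close>,
  while the half in \<open>m\<close> makes the tail small.\<close>

lemma poisson_cdf_upper:
  assumes u: "u \<ge> real m * (1 + 3 * h)" and h: "0 < h" "h \<le> 1/4"
  shows "poisson_cdf m u \<le> exp (- real m * h\<^sup>2 / 4) * exp (- u * h\<^sup>2 / 4)"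
proof -
  define y where "y = 1 - h"
  have y: "y > 0" "y \<le> 1" using h by (auto simp: y_def)
  have m0: "real m * (1 + 3 * h) \<ge> real m" using h by (simp add: algebra_simps)
  have u0: "u \<ge> 0" "u \<ge> real m" using u m0 by linarith+
  have "(\<Sum>j\<le>m. u ^ j / fact j) \<le> (\<Sum>j\<le>m. (u * y) ^ j / fact j / y ^ m)"
  proof (rule sum_mono)
    fix j assume "j \<in> {..m}"
    hence "y ^ m \<le> y ^ j" using y by (intro power_decreasing) auto
    hence "u ^ j / fact j * y ^ m \<le> u ^ j / fact j * y ^ j" using u0 by (intro mult_left_mono) auto
    thus "u ^ j / fact j \<le> (u * y) ^ j / fact j / y ^ m"
      using y by (simp add: power_mult_distrib pos_le_divide_eq)
  qed
  also have "\<dots> = (\<Sum>j\<le>m. (u * y) ^ j / fact j) / y ^ m" by (simp add: sum_divide_distrib)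
  also have "\<dots> \<le> exp (u * y) / y ^ m"
    using u0 y by (intro divide_right_mono sum_exp_series_le) auto
  finally have "poisson_cdf m u \<le> exp (-u) * (exp (u * y) / y ^ m)"
    unfolding poisson_cdf_eq by (intro mult_left_mono) auto
  also have "y ^ m = exp (real m * ln y)" using y by (simp add: exp_of_nat_mult)
  also have "exp (-u) * (exp (u * y) / exp (real m * ln y)) = exp (- u * h - real m * ln y)"
    by (simp add: y_def exp_diff[symmetric] flip: exp_add) (simp add: algebra_simps)
  also have "\<dots> \<le> exp (- real m * h\<^sup>2 / 4 - u * h\<^sup>2 / 4)"
  proof -
    \<comment> \<open>For \<open>h <= 1/4\<close> the tail \<open>h^2 / (1 - h)\<close> of the
      geometric series is at most \<open>4/3 * h^2\<close>.\<close>
    have "- ln y \<le> h + 4/3 * h\<^sup>2"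
    proof -
      have "- ln y = ln (1 / y)" using y by (simp add: ln_div)
      also have "\<dots> \<le> 1 / y - 1" using y by (intro ln_le_minus_one) auto
      also have "\<dots> \<le> h + 4/3 * h\<^sup>2"
      proof -
        have "1 / y \<le> 1 + h + 4/3 * h\<^sup>2"
        proof (subst pos_divide_le_eq)
          have "(1 + h + 4/3 * h\<^sup>2) * y = 1 + h\<^sup>2 * (1/3 - 4/3 * h)"
            by (simp add: y_def field_simps power2_eq_square)
          moreover have "h\<^sup>2 * (1/3 - 4/3 * h) \<ge> 0" using h by (intro mult_nonneg_nonneg) auto
          ultimately show "1 \<le> (1 + h + 4/3 * h\<^sup>2) * y" by linarith
        qed (use y in auto)
        thus ?thesis by simp
      qed
      finally show ?thesis .
    qed
    hence "real m * (- ln y) \<le> real m * (h + 4/3 * h\<^sup>2)" by (intro mult_left_mono) auto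
    \<comment> \<open>The quadratic coefficient is \<open>3 - 1/2\<close> on the right against
      \<open>4/3\<close> on the left, and the difference \<open>7/6\<close> outweighs the cubic
      term. This is what the margin \<open>3 * h\<close> is for.\<close>
    also have "\<dots> \<le> real m * ((1 + 3 * h) * (h - h\<^sup>2 / 2))"
    proof (intro mult_left_mono)
      have "(1 + 3 * h) * (h - h\<^sup>2 / 2) - (h + 4/3 * h\<^sup>2) = h\<^sup>2 * (7/6 - 3/2 * h)"
        by (simp add: algebra_simps power2_eq_square)
      moreover have "h\<^sup>2 * (7/6 - 3/2 * h) \<ge> 0" using h by (intro mult_nonneg_nonneg) auto
      ultimately show "h + 4/3 * h\<^sup>2 \<le> (1 + 3 * h) * (h - h\<^sup>2 / 2)" by linarith
    qed auto
    also have "\<dots> = (real m * (1 + 3 * h)) * (h - h\<^sup>2 / 2)" by simp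
    also have "\<dots> \<le> u * (h - h\<^sup>2 / 2)"
    proof (rule mult_right_mono[OF u])
      have "h * (1 - h / 2) \<ge> 0" using h by (intro mult_nonneg_nonneg) auto
      thus "0 \<le> h - h\<^sup>2 / 2" by (simp add: algebra_simps power2_eq_square)
    qed
    finally have "- u * h - real m * ln y \<le> - u * (h\<^sup>2 / 2)" by (simp add: algebra_simps)
    moreover have "real m * (h\<^sup>2 / 4) \<le> u * (h\<^sup>2 / 4)" using u0 by (intro mult_right_mono) auto
    ultimately show ?thesis by (simp add: algebra_simps)
  qed
  also have "\<dots> = exp (- real m * h\<^sup>2 / 4) * exp (- u * h\<^sup>2 / 4)"
    by (simp flip: exp_add)
  finally show ?thesis .
qed

section \<open>Laplace transforms and distribution functions of a measure\<close>

definition lap :: "'a measure \<Rightarrow> ('a \<Rightarrow> real) \<Rightarrow> complex \<Rightarrow> complex" where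
  "lap M X z = (\<integral>x. exp (- z * of_real (X x)) \<partial>M)"

definition cumul :: "'a measure \<Rightarrow> ('a \<Rightarrow> real) \<Rightarrow> real \<Rightarrow> real" where
  "cumul M X T = measure M {x \<in> space M. X x \<le> T}"

locale laplace_measure =
  fixes M :: "'a measure" and X :: "'a \<Rightarrow> real"
  \<comment> \<open>Using a measure with a nonnegative observable, instead of a measure on the
    half-line, lets a density on the line, pairs of factors and harmonic weights share one
    theory.\<close>
  assumes X_meas [measurable]: "X \<in> borel_measurable M"
  assumes X_nonneg: "\<And>x. X x \<ge> 0"
  assumes int_exp: "\<And>s. s > 0 \<Longrightarrow> integrable M (\<lambda>x. exp (- s * X x))"
begin

lemma lap_of_real:
  "lap M X (of_real s) = of_real (\<integral>x. exp (- s * X x) \<partial>M)"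
proof -
  have "lap M X (of_real s) = (\<integral>x. of_real (exp (- s * X x)) \<partial>M)"
    unfolding lap_def by (simp flip: exp_of_real)
  thus ?thesis by simp
qed

text \<open>Markov's inequality with the weight \<open>exp (T - X)\<close>.\<close>

lemma emeasure_le_finite:
  "emeasure M {x \<in> space M. X x \<le> T} < \<infinity>"
proof -
  have "emeasure M {x \<in> space M. X x \<le> T} = (\<integral>\<^sup>+x. indicator {x \<in> space M. X x \<le> T} x \<partial>M)" by simp
  also have "\<dots> \<le> (\<integral>\<^sup>+x. ennreal (exp T * exp (- 1 * X x)) \<partial>M)"
    by (intro nn_integral_mono) (auto simp: indicator_def ennreal_1[symmetric] simp del: ennreal_1 simp flip: exp_add intro!: ennreal_leI)
  also have "\<dots> < \<infinity>"
  proof -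
    have "integrable M (\<lambda>x. exp T * exp (- 1 * X x))" by (intro integrable_mult_right int_exp) auto
    thus ?thesis by (subst (asm) integrable_iff_bounded) (auto simp: abs_mult)
  qed
  finally show ?thesis .
qed

lemma integrable_indicator_le: "integrable M (indicator {x \<in> space M. X x \<le> T} :: _ \<Rightarrow> real)"
  using emeasure_le_finite by (intro integrable_real_indicator) auto

lemma cumul_eq_integral: "cumul M X T = (\<integral>x. indicator {x \<in> space M. X x \<le> T} x \<partial>M)"
  unfolding cumul_def by simp

lemma integrable_poisson_density:
  assumes "s > 0"
  shows "integrable M (\<lambda>x. poisson_density j (s * X x))"
proof -
  have "integrable M (\<lambda>x. 2 ^ j * exp (- (s / 2) * X x))" using int_exp[of "s/2"] assms by simp
  thus ?thesis
  proof (rule Bochner_Integration.integrable_bound)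
    show "(\<lambda>x. poisson_density j (s * X x)) \<in> borel_measurable M"
      unfolding poisson_density_def by measurable
    show "AE x in M. norm (poisson_density j (s * X x)) \<le> norm (2 ^ j * exp (- (s / 2) * X x))"
      using poisson_density_le[of "s * X _" j] poisson_density_nonneg[of "s * X _" j] assms X_nonneg
      by (intro AE_I2) (simp add: abs_mult)
  qed
qed

definition coef :: "real \<Rightarrow> nat \<Rightarrow> real" where
  "coef s j = (\<integral>x. poisson_density j (s * X x) \<partial>M)"

text \<open>Expanding the second factor of \<open>exp (- s X) * exp (s w X)\<close> exhibits the
  Poisson averages as Taylor coefficients in \<open>w\<close>, where Cauchy's estimate reaches them.
  For \<open>|w| < 1\<close> the absolute values sum to \<open>exp (- s (1 - |w|) X)\<close>, which
  is integrable.\<close>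

lemma lap_power_series:
  assumes s: "s > 0" and w: "norm w < 1"
  shows "(\<lambda>j. of_real (coef s j) * w ^ j) sums lap M X (of_real s * (1 - w))"
proof -
  let ?f = "\<lambda>j x. of_real (poisson_density j (s * X x)) * w ^ j"
  have sX: "s * X x \<ge> 0" for x using s X_nonneg by simp
  have nrm: "norm (?f j x) = poisson_density j (s * X x) * norm w ^ j" for j x
    using poisson_density_nonneg[OF sX] by (simp add: norm_mult norm_power)
  have pt: "(\<lambda>j. ?f j x) sums exp (- (of_real s * (1 - w)) * of_real (X x))" for x
  proof -
    let ?u = "of_real (s * X x) :: complex"
    have "(\<lambda>j. exp (- ?u) * ((?u * w) ^ j /\<^sub>R fact j)) sums (exp (- ?u) * exp (?u * w))"
      by (intro sums_mult exp_converges)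
    also have "(\<lambda>j. exp (- ?u) * ((?u * w) ^ j /\<^sub>R fact j)) = (\<lambda>j. ?f j x)"
      by (intro ext) (simp add: poisson_density_def scaleR_conv_of_real power_mult_distrib divide_inverse flip: exp_of_real)
    also have "exp (- ?u) * exp (?u * w) = exp (- (of_real s * (1 - w)) * of_real (X x))"
      by (simp flip: exp_add) (simp add: algebra_simps)
    finally show ?thesis .
  qed
  have int: "integrable M (?f j)" for j
    using integrable_poisson_density[OF s, of j] by (intro integrable_mult_left integrable_of_real) auto
  have "(\<lambda>j. \<integral>x. ?f j x \<partial>M) sums (\<integral>x. (\<Sum>j. ?f j x) \<partial>M)"
  proof (rule sums_integral[OF int])
    have e: "(\<lambda>j. norm (?f j x)) sums exp (- (s * (1 - norm w)) * X x)" for x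
    proof -
      have "(\<lambda>j. exp (- (s * X x)) * ((s * X x * norm w) ^ j / fact j)) sums (exp (- (s * X x)) * exp (s * X x * norm w))"
        by (intro sums_mult exp_sums_real)
      moreover have "norm (?f j x) = exp (- (s * X x)) * ((s * X x * norm w) ^ j / fact j)" for j
        unfolding nrm by (simp add: poisson_density_def power_mult_distrib)
      moreover have "exp (- (s * X x)) * exp (s * X x * norm w) = exp (- (s * (1 - norm w)) * X x)"
        by (simp flip: exp_add) (simp add: algebra_simps)
      ultimately show ?thesis by simp
    qed
    show "AE x in M. summable (\<lambda>j. norm (?f j x))" using e by (auto simp: sums_iff)
    show "summable (\<lambda>j. \<integral>x. norm (?f j x) \<partial>M)"
    proof (rule summableI_nonneg_bounded)
      fix n
      have "(\<Sum>j<n. \<integral>x. norm (?f j x) \<partial>M) = (\<integral>x. (\<Sum>j<n. norm (?f j x)) \<partial>M)"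
        using int by (subst Bochner_Integration.integral_sum) auto
      also have "\<dots> \<le> (\<integral>x. exp (- (s * (1 - norm w)) * X x) \<partial>M)"
      proof (rule integral_mono)
        show "integrable M (\<lambda>x. exp (- (s * (1 - norm w)) * X x))"
          using s w by (intro int_exp) auto
        fix x
        have "(\<Sum>j<n. norm (?f j x)) \<le> (\<Sum>j. norm (?f j x))"
          using e[of x] by (intro sum_le_suminf) (auto simp: sums_iff)
        thus "(\<Sum>j<n. norm (?f j x)) \<le> exp (- (s * (1 - norm w)) * X x)"
          using e[of x] by (simp add: sums_iff)
      qed (use int in auto)
      finally show "(\<Sum>j<n. \<integral>x. norm (?f j x) \<partial>M) \<le> (\<integral>x. exp (- (s * (1 - norm w)) * X x) \<partial>M)" .
    qed auto
  qed
  also have "(\<integral>x. (\<Sum>j. ?f j x) \<partial>M) = lap M X (of_real s * (1 - w))"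
    unfolding lap_def using pt by (simp add: sums_iff)
  also have "(\<lambda>j. \<integral>x. ?f j x \<partial>M) = (\<lambda>j. of_real (coef s j) * w ^ j)"
    using integrable_poisson_density[OF s] by (simp add: coef_def)
  finally show ?thesis .
qed

lemma sum_coef: "s > 0 \<Longrightarrow> (\<Sum>j\<le>m. coef s j) = (\<integral>x. poisson_cdf m (s * X x) \<partial>M)"
  unfolding coef_def poisson_cdf_def
  by (subst Bochner_Integration.integral_sum) (auto intro: integrable_poisson_density)

lemma integrable_poisson_cdf: "s > 0 \<Longrightarrow> integrable M (\<lambda>x. poisson_cdf m (s * X x))"
  unfolding poisson_cdf_def by (intro Bochner_Integration.integrable_sum integrable_poisson_density)

text \<open>The scale \<open>s\<close> puts \<open>s * T\<close> at \<open>m * (1 - 2 * h)\<close>,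
  just below the step, so the Poisson weight is nearly 1 on all of \<open>X <= T\<close>.\<close>

lemma cumul_le_sum_coef:
  assumes T: "T > 0" and h: "0 < h" "h \<le> 1/4" and m: "m > 0"
  defines "s \<equiv> real m * (1 - 2 * h) / T"
  shows "cumul M X T * (1 - exp (- real m * h\<^sup>2)) \<le> (\<Sum>j\<le>m. coef s j)"
proof -
  have s: "s > 0" using assms by (auto simp: s_def intro!: divide_pos_pos mult_pos_pos)
  have "cumul M X T * (1 - exp (- real m * h\<^sup>2)) = (\<integral>x. indicator {x \<in> space M. X x \<le> T} x * (1 - exp (- real m * h\<^sup>2)) \<partial>M)"
    unfolding cumul_eq_integral using integrable_indicator_le by simp
  also have "\<dots> \<le> (\<integral>x. poisson_cdf m (s * X x) \<partial>M)"
  proof (rule integral_mono)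
    fix x assume x: "x \<in> space M"
    have sX: "s * X x \<ge> 0" using s X_nonneg by simp
    show "indicator {x \<in> space M. X x \<le> T} x * (1 - exp (- real m * h\<^sup>2)) \<le> poisson_cdf m (s * X x)"
    proof (cases "X x \<le> T")
      case True
      have "s * X x \<le> s * T" using True s by (intro mult_left_mono) auto
      also have "s * T = real m * (1 - 2 * h)" using T by (simp add: s_def)
      finally show ?thesis using poisson_cdf_lower[OF sX _ h] True x by (simp add: indicator_def)
    next
      case False thus ?thesis using poisson_cdf_nonneg[OF sX] by (simp add: indicator_def)
    qed
  qed (use integrable_indicator_le integrable_poisson_cdf s in auto)
  finally show ?thesis using sum_coef[OF s] by simp
qed

text \<open>At the same scale the step is over once \<open>s * X\<close> passes
  \<open>m * (1 + 3 * h)\<close>; this gives the quotient in front of \<open>T\<close>. Beyond it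
  the Chernoff decay integrates to a Laplace transform.\<close>

lemma sum_coef_le_cumul:
  assumes T: "T > 0" and h: "0 < h" "h \<le> 1/4" and m: "m > 0"
  defines "s \<equiv> real m * (1 - 2 * h) / T"
  shows "(\<Sum>j\<le>m. coef s j) \<le> cumul M X ((1 + 3 * h) / (1 - 2 * h) * T) +
     exp (- real m * h\<^sup>2 / 4) * Re (lap M X (of_real (s * h\<^sup>2 / 4)))"
proof -
  have s: "s > 0" using assms by (auto simp: s_def intro!: divide_pos_pos mult_pos_pos)
  define T' where "T' = (1 + 3 * h) / (1 - 2 * h) * T"
  have sT': "s * T' = real m * (1 + 3 * h)" using T h by (simp add: s_def T'_def)
  have i: "integrable M (\<lambda>x. exp (- (s * h\<^sup>2 / 4) * X x))" using s h by (intro int_exp) auto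
  have "(\<Sum>j\<le>m. coef s j) = (\<integral>x. poisson_cdf m (s * X x) \<partial>M)" by (rule sum_coef[OF s])
  also have "\<dots> \<le> (\<integral>x. indicator {x \<in> space M. X x \<le> T'} x + exp (- real m * h\<^sup>2 / 4) * exp (- (s * h\<^sup>2 / 4) * X x) \<partial>M)"
  proof (rule integral_mono)
    fix x assume x: "x \<in> space M"
    have sX: "s * X x \<ge> 0" using s X_nonneg by simp
    show "poisson_cdf m (s * X x) \<le> indicator {x \<in> space M. X x \<le> T'} x + exp (- real m * h\<^sup>2 / 4) * exp (- (s * h\<^sup>2 / 4) * X x)"
    proof (cases "X x \<le> T'")
      case True thus ?thesis using poisson_cdf_le_1[OF sX, of m] x by (simp add: indicator_def add_increasing2)
    next
      case False
      have "s * T' \<le> s * X x" using False s by (intro mult_left_mono) auto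
      hence "poisson_cdf m (s * X x) \<le> exp (- real m * h\<^sup>2 / 4) * exp (- (s * X x) * h\<^sup>2 / 4)"
        unfolding sT' by (intro poisson_cdf_upper h)
      also have "- (s * X x) * h\<^sup>2 / 4 = - (s * h\<^sup>2 / 4) * X x" by simp
      finally show ?thesis using False by (simp add: indicator_def)
    qed
  next
    show "integrable M (\<lambda>x. indicator {x \<in> space M. X x \<le> T'} x + exp (- real m * h\<^sup>2 / 4) * exp (- (s * h\<^sup>2 / 4) * X x))"
      using integrable_indicator_le i by (intro Bochner_Integration.integrable_add integrable_mult_right)
  qed (use integrable_poisson_cdf s in auto)
  also have "\<dots> = cumul M X T' + exp (- real m * h\<^sup>2 / 4) * (\<integral>x. exp (- (s * h\<^sup>2 / 4) * X x) \<partial>M)"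
    using integrable_indicator_le i by (subst Bochner_Integration.integral_add) (auto simp: cumul_eq_integral)
  finally show ?thesis unfolding lap_of_real Re_complex_of_real T'_def .
qed

end

section \<open>From complex Laplace transforms to distribution functions\<close>

lemma power_series_coeff_bound:
  fixes c :: "nat \<Rightarrow> complex"
  assumes g: "\<And>w. norm w < 1 \<Longrightarrow> (\<lambda>j. c j * w ^ j) sums g w"
    and r: "0 < r" "r < 1" and B: "\<And>w. norm w = r \<Longrightarrow> norm (g w) \<le> B"
  shows "norm (c n) \<le> B / r ^ n"
proof -
  have holo: "g holomorphic_on ball 0 1"
    by (rule power_series_holomorphic[where a = c]) (use g in auto)
  have "g has_fps_expansion (Abs_fps c)"
  proof (rule has_fps_expansionI)
    have "eventually (\<lambda>u::complex. u \<in> ball 0 1) (nhds 0)" by (intro eventually_nhds_in_open) auto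
    thus "eventually (\<lambda>u. (\<lambda>n. fps_nth (Abs_fps c) n * u ^ n) sums g u) (nhds 0)"
      by eventually_elim (use g in auto)
  qed
  from fps_nth_fps_expansion[OF this, of n] have "c n = (deriv ^^ n) g 0 / fact n" by simp
  moreover have "norm ((deriv ^^ n) g 0) \<le> fact n * B / r ^ n"
  proof (rule Cauchy_inequality)
    show "g holomorphic_on ball 0 r" "continuous_on (cball 0 r) g"
      using r by (auto intro!: holomorphic_on_subset[OF holo] holomorphic_on_imp_continuous_on)
  qed (use r B in \<open>auto simp: dist_norm\<close>)
  hence "norm ((deriv ^^ n) g 0) / fact n \<le> (fact n * B / r ^ n) / fact n"
    by (intro divide_right_mono) auto
  ultimately show ?thesis by (simp add: norm_divide)
qed

text \<open>The radius \<open>1 - 1/m\<close> is so close to 1 that dividing by its powers up to the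
  \<open>m\<close>-th costs no more than a constant.\<close>

lemma one_minus_inverse_power_ge:
  assumes "m \<ge> (2::nat)" "j \<le> m"
  shows "1 / (1 - 1 / real m) ^ j \<le> exp 2"
proof -
  have m: "1 / real m \<le> 1/2" "1 - 1 / real m > 0" using assms by (auto simp: field_simps)
  have "- (1 / real m) - 2 * (1 / real m)\<^sup>2 \<le> ln (1 - 1 / real m)"
    using m by (intro ln_one_minus_pos_lower_bound) auto
  hence "real m * (- (1 / real m) - 2 * (1 / real m)\<^sup>2) \<le> real m * ln (1 - 1 / real m)"
    by (intro mult_left_mono) auto
  also have "real m * (- (1 / real m) - 2 * (1 / real m)\<^sup>2) = -1 - 2 * (1 / real m)"
    using assms by (simp add: field_simps power2_eq_square)
  finally have "-2 \<le> real m * ln (1 - 1 / real m)" using m by linarith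
  hence "exp (-2) \<le> exp (real m * ln (1 - 1 / real m))" by simp
  also have "\<dots> = (1 - 1 / real m) ^ m" using m by (simp add: exp_of_nat_mult)
  also have "\<dots> \<le> (1 - 1 / real m) ^ j" using m assms by (intro power_decreasing) auto
  finally have "exp (-2) \<le> (1 - 1 / real m) ^ j" .
  hence "1 / (1 - 1 / real m) ^ j \<le> 1 / exp (-2)" using m by (intro divide_left_mono mult_pos_pos) auto
  thus ?thesis by (simp add: exp_minus divide_inverse)
qed

text \<open>On the circle of radius \<open>1 - 1/m\<close> the point \<open>z = s (1 - w)\<close>
  satisfies \<open>Re z >= s / m\<close> and \<open>|z| <= 2 s\<close>. There the hypothesis bounds
  the difference of the two power series, Cauchy's estimate passes this on to each of the
  \<open>m + 1\<close> coefficients, and the smoothed counts are sums of these.\<close>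

lemma cumul_compare:
  assumes A: "laplace_measure M1 X1" and B: "laplace_measure M2 X2"
    and E: "\<And>z. 0 < Re z \<Longrightarrow> norm z \<le> s0 \<Longrightarrow> norm (lap M1 X1 z - lap M2 X2 z) \<le> C * (norm z)\<^sup>2 / Re z powr (5/2)"
    and C: "C \<ge> 0"
    and T: "T > 0" and h: "0 < h" "h \<le> 1/4" and m: "m \<ge> 2" 
    and s_def: "s = real m * (1 - 2 * h) / T" and s: "2 * s \<le> s0"
  shows "cumul M1 X1 T * (1 - exp (- real m * h\<^sup>2)) \<le> cumul M2 X2 ((1 + 3 * h) / (1 - 2 * h) * T) +
     exp (- real m * h\<^sup>2 / 4) * Re (lap M2 X2 (of_real (s * h\<^sup>2 / 4))) +
     real (m + 1) * (exp 2 * (C * (2 * s)\<^sup>2 / (s / real m) powr (5/2)))"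
proof -
  interpret A: laplace_measure M1 X1 by fact
  interpret B: laplace_measure M2 X2 by fact
  have s0: "s > 0" using T h m by (auto simp: s_def intro!: divide_pos_pos mult_pos_pos)
  define r where "r = 1 - 1 / real m"
  have r: "0 < r" "r < 1" using m by (auto simp: r_def field_simps)
  define D where "D = C * (2 * s)\<^sup>2 / (s / real m) powr (5/2)"
  have D0: "D \<ge> 0" using C by (simp add: D_def)
  have cf: "\<bar>A.coef s j - B.coef s j\<bar> \<le> exp 2 * D" if "j \<le> m" for j
  proof -
    have "norm (of_real (A.coef s j - B.coef s j) :: complex) \<le> D / r ^ j"
    proof (rule power_series_coeff_bound[OF _ r])
      fix w :: complex assume "norm w < 1"
      from sums_diff[OF A.lap_power_series[OF s0 this] B.lap_power_series[OF s0 this]]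
      show "(\<lambda>j. of_real (A.coef s j - B.coef s j) * w ^ j) sums (lap M1 X1 (of_real s * (1 - w)) - lap M2 X2 (of_real s * (1 - w)))"
        by (simp add: algebra_simps)
    next
      fix w :: complex assume w: "norm w = r"
      let ?z = "of_real s * (1 - w)"
      have "Re w \<le> r" using complex_Re_le_cmod[of w] w by simp
      hence "1 / real m \<le> 1 - Re w" by (simp add: r_def)
      hence "s * (1 / real m) \<le> s * (1 - Re w)" using s0 by (intro mult_left_mono) auto
      hence Re: "s / real m \<le> Re ?z" by simp
      have p: "s / real m > 0" using s0 m by simp
      have "norm (1 - w) \<le> 1 + r" using norm_triangle_ineq4[of 1 w] w by simp
      also have "\<dots> \<le> 2" using r by simp
      finally have "s * norm (1 - w) \<le> s * 2" using s0 by (intro mult_left_mono) auto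
      hence nz: "norm ?z \<le> 2 * s" using s0 by (simp add: norm_mult)
      have "norm (lap M1 X1 ?z - lap M2 X2 ?z) \<le> C * (norm ?z)\<^sup>2 / Re ?z powr (5/2)"
        using Re p nz s by (intro E) auto
      also have "\<dots> \<le> D" unfolding D_def
        using Re p nz C m by (intro frac_le mult_left_mono power_mono powr_mono2 mult_nonneg_nonneg) auto
      finally show "norm (lap M1 X1 ?z - lap M2 X2 ?z) \<le> D" .
    qed
    also have "D / r ^ j = D * (1 / r ^ j)" by simp
    also have "\<dots> \<le> D * exp 2" unfolding r_def
      using D0 one_minus_inverse_power_ge[OF m that] by (intro mult_left_mono) auto
    finally show ?thesis by (simp only: norm_of_real mult.commute)
  qed
  have "cumul M1 X1 T * (1 - exp (- real m * h\<^sup>2)) \<le> (\<Sum>j\<le>m. A.coef s j)"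
    unfolding s_def by (rule A.cumul_le_sum_coef) (use T h m in auto)
  also have "\<dots> \<le> (\<Sum>j\<le>m. B.coef s j + exp 2 * D)"
    using cf by (intro sum_mono) (force simp: abs_le_iff)
  also have "\<dots> = (\<Sum>j\<le>m. B.coef s j) + real (m + 1) * (exp 2 * D)" by (simp add: sum.distrib)
  also have "(\<Sum>j\<le>m. B.coef s j) \<le> cumul M2 X2 ((1 + 3 * h) / (1 - 2 * h) * T) +
     exp (- real m * h\<^sup>2 / 4) * Re (lap M2 X2 (of_real (s * h\<^sup>2 / 4)))"
    unfolding s_def by (rule B.sum_coef_le_cumul) (use T h m in auto)
  finally show ?thesis by (simp add: D_def)
qed

text \<open>The quotient of the two margins at \<open>h = 1 / (ln S)^2\<close>. It exceeds 1 by
  \<open>O(1 / (ln S)^2)\<close>, so widening the window by it changes \<open>T ln T\<close> by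
  \<open>o(T)\<close> only.\<close>

definition window_ratio :: "real \<Rightarrow> real" where
  "window_ratio S = (1 + 3 * (1 / (ln S)\<^sup>2)) / (1 - 2 * (1 / (ln S)\<^sup>2))"

text \<open>The parameters are \<open>h = 1 / (ln S)^2\<close> and \<open>m\<close> about
  \<open>(ln S)^6\<close>. Then \<open>m h^2 >= (ln S)^2\<close> makes the Poisson tails smaller
  than any power of \<open>S\<close>, while the coefficient errors add up to \<open>sqrt S\<close>
  times a power of \<open>ln S\<close>. The parameters depend on \<open>S\<close> alone while
  \<open>T\<close> varies in \<open>[S/2, S]\<close>, so the bound can be used at
  \<open>T = S\<close> and at \<open>T = S / window_ratio S\<close> alike.\<close>

lemma cumul_compare_eventually:
  assumes A: "laplace_measure M1 X1" and B: "laplace_measure M2 X2"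
    and E: "\<And>z. 0 < Re z \<Longrightarrow> norm z \<le> s0 \<Longrightarrow> norm (lap M1 X1 z - lap M2 X2 z) \<le> C * (norm z)\<^sup>2 / Re z powr (5/2)"
    and C: "C \<ge> 0" and s0: "s0 > 0"
    and L2: "\<And>s. 0 < s \<Longrightarrow> s \<le> s0 \<Longrightarrow> Re (lap M2 X2 (of_real s)) \<le> D / s ^ 3" and D: "D \<ge> 0"
  shows "\<exists>\<eta>. (\<eta> \<longlongrightarrow> 0) at_top \<and> (\<forall>\<^sub>F S in at_top. \<forall>T. S / 2 \<le> T \<and> T \<le> S \<longrightarrow>
     cumul M1 X1 T * (1 - exp (- (ln S)\<^sup>2)) \<le> cumul M2 X2 (window_ratio S * T) + \<eta> S * S)"
proof -
  interpret B: laplace_measure M2 X2 by fact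
  \<comment> \<open>The first term is the Chernoff tail times the cubic bound for the Laplace
    transform, divided by \<open>S\<close>; the second is the sum of the coefficient errors, divided
    by \<open>S\<close>.\<close>
  define \<eta> where "\<eta> = (\<lambda>S::real. D * (exp (- (ln S)\<^sup>2 / 4) * S\<^sup>2) + (4 * C * exp 2) * ((ln S ^ 6 + 2) ^ 3 * sqrt (2 * S) / S))"
  have "(\<eta> \<longlongrightarrow> D * 0 + (4 * C * exp 2) * 0) at_top"
    unfolding \<eta>_def by (intro tendsto_add tendsto_mult tendsto_const) real_asymp+
  hence lim: "(\<eta> \<longlongrightarrow> 0) at_top" by simp
  have "((\<lambda>S::real. 4 * (ln S ^ 6 + 1) / S) \<longlongrightarrow> 0) at_top" by real_asymp
  hence ev1: "\<forall>\<^sub>F S in at_top. 4 * (ln S ^ 6 + 1) / S < s0" using s0 by (rule order_tendstoD)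
  \<comment> \<open>The bound 8 yields \<open>h <= 1/8\<close> and
    \<open>s * h^2 / 4 >= 1 / S\<close>, an argument at which the cubic bound is affordable.\<close>
  have ev2: "\<forall>\<^sub>F S::real in at_top. (ln S)\<^sup>2 \<ge> 8" by real_asymp
  have ev3: "\<forall>\<^sub>F S::real in at_top. ln S \<ge> 1" by real_asymp
  have ev4: "\<forall>\<^sub>F S::real in at_top. ln S ^ 6 \<ge> 2" by real_asymp
  have "\<forall>\<^sub>F S in at_top. \<forall>T. S / 2 \<le> T \<and> T \<le> S \<longrightarrow>
     cumul M1 X1 T * (1 - exp (- (ln S)\<^sup>2)) \<le> cumul M2 X2 (window_ratio S * T) + \<eta> S * S"
    using ev1 ev2 ev3 ev4 eventually_gt_at_top[of 1]
  proof eventually_elim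
    case (elim S)
    show ?case
    proof (intro allI impI)
      fix T assume T: "S / 2 \<le> T \<and> T \<le> S"
      have Tpos: "T > 0" using T elim by simp
      define h where "h = 1 / (ln S)\<^sup>2"
      have h: "0 < h" "h \<le> 1/8" using elim by (auto simp: h_def field_simps)
      define m where "m = nat \<lceil>ln S ^ 6\<rceil>"
      have m1: "ln S ^ 6 \<le> real m" unfolding m_def by linarith
      have m2: "real m \<le> ln S ^ 6 + 1" unfolding m_def using elim by linarith
      have m3: "real m \<ge> 2" using m1 elim by linarith
      have m: "m \<ge> 2" using m3 by linarith
      define s where "s = real m * (1 - 2 * h) / T"
      have spos: "s > 0" using Tpos h m by (auto simp: s_def intro!: divide_pos_pos mult_pos_pos)
      have sm_ge: "s / real m \<ge> 1 / (2 * S)"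
      proof -
        have "1 / (2 * S) = (1/2) / S" by simp
        also have "\<dots> \<le> (1 - 2 * h) / T" using h T Tpos elim by (intro frac_le) auto
        also have "\<dots> = s / real m" using m by (simp add: s_def)
        finally show ?thesis .
      qed
      have s_le: "s \<le> 2 * real m / S"
      proof -
        have "s \<le> real m * 1 / (S / 2)" unfolding s_def using h T Tpos elim
          by (intro frac_le mult_left_mono mult_nonneg_nonneg) auto
        thus ?thesis by (simp add: field_simps)
      qed
      have s2: "2 * s \<le> s0"
      proof -
        have "2 * s \<le> 4 * real m / S" using s_le by simp
        also have "\<dots> \<le> 4 * (ln S ^ 6 + 1) / S" using m2 elim by (intro divide_right_mono) auto
        finally show ?thesis using elim by linarith
      qed
      have mh: "(ln S)\<^sup>2 \<le> real m * h\<^sup>2"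
      proof -
        have "(ln S)\<^sup>2 = ln S ^ 6 * h\<^sup>2" using elim by (simp add: h_def field_simps flip: power_add power_mult)
        also have "\<dots> \<le> real m * h\<^sup>2" using m1 by (intro mult_right_mono) auto
        finally show ?thesis .
      qed
      have main: "cumul M1 X1 T * (1 - exp (- real m * h\<^sup>2)) \<le> cumul M2 X2 ((1 + 3 * h) / (1 - 2 * h) * T) +
        exp (- real m * h\<^sup>2 / 4) * Re (lap M2 X2 (of_real (s * h\<^sup>2 / 4))) +
        real (m + 1) * (exp 2 * (C * (2 * s)\<^sup>2 / (s / real m) powr (5/2)))"
        by (rule cumul_compare[OF A B E C Tpos _ _ m s_def s2]) (use h in auto)
      have 1: "cumul M1 X1 T * (1 - exp (- (ln S)\<^sup>2)) \<le> cumul M1 X1 T * (1 - exp (- real m * h\<^sup>2))"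
        using mh by (intro mult_left_mono) (auto simp: cumul_def)
      have 2: "exp (- real m * h\<^sup>2 / 4) * Re (lap M2 X2 (of_real (s * h\<^sup>2 / 4))) \<le> exp (- (ln S)\<^sup>2 / 4) * (D * S ^ 3)"
      proof (intro mult_mono)
        have "1 / S \<le> (ln S)\<^sup>2 * (1 / (2 * S)) / 4" using elim by (simp add: field_simps)
        also have "\<dots> \<le> (real m * h\<^sup>2) * (s / real m) / 4"
          using mh sm_ge elim by (intro divide_right_mono mult_mono) auto
        also have "\<dots> = s * h\<^sup>2 / 4" using m by simp
        finally have x1: "1 / S \<le> s * h\<^sup>2 / 4" .
        have "h\<^sup>2 \<le> 1\<^sup>2" using h by (intro power_mono) auto
        hence "s * h\<^sup>2 \<le> s * 1" using spos by (intro mult_left_mono) auto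
        hence x2: "s * h\<^sup>2 / 4 \<le> s0" using s2 spos by linarith
        have x3: "s * h\<^sup>2 / 4 > 0" using spos h by simp
        have "Re (lap M2 X2 (of_real (s * h\<^sup>2 / 4))) \<le> D / (s * h\<^sup>2 / 4) ^ 3" by (rule L2[OF x3 x2])
        also have "\<dots> \<le> D / (1 / S) ^ 3" using x1 x3 D elim by (intro divide_left_mono power_mono mult_pos_pos) auto
        also have "\<dots> = D * S ^ 3" using elim by (simp add: power_divide)
        finally show "Re (lap M2 X2 (of_real (s * h\<^sup>2 / 4))) \<le> D * S ^ 3" .
        show "0 \<le> Re (lap M2 X2 (complex_of_real (s * h\<^sup>2 / 4)))" unfolding B.lap_of_real by simp
      qed (use mh in auto)
      have 3: "real (m + 1) * (exp 2 * (C * (2 * s)\<^sup>2 / (s / real m) powr (5/2))) \<le> (4 * C * exp 2) * ((ln S ^ 6 + 2) ^ 3 * sqrt (2 * S))"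
      proof -
        define p where "p = s / real m"
        have p: "p > 0" "p \<ge> 1 / (2 * S)" using spos m sm_ge by (auto simp: p_def)
        have "s = p * real m" using m by (simp add: p_def)
        hence "C * (2 * s)\<^sup>2 / (s / real m) powr (5/2) = 4 * C * (real m)\<^sup>2 * (p\<^sup>2 / p powr (5/2))"
          unfolding p_def [symmetric] by (simp add: power_mult_distrib)
        also have "p\<^sup>2 / p powr (5/2) = p powr (2 - 5/2)"
          using p by (subst powr_diff) (simp add: powr_numeral)
        also have "p powr (2 - 5/2) = p powr (- (1/2))" by simp
        also have "p powr (- (1/2)) = inverse (p powr (1/2))" by (rule powr_minus)
        also have "\<dots> = 1 / sqrt p" using powr_half_sqrt[of p] p(1) by (simp add: inverse_eq_divide)
        also have "4 * C * (real m)\<^sup>2 * (1 / sqrt p) \<le> 4 * C * (ln S ^ 6 + 2)\<^sup>2 * sqrt (2 * S)"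
        proof (intro mult_mono power_mono mult_nonneg_nonneg)
          have "1 / sqrt p \<le> 1 / sqrt (1 / (2 * S))"
            using p elim by (intro divide_left_mono) (auto intro!: mult_pos_pos)
          thus "1 / sqrt p \<le> sqrt (2 * S)" by (simp add: real_sqrt_divide)
        qed (use C m2 p elim in auto)
        finally have "C * (2 * s)\<^sup>2 / (s / real m) powr (5/2) \<le> 4 * C * (ln S ^ 6 + 2)\<^sup>2 * sqrt (2 * S)" .
        hence "real (m + 1) * (exp 2 * (C * (2 * s)\<^sup>2 / (s / real m) powr (5/2))) \<le> (ln S ^ 6 + 2) * (exp 2 * (4 * C * (ln S ^ 6 + 2)\<^sup>2 * sqrt (2 * S)))"
          using m2 C elim by (intro mult_mono mult_left_mono mult_nonneg_nonneg divide_nonneg_nonneg) auto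
        also have "\<dots> = (4 * C * exp 2) * ((ln S ^ 6 + 2) ^ 3 * sqrt (2 * S))"
          by (simp add: power2_eq_square power3_eq_cube)
        finally show ?thesis .
      qed
      have 4: "\<eta> S * S = exp (- (ln S)\<^sup>2 / 4) * (D * S ^ 3) + (4 * C * exp 2) * ((ln S ^ 6 + 2) ^ 3 * sqrt (2 * S))"
        using elim by (simp add: \<eta>_def distrib_right power2_eq_square power3_eq_cube)
      have 5: "(1 + 3 * h) / (1 - 2 * h) = window_ratio S" by (simp add: window_ratio_def h_def)
      show "cumul M1 X1 T * (1 - exp (- (ln S)\<^sup>2)) \<le> cumul M2 X2 (window_ratio S * T) + \<eta> S * S"
        using main 1 2 3 unfolding 4 5 by linarith
    qed
  qed
  with lim show ?thesis by blast
qed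

text \<open>The upper bound compares \<open>S\<close> with \<open>window_ratio S * S\<close>. The
  lower bound exchanges the measures and starts from \<open>S / window_ratio S\<close>, which is in
  \<open>[S/2, S]\<close> once the ratio lies between 1 and 2. Since
  \<open>(window_ratio S - 1) * ln S\<close> tends to 0, the constant survives both
  comparisons.\<close>

theorem cumul_asymptotics_transfer:
  assumes A: "laplace_measure M1 X1" and B: "laplace_measure M2 X2"
    and E: "\<And>z. 0 < Re z \<Longrightarrow> norm z \<le> s0 \<Longrightarrow> norm (lap M1 X1 z - lap M2 X2 z) \<le> C * (norm z)\<^sup>2 / Re z powr (5/2)"
    and C: "C \<ge> 0" and s0: "s0 > 0"
    and L1: "\<And>s. 0 < s \<Longrightarrow> s \<le> s0 \<Longrightarrow> Re (lap M1 X1 (of_real s)) \<le> D / s ^ 3"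
    and L2: "\<And>s. 0 < s \<Longrightarrow> s \<le> s0 \<Longrightarrow> Re (lap M2 X2 (of_real s)) \<le> D / s ^ 3" and D: "D \<ge> 0"
    and lim: "((\<lambda>T. cumul M2 X2 T / T - ln T) \<longlongrightarrow> a) at_top"
  shows "((\<lambda>T. cumul M1 X1 T / T - ln T) \<longlongrightarrow> a) at_top"
proof -
  define g where "g = (\<lambda>T. cumul M2 X2 T / T - ln T)"
  have g: "cumul M2 X2 T = T * (ln T + g T)" if "T > 0" for T using that by (simp add: g_def)
  have glim: "(g \<longlongrightarrow> a) at_top" using lim by (simp add: g_def)
  obtain \<eta>1 where e1: "(\<eta>1 \<longlongrightarrow> 0) at_top" and ev1: "\<forall>\<^sub>F S in at_top. \<forall>T. S / 2 \<le> T \<and> T \<le> S \<longrightarrow>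
     cumul M1 X1 T * (1 - exp (- (ln S)\<^sup>2)) \<le> cumul M2 X2 (window_ratio S * T) + \<eta>1 S * S"
    using cumul_compare_eventually[OF A B E C s0 L2 D] by blast
  have E': "norm (lap M2 X2 z - lap M1 X1 z) \<le> C * (norm z)\<^sup>2 / Re z powr (5/2)" if "0 < Re z" "norm z \<le> s0" for z
    using E[OF that] by (simp add: norm_minus_commute)
  obtain \<eta>2 where e2: "(\<eta>2 \<longlongrightarrow> 0) at_top" and ev2: "\<forall>\<^sub>F S in at_top. \<forall>T. S / 2 \<le> T \<and> T \<le> S \<longrightarrow>
     cumul M2 X2 T * (1 - exp (- (ln S)\<^sup>2)) \<le> cumul M1 X1 (window_ratio S * T) + \<eta>2 S * S"
    using cumul_compare_eventually[OF B A E' C s0 L1 D] by blast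
  let ?k = window_ratio and ?e = "\<lambda>S::real. exp (- (ln S)\<^sup>2)"
  have k1: "(?k \<longlongrightarrow> 1) at_top" unfolding window_ratio_def by real_asymp
  have k2: "\<forall>\<^sub>F S in at_top. ?k S > 1" unfolding window_ratio_def by real_asymp
  have k3: "\<forall>\<^sub>F S in at_top. ?k S < 2" using k1 by (rule order_tendstoD) auto
  have kS: "filterlim (\<lambda>S. ?k S * S) at_top at_top" unfolding window_ratio_def by real_asymp
  have Sk: "filterlim (\<lambda>S. S / ?k S) at_top at_top" unfolding window_ratio_def by real_asymp
  have elim0: "(?e \<longlongrightarrow> 0) at_top" by real_asymp
  have e1': "\<forall>\<^sub>F S in at_top. ?e S < 1" using elim0 by (rule order_tendstoD) auto
  have up: "\<forall>\<^sub>F S in at_top. cumul M1 X1 S / S - ln S \<le>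
      (?k S / (1 - ?e S) - 1) * ln S + (?k S * ln (?k S) + ?k S * g (?k S * S) + \<eta>1 S) / (1 - ?e S)"
    using ev1 k2 e1' eventually_gt_at_top[of 1]
  proof eventually_elim
    case (elim S)
    have e: "1 - ?e S > 0" using elim by linarith
    have "cumul M1 X1 S * (1 - ?e S) \<le> cumul M2 X2 (?k S * S) + \<eta>1 S * S"
      using elim by auto
    also have "cumul M2 X2 (?k S * S) = (?k S * S) * (ln (?k S) + ln S + g (?k S * S))"
      using elim by (subst g) (auto simp: ln_mult)
    also have "(?k S * S) * (ln (?k S) + ln S + g (?k S * S)) + \<eta>1 S * S = S * (?k S * ln S + (?k S * ln (?k S) + ?k S * g (?k S * S) + \<eta>1 S))"
      by (simp add: algebra_simps)
    finally have "cumul M1 X1 S / S \<le> (?k S * ln S + (?k S * ln (?k S) + ?k S * g (?k S * S) + \<eta>1 S)) / (1 - ?e S)"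
      using elim e by (simp add: field_simps)
    thus ?case by (simp add: add_divide_distrib algebra_simps)
  qed
  have lo: "\<forall>\<^sub>F S in at_top. cumul M1 X1 S / S - ln S \<ge>
      ((1 - ?e S) / ?k S - 1) * ln S + (1 - ?e S) / ?k S * (g (S / ?k S) - ln (?k S)) - \<eta>2 S"
    using ev2 k2 k3 eventually_gt_at_top[of 1]
  proof eventually_elim
    case (elim S)
    define T where "T = S / ?k S"
    have T: "S / 2 \<le> T \<and> T \<le> S" "?k S * T = S" "T > 0" using elim by (auto simp: T_def field_simps)
    have "cumul M2 X2 T * (1 - ?e S) \<le> cumul M1 X1 (?k S * T) + \<eta>2 S * S" using elim T by blast
    also have "cumul M2 X2 T = T * (ln S - ln (?k S) + g T)"
      using elim by (subst g) (auto simp: T_def ln_div)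
    finally have "T * (ln S - ln (?k S) + g T) * (1 - ?e S) / S \<le> (cumul M1 X1 S + \<eta>2 S * S) / S"
      using elim T(2) by (intro divide_right_mono) auto
    moreover have "T * (ln S - ln (?k S) + g T) * (1 - ?e S) / S = (1 - ?e S) / ?k S * (ln S - ln (?k S) + g T)"
      using elim by (simp add: T_def)
    moreover have "(cumul M1 X1 S + \<eta>2 S * S) / S = cumul M1 X1 S / S + \<eta>2 S"
      using elim by (simp add: add_divide_distrib)
    moreover define q where "q = (1 - ?e S) / ?k S"
    ultimately have "q * (ln S - ln (?k S) + g T) \<le> cumul M1 X1 S / S + \<eta>2 S" by simp
    hence "(q - 1) * ln S + q * (g T - ln (?k S)) - \<eta>2 S \<le> cumul M1 X1 S / S - ln S"
      by (simp add: algebra_simps)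
    thus ?case by (simp only: q_def T_def)
  qed
  have "((\<lambda>S. (?k S / (1 - ?e S) - 1) * ln S) \<longlongrightarrow> 0) at_top" unfolding window_ratio_def by real_asymp
  moreover have "((\<lambda>S. (?k S * ln (?k S) + ?k S * g (?k S * S) + \<eta>1 S) / (1 - ?e S)) \<longlongrightarrow> (1 * ln 1 + 1 * a + 0) / (1 - 0)) at_top"
    by (intro tendsto_intros k1 elim0 e1 filterlim_compose[OF glim kS]) auto
  ultimately have up': "((\<lambda>S. (?k S / (1 - ?e S) - 1) * ln S + (?k S * ln (?k S) + ?k S * g (?k S * S) + \<eta>1 S) / (1 - ?e S)) \<longlongrightarrow> a) at_top"
    using tendsto_add by fastforce
  have t1: "((\<lambda>S. ((1 - ?e S) / ?k S - 1) * ln S) \<longlongrightarrow> 0) at_top" unfolding window_ratio_def by real_asymp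
  have t2: "((\<lambda>S. (1 - ?e S) / ?k S * (g (S / ?k S) - ln (?k S)) - \<eta>2 S) \<longlongrightarrow> (1 - 0) / 1 * (a - ln 1) - 0) at_top"
    by (intro tendsto_intros k1 elim0 e2 filterlim_compose[OF glim Sk]) auto
  have lo': "((\<lambda>S. ((1 - ?e S) / ?k S - 1) * ln S + (1 - ?e S) / ?k S * (g (S / ?k S) - ln (?k S)) - \<eta>2 S) \<longlongrightarrow> a) at_top"
    using tendsto_add[OF t1 t2] by (simp add: add_diff_eq)
  show ?thesis by (rule tendsto_sandwich[OF lo up lo' up'])
qed

section \<open>Integral transforms of the zeta function\<close>

definition half_power :: "real \<Rightarrow> real \<Rightarrow> complex" where
  "half_power u t = exp (- (1/2 + \<i> * of_real t) * of_real (ln u))"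

lemma norm_half_power: "u > 0 \<Longrightarrow> norm (half_power u t) = u powr (- 1/2)"
  by (simp add: half_power_def powr_def)

lemma half_power_eq_powr: "u > 0 \<Longrightarrow> half_power u t = of_real u powr (- (1/2 + \<i> * of_real t))"
  by (simp add: half_power_def powr_def Ln_of_real)

lemma half_power_measurable [measurable (raw)]:
  assumes [measurable]: "f \<in> borel_measurable M" "g \<in> borel_measurable M"
  shows "(\<lambda>x. half_power (f x) (g x)) \<in> borel_measurable M"
  unfolding half_power_def by measurable

lemma set_integrable_powr_minus_half:
  "set_integrable lborel {0<..<b} (\<lambda>u::real. u powr (- 1/2))"
proof (cases "b > 0")
  case True
  have "(\<lambda>u::real. u powr (- 1/2)) integrable_on {0..b}"
    using has_integral_powr_from_0[of "-1/2" b] True by (auto simp: integrable_on_def)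
  hence "(\<lambda>u::real. u powr (- 1/2)) absolutely_integrable_on {0..b}"
    by (intro nonnegative_absolutely_integrable_1) auto
  hence "set_integrable lebesgue {0<..<b} (\<lambda>u::real. u powr (- 1/2))"
    by (rule set_integrable_subset) auto
  thus ?thesis unfolding set_integrable_def by (subst (asm) integrable_completion) auto
qed (simp add: set_integrable_def)

lemma set_integrable_half_power: "set_integrable lborel {0<..<b} (\<lambda>u. half_power u t)"
  using set_integrable_powr_minus_half[of b] unfolding set_integrable_def
  by (rule Bochner_Integration.integrable_bound) (auto simp: indicator_def norm_half_power)

text \<open>The integral converges at 0 because \<open>1 - (1/2 + \<i> t)\<close> has real part 1/2.
  It identifies the correction term of \<open>zeta_cutoff\<close>, which is this expression at
  \<open>b = N + 1\<close>.\<close>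

lemma set_integral_half_power:
  assumes b: "b > 0"
  shows "(LINT u:{0<..<b}|lborel. half_power u t) = of_real b powr (1 - (1/2 + \<i> * of_real t)) / (1 - (1/2 + \<i> * of_real t))"
proof -
  define a where "a = 1 - (1/2 + \<i> * complex_of_real t)"
  have a: "Re a > 0" "a \<noteq> 0" "a - 1 = - (1/2 + \<i> * complex_of_real t)" by (auto simp: a_def complex_eq_iff)
  have hi: "((\<lambda>u. of_real u powr (a - 1)) has_integral (of_real b powr a / a - of_real 0 powr a / a)) {0..b}"
  proof (rule fundamental_theorem_of_calculus_interior)
    show "continuous_on {0..b} (\<lambda>u. of_real u powr a / a)"
    proof -
      have "continuous_on {0..b} (\<lambda>u. of_real u powr a)"
        using a by (intro continuous_on_powr_complex continuous_intros) auto
      thus ?thesis using a by (intro continuous_intros) auto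
    qed
    fix u assume u: "u \<in> {0<..<b}"
    have "((\<lambda>z. z powr a / a) has_field_derivative (of_real u powr (a - 1))) (at (of_real u))"
      using u a by (auto intro!: derivative_eq_intros simp: complex_nonpos_Reals_iff)
    thus "((\<lambda>u. of_real u powr a / a) has_vector_derivative of_real u powr (a - 1)) (at u)"
      by (rule has_vector_derivative_real_field)
  qed (use b in auto)
  have "(LINT u:{0<..<b}|lborel. half_power u t) = integral {0<..<b} (\<lambda>u. half_power u t)"
    by (rule set_borel_integral_eq_integral(2)[OF set_integrable_half_power])
  also have "\<dots> = integral {0<..<b} (\<lambda>u. of_real u powr (a - 1))"
    by (intro integral_cong) (simp add: half_power_eq_powr a)
  also have "\<dots> = integral {0..b} (\<lambda>u. of_real u powr (a - 1))"
    using integral_open_interval_real[of 0 b "\<lambda>u. complex_of_real u powr (a - 1)"] by simp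
  also have "\<dots> = of_real b powr a / a" using hi a by (simp add: integral_unique)
  finally show ?thesis by (simp add: a_def)
qed

text \<open>A Mellin-type transform of \<open>K\<close> along the line with real part 1/2, without
  the usual normalisation.\<close>

definition half_mellin :: "(real \<Rightarrow> complex) \<Rightarrow> real \<Rightarrow> complex" where
  "half_mellin K u = (\<integral>t. K t * half_power u t \<partial>lborel)"

text \<open>Fubini's theorem applies because the absolute value of \<open>half_power u t\<close> is
  \<open>u powr (- 1/2)\<close>, independent of \<open>t\<close> and integrable at 0, so the double
  integral of absolute values splits into a product.\<close>

lemma
  fixes K :: "real \<Rightarrow> complex"
  assumes K: "integrable lborel K" and b: "b > 0"
  shows set_integrable_half_mellin: "set_integrable lborel {0<..<b} (half_mellin K)"
    and set_integral_half_mellin: "(LINT u:{0<..<b}|lborel. half_mellin K u) =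
      (\<integral>t. K t * (of_real b powr (1 - (1/2 + \<i> * of_real t)) / (1 - (1/2 + \<i> * of_real t))) \<partial>lborel)" (is ?th)
    and integrable_half_mellin_tail: "integrable lborel (\<lambda>t. K t * (of_real b powr (1 - (1/2 + \<i> * of_real t)) / (1 - (1/2 + \<i> * of_real t))))"
proof -
  have [measurable]: "K \<in> borel_measurable lborel" using K by auto
  define f where "f = (\<lambda>(t, u). indicator {0<..<b} u *\<^sub>R (K t * half_power u t))"
  have fm: "f \<in> borel_measurable (lborel \<Otimes>\<^sub>M lborel)" unfolding f_def by measurable
  have inner: "(\<integral>u. f (t, u) \<partial>lborel) = K t * (of_real b powr (1 - (1/2 + \<i> * of_real t)) / (1 - (1/2 + \<i> * of_real t)))" for t
  proof -
    have "(\<integral>u. f (t, u) \<partial>lborel) = (\<integral>u. K t * (indicator {0<..<b} u *\<^sub>R half_power u t) \<partial>lborel)"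
      by (simp add: f_def)
    also have "\<dots> = K t * (LINT u:{0<..<b}|lborel. half_power u t)" unfolding set_lebesgue_integral_def by (rule integral_mult_right_zero)
    finally show ?thesis by (simp only: set_integral_half_power[OF b])
  qed
  define c where "c = (LINT u:{0<..<b}|lborel. u powr (- 1/2))"
  have nrm: "norm (f (t, u)) = norm (K t) * (indicator {0<..<b} u *\<^sub>R (u powr (- 1/2)))" for t u
    by (auto simp: f_def indicator_def norm_mult norm_half_power)
  have int: "integrable (lborel \<Otimes>\<^sub>M lborel) f"
  proof (rule lborel_pair.Fubini_integrable[OF fm])
    show "integrable lborel (\<lambda>t. \<integral>u. norm (f (t, u)) \<partial>lborel)"
    proof -
      have "(\<integral>u. norm (f (t, u)) \<partial>lborel) = norm (K t) * c" for t
        unfolding nrm c_def set_lebesgue_integral_def by (rule integral_mult_right_zero)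
      thus ?thesis using K by simp
    qed
    show "AE t in lborel. integrable lborel (\<lambda>u. f (t, u))"
    proof (intro AE_I2)
      fix t
      have "integrable lborel (\<lambda>u. K t * (indicator {0<..<b} u *\<^sub>R half_power u t))"
        using set_integrable_half_power[of b t] by (intro integrable_mult_right) (simp add: set_integrable_def)
      thus "integrable lborel (\<lambda>u. f (t, u))" by (simp add: f_def)
    qed
  qed
  have sw: "(\<integral>t. f (t, u) \<partial>lborel) = indicator {0<..<b} u *\<^sub>R half_mellin K u" for u
    by (simp add: f_def half_mellin_def)
  have "integrable lborel (\<lambda>u. \<integral>t. f (t, u) \<partial>lborel)"
    using lborel_pair.integrable_snd[of "\<lambda>t u. f (t, u)"] int by simp
  thus "set_integrable lborel {0<..<b} (half_mellin K)" by (simp add: sw set_integrable_def)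
  have "integrable lborel (\<lambda>t. \<integral>u. f (t, u) \<partial>lborel)"
    using lborel_pair.integrable_fst[of "\<lambda>t u. f (t, u)"] int by simp
  thus "integrable lborel (\<lambda>t. K t * (of_real b powr (1 - (1/2 + \<i> * of_real t)) / (1 - (1/2 + \<i> * of_real t))))"
    unfolding inner .
  have "(\<integral>u. (\<integral>t. f (t, u) \<partial>lborel) \<partial>lborel) = (\<integral>t. (\<integral>u. f (t, u) \<partial>lborel) \<partial>lborel)"
    by (rule lborel_pair.Fubini_integral) (use int in simp)
  thus ?th unfolding sw inner set_lebesgue_integral_def .
qed

lemma integrable_mult_half_power:
  assumes K: "integrable lborel K" and u: "u > 0"
  shows "integrable lborel (\<lambda>t. K t * half_power u t)"
proof -
  have "integrable lborel (\<lambda>t. norm (K t) * u powr (- 1/2))"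
    using K by (intro integrable_mult_left integrable_norm) auto
  thus ?thesis
    by (rule Bochner_Integration.integrable_bound) (use K u in \<open>auto simp: norm_mult norm_half_power\<close>)
qed

lemma integral_zeta_cutoff:
  assumes K: "integrable lborel K"
  shows "(\<integral>t. K t * zeta_cutoff N (1/2 + \<i> * of_real t) \<partial>lborel) =
     (\<Sum>n<N. half_mellin K (real (Suc n))) - (LINT u:{0<..<real (Suc N)}|lborel. half_mellin K u)"
proof -
  have e: "K t * zeta_cutoff N (1/2 + \<i> * of_real t) = (\<Sum>n<N. K t * half_power (real (Suc n)) t) -
     K t * (of_real (real (Suc N)) powr (1 - (1/2 + \<i> * of_real t)) / (1 - (1/2 + \<i> * of_real t)))" for t
  proof -
    have "1 / of_nat (Suc n) powr (1/2 + \<i> * complex_of_real t) = half_power (real (Suc n)) t" for n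
    proof -
      have "half_power (real (Suc n)) t = of_real (real (Suc n)) powr (- (1/2 + \<i> * of_real t))"
        by (rule half_power_eq_powr) simp
      also have "\<dots> = inverse (of_real (real (Suc n)) powr (1/2 + \<i> * of_real t))" by (rule powr_minus)
      finally show ?thesis by (simp add: inverse_eq_divide del: of_nat_Suc)
    qed
    thus ?thesis unfolding zeta_cutoff_def by (simp add: sum_distrib_left right_diff_distrib del: of_nat_Suc)
  qed
  have "(\<integral>t. K t * zeta_cutoff N (1/2 + \<i> * of_real t) \<partial>lborel) =
    (\<integral>t. (\<Sum>n<N. K t * half_power (real (Suc n)) t) \<partial>lborel) -
    (\<integral>t. K t * (of_real (real (Suc N)) powr (1 - (1/2 + \<i> * of_real t)) / (1 - (1/2 + \<i> * of_real t))) \<partial>lborel)"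
    unfolding e using K
    by (intro Bochner_Integration.integral_diff Bochner_Integration.integrable_sum integrable_mult_half_power integrable_half_mellin_tail) auto
  also have "(\<integral>t. (\<Sum>n<N. K t * half_power (real (Suc n)) t) \<partial>lborel) = (\<Sum>n<N. half_mellin K (real (Suc n)))"
    unfolding half_mellin_def by (intro Bochner_Integration.integral_sum integrable_mult_half_power K) auto
  also have "(\<integral>t. K t * (of_real (real (Suc N)) powr (1 - (1/2 + \<i> * of_real t)) / (1 - (1/2 + \<i> * of_real t))) \<partial>lborel) =
     (LINT u:{0<..<real (Suc N)}|lborel. half_mellin K u)"
    by (subst set_integral_half_mellin[OF K]) auto
  finally show ?thesis .
qed

text \<open>Dominated convergence with the linear bound for the cut-offs. The lemma trades a zeta
  factor for a sum minus an integral; it is applied twice, once for each zeta factor of the mean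
  square.\<close>

lemma zeta_transform:
  assumes [measurable]: "K \<in> borel_measurable lborel"
    and K: "integrable lborel (\<lambda>t. (1 + \<bar>t\<bar>) * norm (K t))"
  shows "(\<lambda>N. (\<Sum>n<N. half_mellin K (real (Suc n))) - (LINT u:{0<..<real (Suc N)}|lborel. half_mellin K u))
           \<longlonglongrightarrow> (\<integral>t. K t * zeta_half t \<partial>lborel)"
proof -
  have K': "integrable lborel K"
    by (rule Bochner_Integration.integrable_bound[OF K]) (auto simp: abs_mult mult_le_cancel_right1)
  obtain C where C: "C > 0" "\<And>N t. norm (zeta_cutoff N (1/2 + \<i> * of_real t)) \<le> C * (1 + \<bar>t\<bar>)"
    using zeta_cutoff_critical_line_bound by blast
  have cm: "(\<lambda>t. zeta_cutoff N (1/2 + \<i> * of_real t)) \<in> borel_measurable borel" for N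
  proof (rule borel_measurable_continuous_onI)
    show "continuous_on UNIV (\<lambda>t. zeta_cutoff N (1/2 + \<i> * complex_of_real t))"
      unfolding zeta_cutoff_def
      by (intro continuous_intros) (auto simp: complex_eq_iff[of _ 1] powr_def simp del: of_nat_Suc)
  qed
  note [measurable] = cm
  have "(\<lambda>N. \<integral>t. K t * zeta_cutoff N (1/2 + \<i> * of_real t) \<partial>lborel) \<longlonglongrightarrow> (\<integral>t. K t * zeta_half t \<partial>lborel)"
  proof (rule integral_dominated_convergence[where w = "\<lambda>t. C * ((1 + \<bar>t\<bar>) * norm (K t))"])
    show "AE t in lborel. (\<lambda>N. K t * zeta_cutoff N (1/2 + \<i> * of_real t)) \<longlonglongrightarrow> K t * zeta_half t"
      by (intro AE_I2 tendsto_intros zeta_cutoff_half_tendsto)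
    show "AE t in lborel. norm (K t * zeta_cutoff N (1/2 + \<i> * of_real t)) \<le> C * ((1 + \<bar>t\<bar>) * norm (K t))" for N
    proof (intro AE_I2)
      fix t
      have "norm (K t) * norm (zeta_cutoff N (1/2 + \<i> * of_real t)) \<le> norm (K t) * (C * (1 + \<bar>t\<bar>))"
        by (intro mult_left_mono C) auto
      thus "norm (K t * zeta_cutoff N (1/2 + \<i> * of_real t)) \<le> C * ((1 + \<bar>t\<bar>) * norm (K t))"
        by (simp add: norm_mult mult_ac)
    qed
  qed (use K in auto)
  thus ?thesis by (simp only: integral_zeta_cutoff[OF K'])
qed

section \<open>A closed form for the Laplace transform of the mean square\<close>

text \<open>For \<open>0 < Re s < pi\<close> this lies in the lower half-plane, so
  \<open>1 / (v - u * rot_exp s)\<close> has no pole for positive \<open>u\<close> and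
  \<open>v\<close>. As \<open>s\<close> tends to 0 it approaches 1, and the poles come close to the
  positive axis.\<close>

definition rot_exp :: "complex \<Rightarrow> complex" where
  "rot_exp s = exp (- \<i> * s)"

text \<open>The limit of sum minus integral of the Cauchy kernel \<open>1 / (v - w)\<close>, see
  \<open>Cauchy_kernel_sum_minus_integral\<close>.\<close>

definition log_digamma :: "complex \<Rightarrow> complex" where
  "log_digamma w = Ln (- w) - Digamma (1 - w)"

lemma Im_rot_exp: "Im (rot_exp s) = - exp (Im s) * sin (Re s)"
  by (simp add: rot_exp_def Im_exp)

lemma Im_rot_exp_neg: "0 < Re s \<Longrightarrow> Re s < pi \<Longrightarrow> Im (rot_exp s) < 0"
  by (simp add: Im_rot_exp sin_gt_zero)

text \<open>Up to a constant the two powers multiply to \<open>exp (- \<i> t (ln u - ln v))\<close>,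
  which amounts to shifting \<open>s\<close> by \<open>\<i> (ln u - ln v)\<close>. The real part of
  \<open>s\<close> is unchanged, so the residue formula still applies, and the sine at the shifted
  point factors into a Cauchy kernel.\<close>

lemma integral_sech_kernel_half_powers:
  assumes s: "0 < Re s" "Re s < 2 * pi" and u: "u > 0" and v: "v > 0"
  shows "(\<integral>t. sech_kernel s t * (half_power u t * half_power v (- t)) \<partial>lborel) =
    \<i> * exp (- \<i> * s / 2) / (of_real v - of_real u * rot_exp s)"
proof -
  define l where "l = ln u - ln v"
  define c where "c = exp (- complex_of_real ((ln u + ln v) / 2))"
  define z where "z = s + \<i> * of_real l"
  have "sech_kernel s t * (half_power u t * half_power v (- t)) = c * sech_kernel z t" for t
  proof -
    have "half_power u t * half_power v (- t) = c * exp (- \<i> * of_real l * of_real t)"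
    proof -
      have "- (1/2 + \<i> * complex_of_real t) * of_real (ln u) + - (1/2 + \<i> * complex_of_real (- t)) * of_real (ln v) =
            - complex_of_real ((ln u + ln v) / 2) + - \<i> * of_real l * of_real t"
        by (simp add: l_def field_simps)
      thus ?thesis unfolding half_power_def c_def by (simp only: flip: exp_add)
    qed
    moreover have "sech_kernel s t * exp (- \<i> * of_real l * of_real t) = sech_kernel z t"
    proof -
      have "- s * complex_of_real t + - \<i> * of_real l * of_real t = - z * of_real t"
        by (simp add: z_def algebra_simps)
      thus ?thesis unfolding sech_kernel_def by (simp only: times_divide_eq_left flip: exp_add)
    qed
    ultimately show ?thesis by (simp add: mult_ac)
  qed
  hence "(\<integral>t. sech_kernel s t * (half_power u t * half_power v (- t)) \<partial>lborel) = c * (\<integral>t. sech_kernel z t \<partial>lborel)"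
    by simp
  also have "\<dots> = c / (2 * sin (z / 2))"
    by (subst integral_sech_kernel) (use s in \<open>auto simp: z_def\<close>)
  also have "\<dots> = \<i> * exp (- \<i> * s / 2) / (of_real v - of_real u * rot_exp s)"
  proof -
    define A where "A = exp (\<i> * s / 2)"
    define B where "B = exp (- \<i> * s / 2)"
    have AB: "A * B = 1" unfolding A_def B_def by (simp flip: exp_add)
    have q: "rot_exp s = B * B" unfolding B_def rot_exp_def by (simp flip: exp_add)
    define P where "P = exp (complex_of_real (ln u / 2))"
    define Q where "Q = exp (complex_of_real (ln v / 2))"
    have uP: "of_real u = P * P" using u by (simp add: P_def exp_of_real exp_ln flip: exp_add of_real_mult)
    have vQ: "of_real v = Q * Q" using v by (simp add: Q_def exp_of_real exp_ln flip: exp_add of_real_mult)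
    have nz: "P \<noteq> 0" "Q \<noteq> 0" "A \<noteq> 0" "B \<noteq> 0" by (auto simp: P_def Q_def A_def B_def)
    have cPQ: "c = 1 / (P * Q)"
    proof -
      have "- complex_of_real ((ln u + ln v) / 2) = - of_real (ln u / 2) - of_real (ln v / 2)"
        by (simp add: add_divide_distrib)
      hence "c = inverse P / Q" unfolding c_def P_def Q_def by (simp only: exp_diff exp_minus)
      thus ?thesis by (simp add: inverse_eq_divide)
    qed
    have rot: "\<i> * ((x + \<i> * (a - b)) / 2) = \<i> * x / 2 + b / 2 - a / 2" for x a b :: complex
      by (simp add: algebra_simps add_divide_distrib diff_divide_distrib)
    have rot': "- (\<i> * ((x + \<i> * (a - b)) / 2)) = - \<i> * x / 2 + a / 2 - b / 2" for x a b :: complex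
      by (simp add: algebra_simps add_divide_distrib diff_divide_distrib)
    have e1: "exp (\<i> * (z / 2)) = A * Q / P"
    proof -
      have "\<i> * (z / 2) = \<i> * s / 2 + of_real (ln v / 2) - of_real (ln u / 2)"
        unfolding z_def l_def of_real_diff rot by (simp only: of_real_divide of_real_numeral)
      thus ?thesis by (simp only: exp_add exp_diff A_def P_def Q_def)
    qed
    have e2: "exp (- (\<i> * (z / 2))) = B * P / Q"
    proof -
      have "- (\<i> * (z / 2)) = - \<i> * s / 2 + of_real (ln u / 2) - of_real (ln v / 2)"
        unfolding z_def l_def of_real_diff rot' by (simp only: of_real_divide of_real_numeral)
      thus ?thesis by (simp only: exp_add exp_diff B_def P_def Q_def)
    qed
    have "2 * sin (z / 2) = (A * Q / P - B * P / Q) / \<i>"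
      unfolding sin_exp_eq e1 e2 by simp
    also have "\<dots> = A * (Q * Q - P * P * (B * B)) / (\<i> * P * Q)"
      using nz AB by (simp add: field_simps)
    finally have "c / (2 * sin (z / 2)) = \<i> / (A * (Q * Q - P * P * (B * B)))"
      using nz by (simp add: cPQ divide_divide_eq_right)
    also have "\<dots> = \<i> * B / (of_real v - of_real u * rot_exp s)"
    proof -
      have "inverse A = B" by (rule inverse_unique[OF AB])
      thus ?thesis by (simp add: uP vQ q divide_inverse mult_ac)
    qed
    finally show ?thesis by (simp add: B_def)
  qed
  finally show ?thesis .
qed

text \<open>\<open>v - w\<close> stays in the upper half-plane, so the principal logarithm is a
  primitive along the whole path.\<close>

lemma set_integral_Cauchy_kernel:
  assumes w: "Im w < 0" and b: "b > 0"
  shows "(LINT v:{0<..<b}|lborel. 1 / (of_real v - w)) = Ln (of_real b - w) - Ln (- w)"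
proof -
  have nz: "of_real v - w \<noteq> 0" for v using w by (auto simp: complex_eq_iff)
  have "set_integrable lborel {0..b} (\<lambda>v. 1 / (of_real v - w))"
    using nz by (intro borel_integrable_atLeastAtMost' continuous_intros) auto
  hence *: "set_integrable lborel {0<..<b} (\<lambda>v. 1 / (of_real v - w))"
    by (rule set_integrable_subset) auto
  have "((\<lambda>v. 1 / (of_real v - w)) has_integral (Ln (of_real b - w) - Ln (of_real 0 - w))) {0..b}"
  proof (rule fundamental_theorem_of_calculus)
    fix v :: real
    have "of_real v - w \<notin> \<real>\<^sub>\<le>\<^sub>0" using w by (auto simp: complex_nonpos_Reals_iff)
    hence "((\<lambda>z. Ln (z - w)) has_field_derivative 1 / (of_real v - w)) (at (of_real v))"
      by (auto intro!: derivative_eq_intros simp: divide_inverse)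
    thus "((\<lambda>v. Ln (of_real v - w)) has_vector_derivative 1 / (of_real v - w)) (at v within {0..b})"
      by (rule has_vector_derivative_real_field)
  qed (use b in auto)
  hence "integral {0..b} (\<lambda>v. 1 / (of_real v - w)) = Ln (of_real b - w) - Ln (- w)"
    by (simp add: integral_unique)
  thus "(LINT v:{0<..<b}|lborel. 1 / (of_real v - w)) = Ln (of_real b - w) - Ln (- w)"
    using set_borel_integral_eq_integral(2)[OF *] integral_open_interval_real[of 0 b "\<lambda>v. 1 / (complex_of_real v - w)"] by simp
qed

text \<open>The limit formula for digamma at \<open>1 - w\<close>, with \<open>ln N\<close> replaced
  by \<open>Ln (N + 1 - w)\<close>; the difference of the two tends to 0.\<close>

lemma Cauchy_kernel_sum_minus_integral:
  assumes w: "Im w < 0"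
  shows "(\<lambda>N. (\<Sum>n<N. 1 / (of_real (real (Suc n)) - w)) - (LINT v:{0<..<real (Suc N)}|lborel. 1 / (of_real v - w)))
    \<longlonglongrightarrow> log_digamma w"
proof -
  have nz: "1 - w \<noteq> 0" using w by (auto simp: complex_eq_iff)
  have "(\<lambda>N. of_real (ln (real N)) - (\<Sum>n<N. inverse (1 - w + of_nat n))) \<longlonglongrightarrow> Digamma (1 - w)"
    by (rule Digamma_LIMSEQ[OF nz])
  moreover have "(\<lambda>N. Ln (of_real (real (Suc N)) - w) - of_real (ln (real N))) \<longlonglongrightarrow> 0"
  proof -
    have "(\<lambda>N. Ln (1 + (1 - w) * of_real (1 / real N))) \<longlonglongrightarrow> Ln (1 + (1 - w) * of_real 0)"
      by (intro tendsto_intros lim_1_over_n) (auto simp: complex_nonpos_Reals_iff)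
    moreover have "\<forall>\<^sub>F N in sequentially. Ln (1 + (1 - w) * of_real (1 / real N)) = Ln (of_real (real (Suc N)) - w) - of_real (ln (real N))"
      using eventually_gt_at_top[of 0]
    proof eventually_elim
      case (elim N)
      have "of_real (real (Suc N)) - w = of_real (real N) * (1 + (1 - w) * of_real (1 / real N))"
        using elim by (simp add: field_simps)
      also have "Ln \<dots> = of_real (ln (real N)) + Ln (1 + (1 - w) * of_real (1 / real N))"
      proof -
        have "Im (1 + (1 - w) * of_real (1 / real N)) \<noteq> 0" using w elim by simp
        hence "1 + (1 - w) * of_real (1 / real N) \<noteq> 0" by (rule contrapos_nn) (simp only: zero_complex.sel)
        thus ?thesis using elim by (subst Ln_times_of_real) auto
      qed
      finally show ?case by simp
    qed
    ultimately show ?thesis by (simp add: filterlim_cong)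
  qed
  ultimately have "(\<lambda>N. Ln (- w) - ((of_real (ln (real N)) - (\<Sum>n<N. inverse (1 - w + of_nat n))) + (Ln (of_real (real (Suc N)) - w) - of_real (ln (real N))))) \<longlonglongrightarrow> Ln (- w) - (Digamma (1 - w) + 0)"
    by (intro tendsto_intros)
  also have "(\<lambda>N. Ln (- w) - ((of_real (ln (real N)) - (\<Sum>n<N. inverse (1 - w + of_nat n))) + (Ln (of_real (real (Suc N)) - w) - of_real (ln (real N))))) =
     (\<lambda>N. (\<Sum>n<N. 1 / (of_real (real (Suc n)) - w)) - (LINT v:{0<..<real (Suc N)}|lborel. 1 / (of_real v - w)))"
  proof
    fix N
    have "1 / (of_real (real (Suc n)) - w) = inverse (1 - w + of_nat n)" for n
      by (simp add: divide_inverse algebra_simps)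
    thus "Ln (- w) - ((of_real (ln (real N)) - (\<Sum>n<N. inverse (1 - w + of_nat n))) + (Ln (of_real (real (Suc N)) - w) - of_real (ln (real N)))) =
      (\<Sum>n<N. 1 / (of_real (real (Suc n)) - w)) - (LINT v:{0<..<real (Suc N)}|lborel. 1 / (of_real v - w))"
      by (subst set_integral_Cauchy_kernel[OF w]) auto
  qed
  finally show ?thesis by (simp add: log_digamma_def)
qed

lemma integral_lborel_uminus:
  fixes f :: "real \<Rightarrow> 'a :: {banach, second_countable_topology}"
  shows "(\<integral>t. f (- t) \<partial>lborel) = (\<integral>t. f t \<partial>lborel)"
  using lborel_integral_real_affine[of "-1" f 0] by simp

context
  fixes s :: complex
  assumes s: "0 < Re s" "Re s < pi"
begin

lemma Re_less_2pi: "Re s < 2 * pi" using s by linarith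

text \<open>The inner application of \<open>zeta_transform\<close>: the kernel carries the power of
  \<open>u\<close>, and its own transform is a Cauchy kernel in \<open>v\<close> with pole at
  \<open>u * rot_exp s\<close>.\<close>

lemma half_mellin_sech_zeta:
  assumes u: "u > 0"
  shows "half_mellin (\<lambda>t. sech_kernel s t * zeta_half (- t)) u = \<i> * exp (- \<i> * s / 2) * log_digamma (of_real u * rot_exp s)"
proof -
  define c where "c = \<i> * exp (- \<i> * s / 2)"
  define w where "w = of_real u * rot_exp s"
  have w: "Im w < 0" using Im_rot_exp_neg[OF s] u by (simp add: w_def mult_pos_neg)
  \<comment> \<open>Reflected in \<open>t\<close>, because \<open>zeta_transform\<close> supplies
    \<open>zeta_half t\<close> while the factor wanted here is
    \<open>zeta_half (- t)\<close>.\<close>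
  define K where "K = (\<lambda>t. sech_kernel s (- t) * half_power u (- t))"
  have K_int: "integrable lborel (\<lambda>t. (1 + \<bar>t\<bar>) * norm (K t))"
  proof -
    have "integrable lborel (\<lambda>t. (1 + \<bar>t\<bar>) ^ 1 * norm (sech_kernel s t) * u powr (- 1/2))"
      using integrable_poly_sech_kernel[OF s(1) Re_less_2pi, of 1] by (intro integrable_mult_left) simp
    from lborel_integrable_real_affine[OF this, of "-1" 0]
    show ?thesis using u by (simp add: K_def norm_mult norm_half_power mult_ac)
  qed
  have kh: "half_mellin K v = c / (of_real v - w)" if "v > 0" for v
  proof -
    have "half_mellin K v = (\<integral>t. sech_kernel s t * (half_power u t * half_power v (- t)) \<partial>lborel)"
      unfolding half_mellin_def using integral_lborel_uminus[of "\<lambda>t. K t * half_power v t"]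
      by (simp add: K_def mult_ac)
    thus ?thesis using integral_sech_kernel_half_powers[OF s(1) Re_less_2pi u that] by (simp add: c_def w_def)
  qed
  have "(\<lambda>N. (\<Sum>n<N. half_mellin K (real (Suc n))) - (LINT v:{0<..<real (Suc N)}|lborel. half_mellin K v)) \<longlonglongrightarrow> (\<integral>t. K t * zeta_half t \<partial>lborel)"
    by (rule zeta_transform[OF _ K_int]) (simp add: K_def)
  also have "(\<lambda>N. (\<Sum>n<N. half_mellin K (real (Suc n))) - (LINT v:{0<..<real (Suc N)}|lborel. half_mellin K v)) =
      (\<lambda>N. c * ((\<Sum>n<N. 1 / (of_real (real (Suc n)) - w)) - (LINT v:{0<..<real (Suc N)}|lborel. 1 / (of_real v - w))))"
  proof
    fix N
    have "(LINT v:{0<..<real (Suc N)}|lborel. half_mellin K v) = (LINT v:{0<..<real (Suc N)}|lborel. c * (1 / (of_real v - w)))"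
      by (intro set_lebesgue_integral_cong) (auto simp: kh)
    also have "\<dots> = c * (LINT v:{0<..<real (Suc N)}|lborel. 1 / (of_real v - w))" by (rule set_integral_mult_right)
    finally show "(\<Sum>n<N. half_mellin K (real (Suc n))) - (LINT v:{0<..<real (Suc N)}|lborel. half_mellin K v) =
       c * ((\<Sum>n<N. 1 / (of_real (real (Suc n)) - w)) - (LINT v:{0<..<real (Suc N)}|lborel. 1 / (of_real v - w)))"
      by (simp add: kh right_diff_distrib sum_distrib_left del: of_nat_Suc)
  qed
  finally have "(\<integral>t. K t * zeta_half t \<partial>lborel) = c * log_digamma w"
    using LIMSEQ_unique tendsto_mult[OF tendsto_const Cauchy_kernel_sum_minus_integral[OF w]] by blast
  moreover have "half_mellin (\<lambda>t. sech_kernel s t * zeta_half (- t)) u = (\<integral>t. K t * zeta_half t \<partial>lborel)"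
    unfolding half_mellin_def using integral_lborel_uminus[of "\<lambda>t. K t * zeta_half t"]
    by (simp add: K_def mult_ac)
  ultimately show ?thesis by (simp add: c_def w_def)
qed

lemma integrable_poly_sech_zeta: "integrable lborel (\<lambda>t. (1 + \<bar>t\<bar>) ^ k * norm (sech_kernel s t * zeta_half (- t)))"
proof -
  obtain C where C: "C > 0" "\<And>t. norm (zeta_half t) \<le> C * (1 + \<bar>t\<bar>)" using zeta_half_bound by blast
  have "integrable lborel (\<lambda>t. C * ((1 + \<bar>t\<bar>) ^ Suc k * norm (sech_kernel s t)))"
    using integrable_poly_sech_kernel[OF s(1) Re_less_2pi, of "Suc k"] by simp
  thus ?thesis
  proof (rule Bochner_Integration.integrable_bound)
    show "AE t in lborel. norm ((1 + \<bar>t\<bar>) ^ k * norm (sech_kernel s t * zeta_half (- t))) \<le> norm (C * ((1 + \<bar>t\<bar>) ^ Suc k * norm (sech_kernel s t)))"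
    proof (intro AE_I2)
      fix t
      have "(1 + \<bar>t\<bar>) ^ k * norm (sech_kernel s t) * norm (zeta_half (- t)) \<le> (1 + \<bar>t\<bar>) ^ k * norm (sech_kernel s t) * (C * (1 + \<bar>t\<bar>))"
        using C(2)[of "-t"] by (intro mult_left_mono) auto
      thus "norm ((1 + \<bar>t\<bar>) ^ k * norm (sech_kernel s t * zeta_half (- t))) \<le> norm (C * ((1 + \<bar>t\<bar>) ^ Suc k * norm (sech_kernel s t)))"
        using C(1) by (simp add: norm_mult abs_mult mult_ac)
    qed
  qed simp
qed

lemma integrable_sech_zeta: "integrable lborel (\<lambda>t. sech_kernel s t * zeta_half (- t))"
proof (rule integrable_norm_cancel)
  show "integrable lborel (\<lambda>t. norm (sech_kernel s t * zeta_half (- t)))" using integrable_poly_sech_zeta[of 0] by simp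
qed simp

text \<open>The outer application of \<open>zeta_transform\<close>: the factor
  \<open>zeta_half (- t)\<close> sits in the kernel, and the transform supplies its conjugate
  \<open>zeta_half t\<close>.\<close>

lemma sech_zeta_square_limit:
  "(\<lambda>N. \<i> * exp (- \<i> * s / 2) * ((\<Sum>n<N. log_digamma (of_real (real (Suc n)) * rot_exp s)) -
      (LINT u:{0<..<real (Suc N)}|lborel. log_digamma (of_real u * rot_exp s))))
   \<longlonglongrightarrow> (\<integral>t. sech_kernel s t * of_real ((norm (zeta_half t))\<^sup>2) \<partial>lborel)"
proof -
  define c where "c = \<i> * exp (- \<i> * s / 2)"
  define K where "K = (\<lambda>t. sech_kernel s t * zeta_half (- t))"
  have kh: "half_mellin K u = c * log_digamma (of_real u * rot_exp s)" if "u > 0" for u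
    using half_mellin_sech_zeta[OF that] by (simp add: K_def c_def)
  have "(\<lambda>N. (\<Sum>n<N. half_mellin K (real (Suc n))) - (LINT u:{0<..<real (Suc N)}|lborel. half_mellin K u)) \<longlonglongrightarrow> (\<integral>t. K t * zeta_half t \<partial>lborel)"
    by (rule zeta_transform) (use integrable_poly_sech_zeta[of 1] in \<open>simp_all add: K_def\<close>)
  also have "(\<lambda>N. (\<Sum>n<N. half_mellin K (real (Suc n))) - (LINT u:{0<..<real (Suc N)}|lborel. half_mellin K u)) =
     (\<lambda>N. c * ((\<Sum>n<N. log_digamma (of_real (real (Suc n)) * rot_exp s)) - (LINT u:{0<..<real (Suc N)}|lborel. log_digamma (of_real u * rot_exp s))))"
  proof
    fix N
    have "(LINT u:{0<..<real (Suc N)}|lborel. half_mellin K u) = (LINT u:{0<..<real (Suc N)}|lborel. c * log_digamma (of_real u * rot_exp s))"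
      by (intro set_lebesgue_integral_cong) (auto simp: kh)
    also have "\<dots> = c * (LINT u:{0<..<real (Suc N)}|lborel. log_digamma (of_real u * rot_exp s))" by (rule set_integral_mult_right)
    finally show "(\<Sum>n<N. half_mellin K (real (Suc n))) - (LINT u:{0<..<real (Suc N)}|lborel. half_mellin K u) =
      c * ((\<Sum>n<N. log_digamma (of_real (real (Suc n)) * rot_exp s)) - (LINT u:{0<..<real (Suc N)}|lborel. log_digamma (of_real u * rot_exp s)))"
      by (simp add: kh right_diff_distrib sum_distrib_left del: of_nat_Suc)
  qed
  also have "(\<lambda>t. K t * zeta_half t) = (\<lambda>t. sech_kernel s t * of_real ((norm (zeta_half t))\<^sup>2))"
    unfolding K_def zeta_half_uminus by (simp add: mult.assoc complex_norm_square mult.commute[of "cnj _"] del: of_real_power)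
  finally show ?thesis unfolding c_def .
qed

text \<open>Integrability at the logarithmic singularity \<open>u = 0\<close> is inherited from the
  half Mellin transform, where Fubini's theorem has already settled it.\<close>

lemma set_integrable_log_digamma:
  assumes "b > 0"
  shows "set_integrable lborel {0<..<b} (\<lambda>u. log_digamma (of_real u * rot_exp s))"
proof -
  define c where "c = \<i> * exp (- \<i> * s / 2)"
  have c: "c \<noteq> 0" by (simp add: c_def)
  have "set_integrable lborel {0<..<b} (\<lambda>u. (1 / c) * half_mellin (\<lambda>t. sech_kernel s t * zeta_half (- t)) u)"
    by (intro set_integrable_mult_right set_integrable_half_mellin integrable_sech_zeta assms)
  also have "?this \<longleftrightarrow> ?thesis"
    by (intro set_integrable_cong) (use c in \<open>auto simp: half_mellin_sech_zeta c_def\<close>)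
  finally show ?thesis .
qed

end

section \<open>Splitting off the periodic part of the digamma function\<close>

text \<open>Both sides of the reflection formula for Gamma are differentiated. The common factor
  \<open>pi / sin (pi w)\<close> is nonzero and cancels, so no branch of a logarithm enters.\<close>

lemma Digamma_reflection_complex:
  fixes w :: complex
  assumes "w \<notin> \<int>"
  shows "Digamma (1 - w) = Digamma w + of_real pi * cot (of_real pi * w)"
proof -
  have w1: "w \<notin> \<int>\<^sub>\<le>\<^sub>0" using assms nonpos_Ints_Int by blast
  have w2: "1 - w \<notin> \<int>\<^sub>\<le>\<^sub>0"
  proof
    assume "1 - w \<in> \<int>\<^sub>\<le>\<^sub>0"
    hence "1 - w \<in> \<int>" by (rule nonpos_Ints_Int)
    hence "1 - (1 - w) \<in> \<int>" by (rule Ints_diff[OF Ints_1])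
    thus False using assms by simp
  qed
  have sin_nz: "sin (of_real pi * w) \<noteq> 0"
  proof
    assume "sin (of_real pi * w) = 0"
    then obtain k :: int where "of_real pi * w = of_real (of_int k * pi)" by (auto simp: sin_eq_0)
    hence "of_real pi * w = of_real pi * of_int k" by (simp add: mult.commute)
    hence "w = of_int k" by simp
    thus False using assms by simp
  qed
  have "((\<lambda>z. Gamma z * Gamma (1 - z)) has_field_derivative
      Gamma w * Gamma (1 - w) * (Digamma w - Digamma (1 - w))) (at w)"
    using w1 w2 by (auto intro!: derivative_eq_intros simp: algebra_simps)
  also have "(\<lambda>z::complex. Gamma z * Gamma (1 - z)) = (\<lambda>z. of_real pi / sin (of_real pi * z))"
    by (intro ext Gamma_reflection_complex)
  finally have d1: "((\<lambda>z. of_real pi / sin (of_real pi * z)) has_field_derivative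
      of_real pi / sin (of_real pi * w) * (Digamma w - Digamma (1 - w))) (at w)"
    unfolding Gamma_reflection_complex .
  have d2: "((\<lambda>z. of_real pi / sin (of_real pi * z)) has_field_derivative
      - (of_real pi / sin (of_real pi * w) * (of_real pi * cot (of_real pi * w)))) (at w)"
    using sin_nz by (auto intro!: derivative_eq_intros simp: cot_def)
  from DERIV_unique[OF d1 d2] sin_nz
  have "Digamma w - Digamma (1 - w) = - (of_real pi * cot (of_real pi * w))"
    by (metis (no_types, lifting) divide_eq_0_iff mult_cancel_left mult_minus_right of_real_eq_0_iff pi_neq_zero)
  thus ?thesis by (simp add: algebra_simps)
qed

definition log_digamma_reg :: "complex \<Rightarrow> complex" where
  "log_digamma_reg w = Ln w - Digamma w"

text \<open>A function of period 1 with poles at the integers; at \<open>w = n q\<close> it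
  therefore depends on \<open>n (q - 1)\<close> only. For \<open>q\<close> near 1 it carries the
  whole main term.\<close>

definition log_digamma_sing :: "complex \<Rightarrow> complex" where
  "log_digamma_sing w = - 2 * of_real pi * \<i> / (exp (2 * of_real pi * \<i> * w) - 1)"

lemma exp_neq_1_lower: "Im w < 0 \<Longrightarrow> exp (2 * of_real pi * \<i> * w) \<noteq> 1"
proof
  assume w: "Im w < 0" and "exp (2 * of_real pi * \<i> * w) = 1"
  hence "norm (exp (2 * of_real pi * \<i> * w)) = 1" by simp
  hence "- 2 * pi * Im w = 0" by simp
  thus False using w by simp
qed

text \<open>Reflection replaces digamma at \<open>1 - w\<close>, whose poles are the positive
  integers, by digamma at \<open>w\<close>, which is smooth in the right half-plane, plus a
  cotangent. The condition \<open>Im w < 0\<close> fixes the branch in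
  \<open>Ln (- w) = Ln w + \<i> pi\<close>.\<close>

lemma log_digamma_split:
  assumes w: "Im w < 0" "Re w > 0"
  shows "log_digamma w = log_digamma_reg w + log_digamma_sing w"
proof -
  have nint: "w \<notin> \<int>" using w by (auto elim!: Ints_cases)
  have w0: "w \<noteq> 0" using w by auto
  have "Ln (- w) = Ln w + \<i> * of_real pi" using w w0 by (simp add: Ln_minus)
  hence "log_digamma w = log_digamma_reg w + (\<i> * of_real pi - of_real pi * cot (of_real pi * w))"
    unfolding log_digamma_def log_digamma_reg_def Digamma_reflection_complex[OF nint] by simp
  also have "\<i> * of_real pi - of_real pi * cot (of_real pi * w) = log_digamma_sing w"
  proof -
    define A where "A = exp (\<i> * (of_real pi * w))"
    define E where "E = exp (2 * of_real pi * \<i> * w)"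
    have E1: "E \<noteq> 1" unfolding E_def by (rule exp_neq_1_lower[OF w(1)])
    have EA: "E = A * A" unfolding E_def A_def by (simp flip: exp_add add: mult_ac)
    have A0: "A \<noteq> 0" by (simp add: A_def)
    have inv: "exp (- (\<i> * (of_real pi * w))) = 1 / A" by (simp add: A_def exp_minus inverse_eq_divide)
    have AA: "A * A \<noteq> 1" using E1 EA by simp
    have "cos (of_real pi * w) = (A * A + 1) / (2 * A)"
      unfolding cos_exp_eq inv A_def[symmetric] using A0 by (simp add: field_simps)
    moreover have "sin (of_real pi * w) = (A * A - 1) / (2 * \<i> * A)"
      unfolding sin_exp_eq inv A_def[symmetric] using A0 by (simp add: field_simps)
    ultimately have "cot (of_real pi * w) = \<i> * (A * A + 1) / (A * A - 1)"
      using A0 AA by (simp add: cot_def)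
    moreover have "\<i> * of_real pi - of_real pi * (\<i> * (A * A + 1) / (A * A - 1)) = - 2 * of_real pi * \<i> / (A * A - 1)"
      using AA by (simp add: field_simps)
    ultimately show ?thesis unfolding log_digamma_sing_def E_def[symmetric] EA by simp
  qed
  finally show ?thesis .
qed

lemma pos_Re_notin_nonpos_Ints: "Re w > 0 \<Longrightarrow> w \<notin> \<int>\<^sub>\<le>\<^sub>0"
  by (auto elim!: nonpos_Ints_cases)

lemma log_digamma_reg_has_field_derivative:
  assumes "Re w > 0"
  shows "(log_digamma_reg has_field_derivative (1 / w - Polygamma 1 w)) (at w)"
  unfolding log_digamma_reg_def using assms pos_Re_notin_nonpos_Ints[OF assms]
  by (auto intro!: derivative_eq_intros simp: complex_nonpos_Reals_iff inverse_eq_divide)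

text \<open>Telescoping \<open>1 / w\<close> against the series of the trigamma function leaves the
  terms \<open>- 1 / ((w + k)^2 (w + k + 1))\<close>. These are cubically small and are summed by
  comparison with a second telescoping series, of inverse squares.\<close>

lemma norm_deriv_log_digamma_reg_le:
  assumes w: "Re w > 0" "norm w \<ge> 1/2"
  shows "norm (1 / w - Polygamma 1 w) \<le> 36 / (norm w)\<^sup>2"
proof -
  define r where "r = norm w"
  have w0: "w \<noteq> 0" using w by auto
  have xk: "norm (w + of_nat k) \<ge> (r + real k) / 2" "w + of_nat k \<noteq> 0" "norm (w + of_nat k + 1) \<ge> norm (w + of_nat k)" for k
  proof -
    have "norm (w + of_nat k) \<ge> r" unfolding r_def cmod_def by (rule real_sqrt_le_mono) (use w in \<open>auto intro!: power_mono\<close>)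
    moreover have "real k \<le> Re (w + of_nat k)" using w by simp
    hence "real k \<le> norm (w + of_nat k)" using complex_Re_le_cmod order_trans by blast
    ultimately show "norm (w + of_nat k) \<ge> (r + real k) / 2" by simp
    have "Re (w + of_nat k) \<noteq> 0" using w by (simp add: add_pos_nonneg less_imp_neq[symmetric])
    thus "w + of_nat k \<noteq> 0" by (metis zero_complex.sel(1))
    show "norm (w + of_nat k + 1) \<ge> norm (w + of_nat k)"
      unfolding cmod_def by (rule real_sqrt_le_mono) (use w in \<open>auto intro!: power_mono\<close>)
  qed
  have s1: "(\<lambda>k. 1 / (w + of_nat k) - 1 / (w + of_nat (Suc k))) sums (1 / (w + of_nat 0) - 0)"
  proof (rule telescope_sums')
    have "(\<lambda>k. norm (1 / (w + of_nat k))) \<longlonglongrightarrow> 0"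
    proof (rule tendsto_sandwich[OF _ _ tendsto_const])
      show "\<forall>\<^sub>F k in sequentially. norm (1 / (w + of_nat k)) \<le> 1 / real k"
        using eventually_gt_at_top[of 0]
      proof eventually_elim
        case (elim k)
        have "real k \<le> Re (w + of_nat k)" using w by simp
        hence "real k \<le> norm (w + of_nat k)" using complex_Re_le_cmod order_trans by blast
        thus ?case using elim by (simp add: norm_divide frac_le)
      qed
    qed (auto intro: lim_1_over_n)
    thus "(\<lambda>k. 1 / (w + of_nat k)) \<longlonglongrightarrow> 0" by (rule tendsto_norm_zero_cancel)
  qed
  have s2: "(\<lambda>k. inverse ((w + of_nat k) ^ Suc 1)) sums ((-1) ^ Suc 1 * Polygamma 1 w / fact 1)"
    by (rule Polygamma_LIMSEQ) (use w0 in auto)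
  have s3: "(\<lambda>k. (1 / (w + of_nat k) - 1 / (w + of_nat (Suc k))) - inverse ((w + of_nat k) ^ Suc 1)) sums (1 / w - Polygamma 1 w)"
    using sums_diff[OF s1 s2] by simp
  have s4: "(\<lambda>k. 36 * (1 / (r + real k)\<^sup>2 - 1 / (r + real (Suc k))\<^sup>2)) sums (36 * (1 / (r + real 0)\<^sup>2 - 0))"
    by (intro sums_mult telescope_sums') real_asymp
  have trm: "norm ((1 / (w + of_nat k) - 1 / (w + of_nat (Suc k))) - inverse ((w + of_nat k) ^ Suc 1)) \<le> 36 * (1 / (r + real k)\<^sup>2 - 1 / (r + real (Suc k))\<^sup>2)" for k
  proof -
    define x where "x = w + of_nat k"
    define y where "y = r + real k"
    have y: "y \<ge> 1/2" using w by (simp add: y_def r_def)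
    have x: "x \<noteq> 0" "norm x \<ge> y / 2" "norm (x + 1) \<ge> norm x" using xk[of k] by (auto simp: x_def y_def)
    have x1: "x + 1 \<noteq> 0" using x y by auto
    have "(1 / x - 1 / (x + 1)) - inverse (x ^ Suc 1) = - 1 / (x * x * (x + 1))"
    proof -
      have "(1 / x - 1 / z) - inverse (x ^ Suc 1) = (x * (z - x) - z) / (x * x * z)" if "z \<noteq> 0" for z
        using x(1) that by (simp add: field_simps)
      from this[OF x1] show ?thesis by simp
    qed
    hence "norm ((1 / x - 1 / (x + 1)) - inverse (x ^ Suc 1)) = 1 / (norm x * norm x * norm (x + 1))"
      by (simp add: norm_divide norm_mult)
    also have "\<dots> \<le> 1 / ((y / 2) * (y / 2) * (y / 2))"
      using x y by (intro frac_le mult_mono) auto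
    \<comment> \<open>By \<open>y + 1 <= 3 y\<close> the difference of inverse squares is at least
      \<open>(2/9) / y^3\<close>, and \<open>36 * 2/9 = 8\<close> matches the three factors 1/2 on
      the left.\<close>
    also have "\<dots> \<le> 36 * (1 / y\<^sup>2 - 1 / (y + 1)\<^sup>2)"
    proof -
      have "1 / y\<^sup>2 - 1 / (y + 1)\<^sup>2 = ((y + 1)\<^sup>2 - y\<^sup>2) / (y\<^sup>2 * (y + 1)\<^sup>2)"
        using y by (subst diff_frac_eq) auto
      also have "(y + 1)\<^sup>2 - y\<^sup>2 = 2 * y + 1" by (simp add: power2_eq_square algebra_simps)
      also have "(2 * y + 1) / (y\<^sup>2 * (y + 1)\<^sup>2) \<ge> (2 * y) / (y\<^sup>2 * (3 * y)\<^sup>2)"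
        using y by (intro frac_le mult_left_mono power_mono) auto
      also have "(2 * y) / (y\<^sup>2 * (3 * y)\<^sup>2) = (2/9) / (y * y * y)"
        using y by (simp add: field_simps power2_eq_square)
      finally show ?thesis using y by (simp add: field_simps)
    qed
    finally show ?thesis by (simp add: x_def y_def algebra_simps)
  qed
  have "norm (1 / w - Polygamma 1 w) \<le> 36 * (1 / (r + real 0)\<^sup>2 - 0)"
    unfolding sums_unique[OF s3] sums_unique[OF s4] by (rule norm_suminf_le[OF trm sums_summable[OF s4]])
  thus ?thesis by (simp add: r_def)
qed

section \<open>Uniform bounds for s near 0\<close>

text \<open>A compact set away from the poles of digamma that contains \<open>1 - u q\<close> for
  \<open>0 < u < 1/2\<close> and \<open>u q\<close> for \<open>1/2 <= u <= 1\<close> whenever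
  \<open>q\<close> is within 1/4 of 1.\<close>

definition right_box :: "complex set" where
  "right_box = {z. Re z \<ge> 1/4} \<inter> cball 0 2"

lemma compact_right_box: "compact right_box"
  unfolding right_box_def by (intro closed_Int_compact closed_halfspace_Re_ge compact_cball)

lemma compact_imp_norm_bound:
  fixes f :: "complex \<Rightarrow> complex"
  assumes "compact A" "continuous_on A f"
  shows "\<exists>C\<ge>0. \<forall>z\<in>A. norm (f z) \<le> C"
proof -
  have "bounded (f ` A)" by (intro compact_imp_bounded compact_continuous_image assms)
  then obtain C where "\<And>y. y \<in> f ` A \<Longrightarrow> norm y \<le> C" by (auto simp: bounded_iff)
  thus ?thesis by (intro exI[of _ "max C 0"]) (auto simp: max.coboundedI1)
qed

lemma Digamma_right_box_bound: "\<exists>C\<ge>0. \<forall>z\<in>right_box. norm (Digamma z) \<le> C"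
proof (rule compact_imp_norm_bound[OF compact_right_box])
  have "right_box \<inter> \<int>\<^sub>\<le>\<^sub>0 = {}" using pos_Re_notin_nonpos_Ints by (force simp: right_box_def)
  thus "continuous_on right_box (Digamma :: complex \<Rightarrow> complex)"
    by (intro holomorphic_on_imp_continuous_on holomorphic_on_Polygamma)
qed

lemma log_digamma_reg_right_box_bound: "\<exists>C\<ge>0. \<forall>z\<in>right_box. norm (log_digamma_reg z) \<le> C"
proof (rule compact_imp_norm_bound[OF compact_right_box])
  show "continuous_on right_box log_digamma_reg"
    by (intro continuous_at_imp_continuous_on ballI DERIV_isCont[OF log_digamma_reg_has_field_derivative]) (auto simp: right_box_def)
qed

text \<open>For \<open>|u q| >= 3 a / 4\<close> the derivative bound is
  \<open>36 * (16/9) / a^2 = 64 / a^2\<close>, and the chain rule factor \<open>|q| <= 5/4\<close>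
  makes it \<open>80 / a^2\<close>, which is summable over the integers \<open>a\<close>.\<close>

lemma log_digamma_reg_sum_integral_diff:
  assumes q: "Re q > 0" "norm q \<ge> 3/4" "norm q \<le> 5/4" and a: "a \<ge> 1"
  shows "norm (log_digamma_reg (of_real a * q) - integral {a..a+1} (\<lambda>u. log_digamma_reg (of_real u * q))) \<le> 80 / a\<^sup>2"
proof -
  have Re: "Re (of_real u * q) > 0" if "u \<ge> a" for u using that a q by simp
  have d: "((\<lambda>z. log_digamma_reg (z * q)) has_field_derivative ((1 / (of_real u * q) - Polygamma 1 (of_real u * q)) * q)) (at (of_real u))" if "u \<ge> a" for u
  proof (rule DERIV_chain2[where f = log_digamma_reg and g = "\<lambda>z. z * q"])
    show "(log_digamma_reg has_field_derivative 1 / (of_real u * q) - Polygamma 1 (of_real u * q)) (at (of_real u * q))"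
      by (rule log_digamma_reg_has_field_derivative[OF Re[OF that]])
  qed (auto intro!: derivative_eq_intros)
  have dbnd: "norm ((1 / (of_real u * q) - Polygamma 1 (of_real u * q)) * q) \<le> 80 / a\<^sup>2" if u: "u \<ge> a" for u
  proof -
    have "a * (3/4) \<le> u * norm q" using u a q by (intro mult_mono) auto
    hence n: "norm (of_real u * q) \<ge> a * (3/4)" using u a by (simp add: norm_mult)
    have "norm (1 / (of_real u * q) - Polygamma 1 (of_real u * q)) \<le> 36 / (norm (of_real u * q))\<^sup>2"
      by (rule norm_deriv_log_digamma_reg_le) (use Re[OF u] n a in auto)
    also have "\<dots> \<le> 36 / (a * (3/4))\<^sup>2" using n a by (intro divide_left_mono power_mono mult_pos_pos) auto
    also have "\<dots> = 64 / a\<^sup>2" by (simp add: power2_eq_square)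
    finally have "norm (1 / (of_real u * q) - Polygamma 1 (of_real u * q)) * norm q \<le> 64 / a\<^sup>2 * (5/4)"
      using q by (intro mult_mono) auto
    thus ?thesis by (simp add: norm_mult)
  qed
  define S where "S = closed_segment (of_real a) (of_real (a + 1) :: complex)"
  have S: "S = of_real ` {a..a+1}" unfolding S_def closed_segment_of_real by (simp add: closed_segment_eq_real_ivl)
  have lip: "norm (log_digamma_reg (of_real u * q) - log_digamma_reg (of_real a * q)) \<le> 80 / a\<^sup>2" if u: "u \<in> {a..a+1}" for u
  proof -
    have "norm (log_digamma_reg (of_real u * q) - log_digamma_reg (of_real a * q)) \<le> 80 / a\<^sup>2 * norm (of_real u - of_real a :: complex)"
    proof (rule field_differentiable_bound[of S])
      show "convex S" by (simp add: S_def)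
      fix z assume "z \<in> S"
      then obtain v where v: "z = of_real v" "v \<ge> a" by (auto simp: S)
      show "((\<lambda>z. log_digamma_reg (z * q)) has_field_derivative ((1 / (z * q) - Polygamma 1 (z * q)) * q)) (at z within S)"
        unfolding v(1) by (rule has_field_derivative_at_within[OF d[OF v(2)]])
      show "norm ((1 / (z * q) - Polygamma 1 (z * q)) * q) \<le> 80 / a\<^sup>2" unfolding v(1) by (rule dbnd[OF v(2)])
    qed (use u in \<open>auto simp: S\<close>)
    also have "norm (of_real u - of_real a :: complex) = u - a" using u by (simp flip: of_real_diff)
    also have "80 / a\<^sup>2 * (u - a) \<le> 80 / a\<^sup>2 * 1" using u by (intro mult_left_mono) auto
    finally show ?thesis by simp
  qed
  have cont: "continuous_on {a..a+1} (\<lambda>u. log_digamma_reg (of_real u * q))"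
  proof (rule continuous_on_compose2[of "{z. Re z > 0}" log_digamma_reg])
    show "continuous_on {z. Re z > 0} log_digamma_reg"
      by (intro continuous_at_imp_continuous_on ballI DERIV_isCont[OF log_digamma_reg_has_field_derivative]) auto
  qed (use Re in \<open>auto intro!: continuous_intros\<close>)
  have hi: "((\<lambda>u. log_digamma_reg (of_real a * q) - log_digamma_reg (of_real u * q)) has_integral
     (log_digamma_reg (of_real a * q) - integral {a..a+1} (\<lambda>u. log_digamma_reg (of_real u * q)))) (cbox a (a+1))"
    using has_integral_diff[OF has_integral_const_real[of "log_digamma_reg (of_real a * q)" a "a+1"] integrable_integral[OF integrable_continuous_real[OF cont]]]
    by simp
  have "norm (log_digamma_reg (of_real a * q) - integral {a..a+1} (\<lambda>u. log_digamma_reg (of_real u * q))) \<le> 80 / a\<^sup>2 * measure lborel (cbox a (a+1))"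
    by (rule has_integral_bound[OF _ hi]) (use lip in \<open>auto simp: norm_minus_commute\<close>)
  thus ?thesis by simp
qed

text \<open>The logarithmic singularity is absorbed by \<open>u powr (- 1/2)\<close>, which is
  integrable at 0; the 5 collects \<open>|ln (norm q)| <= 1\<close> and
  \<open>pi <= 4\<close>.\<close>

lemma Ln_small_bound:
  assumes u: "u > 0" "u \<le> 1" and q: "norm q \<ge> 3/4" "norm q \<le> 5/4"
  shows "norm (Ln (- (of_real u * q))) \<le> 2 * u powr (- 1/2) + 5"
proof -
  have q0: "q \<noteq> 0" using q by auto
  have "norm (Ln (- (of_real u * q))) \<le> \<bar>ln (u * norm q)\<bar> + pi"
  proof -
    define w where "w = - (of_real u * q)"
    have w0: "w \<noteq> 0" using u q0 by (simp add: w_def)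
    have "norm (Ln w) \<le> \<bar>Re (Ln w)\<bar> + \<bar>Im (Ln w)\<bar>" by (rule cmod_le)
    also have "Re (Ln w) = ln (u * norm q)" using w0 u by (simp add: Re_Ln w_def norm_mult)
    also have "\<bar>Im (Ln w)\<bar> \<le> pi" using mpi_less_Im_Ln[OF w0] Im_Ln_le_pi[OF w0] by (simp add: abs_le_iff)
    finally show ?thesis by (simp add: w_def)
  qed
  moreover have "\<bar>ln (u * norm q)\<bar> \<le> - ln u + 1"
  proof -
    have "ln (norm q) \<le> norm q - 1" using q by (intro ln_le_minus_one) auto
    moreover have "- ln (norm q) = ln (1 / norm q)" using q by (simp add: ln_div)
    moreover have "ln (1 / norm q) \<le> 1 / norm q - 1" using q by (intro ln_le_minus_one) auto
    moreover have "1 / norm q \<le> 1 / (3/4)" using q by (intro divide_left_mono) auto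
    ultimately have "\<bar>ln (norm q)\<bar> \<le> 1" using q by (auto simp: abs_le_iff)
    moreover have "ln (u * norm q) = ln u + ln (norm q)" using u q0 by (simp add: ln_mult)
    moreover have "ln u \<le> 0" using u by simp
    ultimately show ?thesis by linarith
  qed
  moreover have "- ln u \<le> 2 * u powr (- 1/2)"
  proof -
    have "ln (u powr (- 1/2)) \<le> u powr (- 1/2) - 1" using u by (intro ln_le_minus_one) auto
    thus ?thesis using u by (simp add: ln_powr)
  qed
  moreover have "pi \<le> 4" by (rule less_imp_le[OF pi_less_4])
  ultimately show ?thesis by linarith
qed

text \<open>As \<open>Im q < 0\<close>, the number \<open>E = exp (- 2 pi \<i> u q)\<close> has
  absolute value below 1, so \<open>1 - E\<close> stays in the right half-plane and its logarithm is
  a primitive up to the factor \<open>- 1 / q\<close>. The start at 1/2 avoids the pole at 0 and,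
  for \<open>q\<close> near 1, puts the exponential near -1.\<close>

lemma integral_log_digamma_sing:
  assumes q: "Im q < 0" and b: "b \<ge> 1/2"
  shows "((\<lambda>u. log_digamma_sing (of_real u * q)) has_integral
     ((Ln (1 - exp (- of_real pi * \<i> * q)) - Ln (1 - exp (- 2 * of_real pi * \<i> * of_real b * q))) / q)) {1/2..b}"
proof -
  have q0: "q \<noteq> 0" using q by auto
  define F where "F = (\<lambda>z. - Ln (1 - exp (- 2 * of_real pi * \<i> * z * q)) / q)"
  have "((\<lambda>u. log_digamma_sing (of_real u * q)) has_integral (F (of_real b) - F (of_real (1/2)))) {1/2..b}"
  proof (rule fundamental_theorem_of_calculus)
    fix u assume u: "u \<in> {1/2..b}"
    define E where "E = exp (- 2 * of_real pi * \<i> * of_real u * q)"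
    have "u * Im q < 0" using u q by (intro mult_pos_neg) auto
    hence "pi * (u * Im q) < 0" by (rule mult_pos_neg[OF pi_gt_zero])
    hence "norm E < 1" by (simp add: E_def mult_ac)
    hence "Re E < 1" using complex_Re_le_cmod[of E] by linarith
    hence nz: "1 - E \<notin> \<real>\<^sub>\<le>\<^sub>0" and E1: "1 - E \<noteq> 0" by (auto simp: complex_nonpos_Reals_iff)
    have E0: "E \<noteq> 0" by (simp add: E_def)
    have inv: "exp (2 * of_real pi * \<i> * (of_real u * q)) = 1 / E"
    proof -
      have "exp (2 * of_real pi * \<i> * (of_real u * q)) * E = 1" unfolding E_def by (simp flip: exp_add)
      thus ?thesis using E0 by (simp add: field_simps)
    qed
    have "((\<lambda>z. exp (- 2 * of_real pi * \<i> * z * q)) has_field_derivative (- 2 * of_real pi * \<i> * q) * E) (at (of_real u))"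
      by (auto intro!: derivative_eq_intros simp: E_def)
    hence "((\<lambda>z. 1 - exp (- 2 * of_real pi * \<i> * z * q)) has_field_derivative (2 * of_real pi * \<i> * q) * E) (at (of_real u))"
      using DERIV_diff[OF DERIV_const[of 1]] by fastforce
    moreover have "(Ln has_field_derivative inverse (1 - E)) (at (1 - exp (- 2 * of_real pi * \<i> * of_real u * q)))"
      using nz unfolding E_def[symmetric] by (rule has_field_derivative_Ln)
    ultimately have "((\<lambda>z. Ln (1 - exp (- 2 * of_real pi * \<i> * z * q))) has_field_derivative inverse (1 - E) * ((2 * of_real pi * \<i> * q) * E)) (at (of_real u))"
      by (rule DERIV_chain2[rotated])
    hence "(F has_field_derivative - (inverse (1 - E) * ((2 * of_real pi * \<i> * q) * E)) / q) (at (of_real u))"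
      unfolding F_def by (intro DERIV_cdivide DERIV_minus)
    also have "- (inverse (1 - E) * ((2 * of_real pi * \<i> * q) * E)) / q = log_digamma_sing (of_real u * q)"
      unfolding log_digamma_sing_def inv using E0 E1 q0 by (simp add: field_simps)
    finally show "((\<lambda>u. F (of_real u)) has_vector_derivative log_digamma_sing (of_real u * q)) (at u within {1/2..b})"
      by (rule has_vector_derivative_real_field)
  qed (use b in auto)
  moreover have "F (of_real b) - F (of_real (1/2)) = (Ln (1 - exp (- of_real pi * \<i> * q)) - Ln (1 - exp (- 2 * of_real pi * \<i> * of_real b * q))) / q"
    by (simp add: F_def diff_divide_distrib)
  ultimately show ?thesis by simp
qed

text \<open>A right half-disc reaching up to the imaginary axis, as the Cauchy circles in
  \<open>cumul_compare\<close> demand; the radius 1/8 keeps \<open>rot_exp s\<close> within 1/4 of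
  1.\<close>

definition small_sector :: "complex set" where
  "small_sector = {s. 0 < Re s \<and> norm s \<le> 1/8}"

lemma exp_minus_1_bounds:
  fixes z :: complex
  assumes z: "norm z \<le> 1/8"
  shows "norm (exp z - 1) \<le> 2 * norm z" and "norm (exp z - 1 - z) \<le> 3 * (norm z)\<^sup>2"
proof -
  have "norm (exp z - (\<Sum>k\<le>1. z ^ k / fact k)) \<le> exp \<bar>Re z\<bar> * (norm z ^ Suc 1) / fact 1"
    by (rule Taylor_exp)
  also have "\<dots> \<le> 3 * (norm z)\<^sup>2"
  proof -
    have "exp \<bar>Re z\<bar> \<le> exp 1" using abs_Re_le_cmod[of z] z by simp
    also have "\<dots> \<le> (3::real)" by (rule exp_le)
    finally show ?thesis by (simp add: power2_eq_square mult_right_mono)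
  qed
  finally show 2: "norm (exp z - 1 - z) \<le> 3 * (norm z)\<^sup>2" by (simp add: algebra_simps)
  have "norm (exp z - 1) \<le> norm (exp z - 1 - z) + norm z" using norm_triangle_ineq[of "exp z - 1 - z" z] by simp
  also have "\<dots> \<le> 3 * norm z * norm z + norm z" using 2 by (simp add: power2_eq_square)
  also have "\<dots> \<le> 1 * norm z + norm z" using z by (intro add_mono mult_right_mono) auto
  finally show "norm (exp z - 1) \<le> 2 * norm z" by simp
qed

lemma rot_exp_near_1:
  assumes "s \<in> small_sector"
  shows "norm (rot_exp s - 1) \<le> 1/4" "Re (rot_exp s) \<ge> 3/4" "norm (rot_exp s) \<ge> 3/4" "norm (rot_exp s) \<le> 5/4" "Im (rot_exp s) < 0"
proof -
  have "norm (exp (- \<i> * s) - 1) \<le> 2 * norm (- \<i> * s)"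
    using assms by (intro exp_minus_1_bounds) (auto simp: small_sector_def norm_mult)
  also have "\<dots> = 2 * norm s" by (simp add: norm_mult)
  finally show *: "norm (rot_exp s - 1) \<le> 1/4" using assms by (simp add: rot_exp_def small_sector_def)
  show "Re (rot_exp s) \<ge> 3/4" using abs_Re_le_cmod[of "rot_exp s - 1"] * by simp
  show "norm (rot_exp s) \<ge> 3/4" using norm_triangle_ineq4[of "rot_exp s" "rot_exp s - 1"] * by simp
  show "norm (rot_exp s) \<le> 5/4" using norm_triangle_ineq[of "rot_exp s - 1" 1] * by simp
  have "Re s \<le> 1/8" using assms complex_Re_le_cmod[of s] by (simp add: small_sector_def)
  thus "Im (rot_exp s) < 0" using assms pi_gt3 by (intro Im_rot_exp_neg) (auto simp: small_sector_def)
qed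

text \<open>For \<open>q\<close> near 1 the exponential is near -1, so the logarithm is taken near
  2, away from its cut; compactness gives the bound.\<close>

lemma Ln_near_2_bound: "\<exists>C\<ge>0. \<forall>q. norm (q - 1) \<le> 1/4 \<longrightarrow> norm (Ln (1 - exp (- of_real pi * \<i> * q))) \<le> C"
proof -
  have "\<exists>C\<ge>0. \<forall>q\<in>cball 1 (1/4). norm (Ln (1 - exp (- of_real pi * \<i> * q))) \<le> C"
  proof (rule compact_imp_norm_bound[OF compact_cball])
    show "continuous_on (cball 1 (1/4)) (\<lambda>q. Ln (1 - exp (- of_real pi * \<i> * q)))"
    proof (intro continuous_intros)
      fix q :: complex assume "q \<in> cball 1 (1/4)"
      hence "\<bar>Re q - 1\<bar> \<le> 1/4" using abs_Re_le_cmod[of "q - 1"] by (simp add: dist_norm norm_minus_commute)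
      hence r: "1/2 < Re q" "Re q < 3/2" by linarith+
      have "pi * (1/2) < pi * Re q" "pi * Re q < pi * (3/2)"
        by (intro mult_strict_left_mono r pi_gt_zero)+
      hence "- (pi / 2) < pi * Re q - pi" "pi * Re q - pi < pi / 2" by linarith+
      hence "cos (pi * Re q - pi) > 0" by (rule cos_gt_zero_pi)
      hence "cos (pi * Re q) < 0" by (simp add: cos_diff)
      hence "Re (exp (- of_real pi * \<i> * q)) < 0" by (simp add: Re_exp mult_pos_neg)
      thus "1 - exp (- of_real pi * \<i> * q) \<notin> \<real>\<^sub>\<le>\<^sub>0" by (auto simp: complex_nonpos_Reals_iff)
    qed
  qed
  thus ?thesis by (auto simp: dist_norm norm_minus_commute)
qed

text \<open>On \<open>(0, 1/2)\<close> the function is left unsplit, since both parts have a pole at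
  0. Beyond that, the regular part is compared interval by interval and the singular integral is
  known in closed form. Its upper end term is not bounded uniformly in \<open>s\<close> and
  \<open>N\<close>; it stays explicit because for fixed \<open>s\<close> it vanishes as
  \<open>N\<close> grows.\<close>

lemma log_digamma_sum_integral_bound:
  "\<exists>C\<ge>0. \<forall>s\<in>small_sector. \<forall>N.
     norm ((\<Sum>n<N. log_digamma (of_real (real (Suc n)) * rot_exp s)) -
        (LINT u:{0<..<real (Suc N)}|lborel. log_digamma (of_real u * rot_exp s))
        - (\<Sum>n<N. log_digamma_sing (of_real (real (Suc n)) * rot_exp s)))
     \<le> C + 2 * norm (Ln (1 - exp (- 2 * of_real pi * \<i> * of_real (real (Suc N)) * rot_exp s)))"
proof -
  obtain CD where CD: "CD \<ge> 0" "\<And>z. z \<in> right_box \<Longrightarrow> norm (Digamma z) \<le> CD" using Digamma_right_box_bound by blast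
  obtain CG where CG: "CG \<ge> 0" "\<And>z. z \<in> right_box \<Longrightarrow> norm (log_digamma_reg z) \<le> CG" using log_digamma_reg_right_box_bound by blast
  obtain CL where CL: "CL \<ge> 0" "\<And>q. norm (q - 1) \<le> 1/4 \<Longrightarrow> norm (Ln (1 - exp (- of_real pi * \<i> * q))) \<le> CL"
    using Ln_near_2_bound by blast
  define S2 where "S2 = (\<Sum>n. 80 / (real (Suc n))\<^sup>2)"
  have sm: "summable (\<lambda>n. 80 / (real (Suc n))\<^sup>2)"
  proof -
    have "summable (\<lambda>n. 80 * (1 / (real (Suc n))\<^sup>2))"
      using inverse_squares_sums by (intro summable_mult) (auto simp: sums_iff)
    thus ?thesis by simp
  qed
  define I0 where "I0 = integral {0..1/2} (\<lambda>u::real. 2 * u powr (- 1/2) + (5 + CD))"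
  have int0: "(\<lambda>u::real. 2 * u powr (- 1/2) + (5 + CD)) integrable_on {0..1/2}"
  proof -
    have "(\<lambda>u::real. u powr (- 1/2)) integrable_on {0..1/2}"
      using has_integral_powr_from_0[of "-1/2" "1/2"] by (auto simp: integrable_on_def)
    thus ?thesis by (intro integrable_add integrable_on_cmult_left integrable_const_ivl) auto
  qed
  have "norm ((\<Sum>n<N. log_digamma (of_real (real (Suc n)) * rot_exp s)) -
        (LINT u:{0<..<real (Suc N)}|lborel. log_digamma (of_real u * rot_exp s))
        - (\<Sum>n<N. log_digamma_sing (of_real (real (Suc n)) * rot_exp s)))
     \<le> (S2 + I0 + CG + 2 * CL) + 2 * norm (Ln (1 - exp (- 2 * of_real pi * \<i> * of_real (real (Suc N)) * rot_exp s)))"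
    if s: "s \<in> small_sector" for s N
  proof -
    define q where "q = rot_exp s"
    note q = rot_exp_near_1[OF s, folded q_def]
    define b where "b = real (Suc N)"
    have b: "b \<ge> 1" by (simp add: b_def)
    have s': "0 < Re s" "Re s < pi" using s complex_Re_le_cmod[of s] pi_gt3 by (auto simp: small_sector_def)
    have split: "log_digamma (of_real u * q) = log_digamma_reg (of_real u * q) + log_digamma_sing (of_real u * q)" if "u > 0" for u
      using that q by (intro log_digamma_split) (auto simp: mult_pos_neg)
    have si: "set_integrable lborel {0<..<b} (\<lambda>u. log_digamma (of_real u * q))"
      unfolding q_def by (rule set_integrable_log_digamma[OF s']) (use b in auto)
    have hk: "(\<lambda>u. log_digamma (of_real u * q)) integrable_on {0..b}" 
      using set_borel_integral_eq_integral(1)[OF si] by (simp add: integrable_on_open_interval_real)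
    have lint: "(LINT u:{0<..<b}|lborel. log_digamma (of_real u * q)) = integral {0..b} (\<lambda>u. log_digamma (of_real u * q))"
      using set_borel_integral_eq_integral(2)[OF si] by (simp add: integral_open_interval_real)
    have hk0: "(\<lambda>u. log_digamma (of_real u * q)) integrable_on {0..1/2}"
      by (rule integrable_on_subinterval[OF hk]) (use b in auto)
    have contG: "continuous_on {1/2..} (\<lambda>u. log_digamma_reg (of_real u * q))"
    proof (rule continuous_on_compose2[of "{z. Re z > 0}" log_digamma_reg])
      show "continuous_on {z. Re z > 0} log_digamma_reg"
        by (intro continuous_at_imp_continuous_on ballI DERIV_isCont[OF log_digamma_reg_has_field_derivative]) auto
    qed (use q in \<open>auto intro!: continuous_intros\<close>)
    have regI: "(\<lambda>u. log_digamma_reg (of_real u * q)) integrable_on {x..y}" if "x \<ge> 1/2" for x y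
      by (intro integrable_continuous_real continuous_on_subset[OF contG]) (use that in auto)
    have singI: "((\<lambda>u. log_digamma_sing (of_real u * q)) has_integral
       ((Ln (1 - exp (- of_real pi * \<i> * q)) - Ln (1 - exp (- 2 * of_real pi * \<i> * of_real b * q))) / q)) {1/2..b}"
      by (rule integral_log_digamma_sing) (use q b in auto)
    define Lb where "Lb = norm (Ln (1 - exp (- 2 * of_real pi * \<i> * of_real b * q)))"
    have i1: "integral {0..b} (\<lambda>u. log_digamma (of_real u * q)) = integral {0..1/2} (\<lambda>u. log_digamma (of_real u * q)) + integral {1/2..b} (\<lambda>u. log_digamma (of_real u * q))"
      using b by (intro Henstock_Kurzweil_Integration.integral_combine[symmetric] hk) auto
    have i2: "integral {1/2..b} (\<lambda>u. log_digamma (of_real u * q)) = integral {1/2..b} (\<lambda>u. log_digamma_reg (of_real u * q)) + integral {1/2..b} (\<lambda>u. log_digamma_sing (of_real u * q))"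
    proof -
      have "integral {1/2..b} (\<lambda>u. log_digamma (of_real u * q)) = integral {1/2..b} (\<lambda>u. log_digamma_reg (of_real u * q) + log_digamma_sing (of_real u * q))"
        by (intro Henstock_Kurzweil_Integration.integral_cong split) auto
      thus ?thesis using Henstock_Kurzweil_Integration.integral_add[OF regI[of "1/2" b]] singI by (auto simp: integrable_on_def)
    qed
    have i3: "integral {1/2..b} (\<lambda>u. log_digamma_reg (of_real u * q)) = integral {1/2..1} (\<lambda>u. log_digamma_reg (of_real u * q)) + (\<Sum>n<N. integral {real (Suc n)..real (Suc n) + 1} (\<lambda>u. log_digamma_reg (of_real u * q)))"
    proof -
      have "integral {1/2..real (Suc M)} (\<lambda>u. log_digamma_reg (of_real u * q)) = integral {1/2..1} (\<lambda>u. log_digamma_reg (of_real u * q)) + (\<Sum>n<M. integral {real (Suc n)..real (Suc n) + 1} (\<lambda>u. log_digamma_reg (of_real u * q)))" for M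
      proof (induction M)
        case (Suc M)
        have "integral {1/2..real (Suc (Suc M))} (\<lambda>u. log_digamma_reg (of_real u * q)) = integral {1/2..real (Suc M)} (\<lambda>u. log_digamma_reg (of_real u * q)) + integral {real (Suc M)..real (Suc (Suc M))} (\<lambda>u. log_digamma_reg (of_real u * q))"
          by (intro Henstock_Kurzweil_Integration.integral_combine[symmetric] regI) auto
        thus ?case using Suc by (simp add: add_ac)
      qed simp
      thus ?thesis by (simp add: b_def)
    qed
    have n0: "norm (integral {0..1/2} (\<lambda>u. log_digamma (of_real u * q))) \<le> I0"
      unfolding I0_def integral_open_interval_real
    proof (rule integral_norm_bound_integral[OF hk0[folded integrable_on_open_interval_real] int0[folded integrable_on_open_interval_real]])
      fix u :: real assume u: "u \<in> {0<..<1/2}"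
      have nuq: "norm (of_real u * q) \<le> 5/8"
      proof -
        have "u * norm q \<le> (1/2) * (5/4)" using u q by (intro mult_mono) auto
        thus ?thesis using u by (simp add: norm_mult)
      qed
      have "1 - of_real u * q \<in> right_box"
      proof -
        have "Re (of_real u * q) \<le> 5/8" using complex_Re_le_cmod[of "of_real u * q"] nuq by linarith
        moreover have "norm (1 - of_real u * q) \<le> 1 + 5/8" using norm_triangle_ineq4[of 1 "of_real u * q"] nuq by simp
        ultimately show ?thesis by (simp add: right_box_def)
      qed
      hence "norm (Digamma (1 - of_real u * q)) \<le> CD" by (rule CD(2))
      moreover have "norm (Ln (- (of_real u * q))) \<le> 2 * u powr (- 1/2) + 5"
        using u q by (intro Ln_small_bound) auto
      ultimately show "norm (log_digamma (of_real u * q)) \<le> 2 * u powr (- 1/2) + (5 + CD)"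
        unfolding log_digamma_def using norm_triangle_ineq4[of "Ln (- (of_real u * q))" "Digamma (1 - of_real u * q)"] by linarith
    qed
    have n1: "norm (integral {1/2..1} (\<lambda>u. log_digamma_reg (of_real u * q))) \<le> CG"
    proof -
      have "norm (integral {1/2..1} (\<lambda>u. log_digamma_reg (of_real u * q))) \<le> CG * (1 - 1/2)"
      proof (rule integral_bound)
        show "continuous_on {1/2..1} (\<lambda>u. log_digamma_reg (of_real u * q))" by (rule continuous_on_subset[OF contG]) auto
        fix u :: real assume u: "u \<in> {1/2..1}"
        have "u * norm q \<le> 1 * (5/4)" using u q by (intro mult_mono) auto
        moreover have "(1/2) * (3/4) \<le> u * Re q" using u q by (intro mult_mono) auto
        ultimately have "of_real u * q \<in> right_box" using u by (simp add: right_box_def norm_mult)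
        thus "norm (log_digamma_reg (of_real u * q)) \<le> CG" by (rule CG(2))
      qed auto
      thus ?thesis using CG(1) by simp
    qed
    have n2: "norm (integral {1/2..b} (\<lambda>u. log_digamma_sing (of_real u * q))) \<le> 2 * CL + 2 * Lb"
    proof -
      have "norm (integral {1/2..b} (\<lambda>u. log_digamma_sing (of_real u * q))) = norm (Ln (1 - exp (- of_real pi * \<i> * q)) - Ln (1 - exp (- 2 * of_real pi * \<i> * of_real b * q))) / norm q"
        using singI by (simp add: integral_unique norm_divide)
      also have "\<dots> \<le> (CL + Lb) / (3/4)"
      proof (rule frac_le)
        show "norm (Ln (1 - exp (- of_real pi * \<i> * q)) - Ln (1 - exp (- 2 * of_real pi * \<i> * of_real b * q))) \<le> CL + Lb"
          unfolding Lb_def by (rule norm_triangle_ineq4[THEN order_trans]) (rule add_right_mono[OF CL(2)[OF q(1)]])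
      qed (use q CL(1) in \<open>auto simp: Lb_def\<close>)
      also have "\<dots> \<le> 2 * CL + 2 * Lb" using CL(1) by (simp add: Lb_def)
      finally show ?thesis .
    qed
    have n3: "norm (\<Sum>n<N. log_digamma_reg (of_real (real (Suc n)) * q) - integral {real (Suc n)..real (Suc n) + 1} (\<lambda>u. log_digamma_reg (of_real u * q))) \<le> S2"
    proof -
      have "norm (\<Sum>n<N. log_digamma_reg (of_real (real (Suc n)) * q) - integral {real (Suc n)..real (Suc n) + 1} (\<lambda>u. log_digamma_reg (of_real u * q))) \<le> (\<Sum>n<N. 80 / (real (Suc n))\<^sup>2)"
        by (intro sum_norm_le log_digamma_reg_sum_integral_diff) (use q in auto)
      also have "\<dots> \<le> S2" unfolding S2_def by (intro sum_le_suminf sm) auto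
      finally show ?thesis .
    qed
    have sumsplit: "(\<Sum>n<N. log_digamma (of_real (real (Suc n)) * q)) = (\<Sum>n<N. log_digamma_reg (of_real (real (Suc n)) * q)) + (\<Sum>n<N. log_digamma_sing (of_real (real (Suc n)) * q))"
      unfolding sum.distrib[symmetric] by (intro sum.cong refl split) auto
    have "(\<Sum>n<N. log_digamma (of_real (real (Suc n)) * q)) - integral {0..b} (\<lambda>u. log_digamma (of_real u * q)) - (\<Sum>n<N. log_digamma_sing (of_real (real (Suc n)) * q))
       = (\<Sum>n<N. log_digamma_reg (of_real (real (Suc n)) * q) - integral {real (Suc n)..real (Suc n) + 1} (\<lambda>u. log_digamma_reg (of_real u * q)))
         - integral {0..1/2} (\<lambda>u. log_digamma (of_real u * q)) - integral {1/2..1} (\<lambda>u. log_digamma_reg (of_real u * q)) - integral {1/2..b} (\<lambda>u. log_digamma_sing (of_real u * q))"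
      unfolding sumsplit i1 i2 i3 sum_subtractf by (simp del: of_nat_Suc)
    also have "norm \<dots> \<le> S2 + I0 + CG + (2 * CL + 2 * Lb)"
      by (intro norm_triangle_ineq4[THEN order_trans] add_mono n0 n1 n2 n3)
    finally show ?thesis unfolding lint[symmetric] by (simp add: q_def b_def Lb_def add_ac)
  qed
  moreover have "S2 + I0 + CG + 2 * CL \<ge> 0"
  proof -
    have "S2 \<ge> 0" unfolding S2_def by (intro suminf_nonneg sm) auto
    moreover have "I0 \<ge> 0" unfolding I0_def by (intro integral_nonneg int0) (use CD in auto)
    ultimately show ?thesis using CG CL by simp
  qed
  ultimately show ?thesis by blast
qed

section \<open>Comparison with the divisor function\<close>

text \<open>Factors are stored shifted by one, so every pair of naturals is a pair of positive
  factors, and the number of pairs of weight \<open>n\<close> is the divisor function at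
  \<open>n\<close>.\<close>

definition pair_weight :: "nat \<times> nat \<Rightarrow> real" where
  "pair_weight p = real (Suc (fst p)) * real (Suc (snd p))"

abbreviation count_pairs :: "(nat \<times> nat) measure" where
  "count_pairs \<equiv> count_space UNIV"

lemma pair_weight_ge_1: "pair_weight p \<ge> 1"
proof -
  have "1 * 1 \<le> real (Suc (fst p)) * real (Suc (snd p))" by (intro mult_mono) auto
  thus ?thesis by (simp add: pair_weight_def)
qed

lemma pair_weight_pos: "pair_weight p > 0"
  using pair_weight_ge_1[of p] by linarith

text \<open>The square of the series for zeta at 3/2. The exponent loses against the true order
  \<open>ln (1 / r) / r\<close> of the Lambert series but avoids its logarithm. The 5/2 that results
  from it stays below 3, where the summed coefficient errors would cease to be
  \<open>o(S)\<close>.\<close>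

lemma integrable_pair_weight_powr: "integrable count_pairs (\<lambda>p. pair_weight p powr (- 3/2))"
proof -
  have sm: "summable (\<lambda>n. real (Suc n) powr (- 3/2))"
    by (subst summable_Suc_iff) (simp add: summable_real_powr_iff)
  have "Infinite_Set_Sum.abs_summable_on (\<lambda>n. real (Suc n) powr (- 3/2)) (UNIV :: nat set)"
    using sm by (subst abs_summable_on_nat_iff') simp
  from abs_summable_on_product[OF _ _ this this]
  have "Infinite_Set_Sum.abs_summable_on (\<lambda>(n, k). real (Suc n) powr (- 3/2) * real (Suc k) powr (- 3/2)) (UNIV \<times> UNIV :: (nat \<times> nat) set)"
    by simp
  thus ?thesis
    by (simp add: abs_summable_on_def case_prod_unfold pair_weight_def powr_mult del: of_nat_Suc)
qed

definition pair_weight_sum :: real where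
  "pair_weight_sum = (\<integral>p. pair_weight p powr (- 3/2) \<partial>count_pairs)"

lemma pair_weight_sum_nonneg: "pair_weight_sum \<ge> 0"
  unfolding pair_weight_sum_def by (intro Bochner_Integration.integral_nonneg) auto

text \<open>The exponential series up to the cube dominates \<open>1 + x^2\<close> and
  \<open>1 + x^3\<close> up to constants, and these dominate the powers 3/2 and 5/2.\<close>

lemma exp_minus_le_powr:
  fixes x :: real assumes x: "x > 0"
  shows "exp (- x) \<le> 2 * x powr (- 3/2)" and "x * exp (- x) \<le> 6 * x powr (- 3/2)"
proof -
  have p3: "x powr 3 = x ^ 3" and p2: "x powr 2 = x ^ 2" using x by (simp_all add: powr_numeral)
  have e: "1 + x + x ^ 2 / 2 + x ^ 3 / 6 \<le> exp x"
    using sum_exp_series_le[of x 3] x by (simp add: eval_nat_numeral)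
  have x3: "x powr (3/2) \<le> 1 + x ^ 2"
  proof (cases "x \<le> 1")
    case True
    hence "x powr (3/2) \<le> 1 powr (3/2)" using x by (intro powr_mono2) auto
    moreover have "x ^ 2 \<ge> 0" "1 powr (3/2) = (1::real)" by simp_all
    ultimately show ?thesis by linarith
  next
    case False
    hence "x powr (3/2) \<le> x powr 2" by (intro powr_mono) auto
    thus ?thesis by (simp add: p2)
  qed
  have x5: "x powr (5/2) \<le> 1 + x ^ 3"
  proof (cases "x \<le> 1")
    case True
    hence "x powr (5/2) \<le> 1 powr (5/2)" using x by (intro powr_mono2) auto
    moreover have "x ^ 3 \<ge> 0" "1 powr (5/2) = (1::real)" using x by simp_all
    ultimately show ?thesis by linarith
  next
    case False
    hence "x powr (5/2) \<le> x powr 3" by (intro powr_mono) auto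
    thus ?thesis by (simp add: p3)
  qed
  have pos: "x ^ 2 \<ge> 0" "x ^ 3 \<ge> 0" using x by auto
  have m: "x powr (- 3/2) * x powr (3/2) = 1" using x by (simp flip: powr_add)
  have m': "x powr (- 3/2) * x powr (5/2) = x" using x by (simp flip: powr_add)
  have ee: "exp (- x) * exp x = 1" by (simp flip: exp_add)
  have "x powr (3/2) \<le> 2 * exp x" using x3 e pos x by linarith
  hence "x powr (- 3/2) * exp (- x) * x powr (3/2) \<le> x powr (- 3/2) * exp (- x) * (2 * exp x)"
    by (intro mult_left_mono) auto
  also have "\<dots> = 2 * x powr (- 3/2) * (exp (- x) * exp x)" by simp
  also have "x powr (- 3/2) * exp (- x) * x powr (3/2) = exp (- x) * (x powr (- 3/2) * x powr (3/2))" by simp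
  finally show "exp (- x) \<le> 2 * x powr (- 3/2)" unfolding m ee by simp
  have "x powr (5/2) \<le> 6 * exp x" using x5 e pos x by linarith
  hence "x powr (- 3/2) * exp (- x) * x powr (5/2) \<le> x powr (- 3/2) * exp (- x) * (6 * exp x)"
    by (intro mult_left_mono) auto
  also have "\<dots> = 6 * x powr (- 3/2) * (exp (- x) * exp x)" by simp
  also have "x powr (- 3/2) * exp (- x) * x powr (5/2) = exp (- x) * (x powr (- 3/2) * x powr (5/2))" by simp
  finally show "x * exp (- x) \<le> 6 * x powr (- 3/2)" unfolding m' ee by (simp add: mult.commute)
qed

text \<open>At \<open>x = r * pair_weight p\<close> both elementary bounds separate into a power of
  \<open>r\<close> and the summable \<open>pair_weight p powr (- 3/2)\<close>.\<close>

lemma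
  assumes r: "r > 0"
  shows integrable_exp_pair_weight: "integrable count_pairs (\<lambda>p. exp (- r * pair_weight p))"
    and integral_exp_pair_weight_le: "(\<integral>p. exp (- r * pair_weight p) \<partial>count_pairs) \<le> 2 * pair_weight_sum * r powr (- 3/2)"
    and integrable_mult_exp_pair_weight: "integrable count_pairs (\<lambda>p. pair_weight p * exp (- r * pair_weight p))"
    and integral_mult_exp_pair_weight_le: "(\<integral>p. pair_weight p * exp (- r * pair_weight p) \<partial>count_pairs) \<le> 6 * pair_weight_sum * r powr (- 5/2)"
proof -
  have b1: "exp (- r * pair_weight p) \<le> 2 * r powr (- 3/2) * pair_weight p powr (- 3/2)" for p
    using exp_minus_le_powr(1)[of "r * pair_weight p"] r pair_weight_pos[of p] by (simp add: powr_mult)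
  have b2: "pair_weight p * exp (- r * pair_weight p) \<le> 6 * r powr (- 5/2) * pair_weight p powr (- 3/2)" for p
  proof -
    have "r * (pair_weight p * exp (- r * pair_weight p)) \<le> 6 * (r powr (- 3/2) * pair_weight p powr (- 3/2))"
      using exp_minus_le_powr(2)[of "r * pair_weight p"] r pair_weight_pos[of p] by (simp add: powr_mult mult_ac)
    also have "r powr (- 3/2) = r * r powr (- 5/2)"
      using r powr_add[of r 1 "- 5/2"] by simp
    finally have "r * (pair_weight p * exp (- r * pair_weight p)) \<le> r * (6 * r powr (- 5/2) * pair_weight p powr (- 3/2))"
      by (simp only: mult_ac)
    thus ?thesis using r by (simp only: mult_le_cancel_left_pos)
  qed
  have i1: "integrable count_pairs (\<lambda>p. 2 * r powr (- 3/2) * pair_weight p powr (- 3/2))"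
    and i2: "integrable count_pairs (\<lambda>p. 6 * r powr (- 5/2) * pair_weight p powr (- 3/2))"
    using integrable_pair_weight_powr by simp_all
  show I1: "integrable count_pairs (\<lambda>p. exp (- r * pair_weight p))"
    by (rule Bochner_Integration.integrable_bound[OF i1]) (use b1 in auto)
  show I2: "integrable count_pairs (\<lambda>p. pair_weight p * exp (- r * pair_weight p))"
    by (rule Bochner_Integration.integrable_bound[OF i2]) (use b2 pair_weight_pos in \<open>auto simp: abs_mult less_imp_le\<close>)
  have "(\<integral>p. exp (- r * pair_weight p) \<partial>count_pairs) \<le> (\<integral>p. 2 * r powr (- 3/2) * pair_weight p powr (- 3/2) \<partial>count_pairs)"
    by (rule integral_mono[OF I1 i1 b1])
  thus "(\<integral>p. exp (- r * pair_weight p) \<partial>count_pairs) \<le> 2 * pair_weight_sum * r powr (- 3/2)"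
    by (simp add: pair_weight_sum_def mult_ac)
  have "(\<integral>p. pair_weight p * exp (- r * pair_weight p) \<partial>count_pairs) \<le> (\<integral>p. 6 * r powr (- 5/2) * pair_weight p powr (- 3/2) \<partial>count_pairs)"
    by (rule integral_mono[OF I2 i2 b2])
  thus "(\<integral>p. pair_weight p * exp (- r * pair_weight p) \<partial>count_pairs) \<le> 6 * pair_weight_sum * r powr (- 5/2)"
    by (simp add: pair_weight_sum_def mult_ac)
qed

text \<open>The Lambert series of the divisor function, the sum of \<open>d n * exp (- n w)\<close>,
  written over pairs so that \<open>d\<close> itself never appears.\<close>

definition lambert :: "complex \<Rightarrow> complex" where
  "lambert w = (\<integral>p. exp (- w * of_real (pair_weight p)) \<partial>count_pairs)"

lemma integrable_lambert:
  assumes "Re w > 0"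
  shows "integrable count_pairs (\<lambda>p. exp (- w * of_real (pair_weight p)))"
  by (rule Bochner_Integration.integrable_bound[OF integrable_exp_pair_weight[OF assms]]) auto

lemma norm_lambert_le:
  assumes "r > 0" "Re w \<ge> r"
  shows "norm (lambert w) \<le> 2 * pair_weight_sum * r powr (- 3/2)"
proof -
  have "norm (lambert w) \<le> (\<integral>p. norm (exp (- w * of_real (pair_weight p))) \<partial>count_pairs)"
    unfolding lambert_def by (rule integral_norm_bound)
  also have "\<dots> \<le> (\<integral>p. exp (- r * pair_weight p) \<partial>count_pairs)"
  proof (rule integral_mono)
    show "norm (exp (- w * of_real (pair_weight p))) \<le> exp (- r * pair_weight p)" for p
      using assms pair_weight_pos[of p] by (simp add: mult_right_mono)
    show "integrable count_pairs (\<lambda>p. norm (exp (- w * of_real (pair_weight p))))"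
      by (intro integrable_norm integrable_lambert) (use assms in linarith)
  qed (rule integrable_exp_pair_weight[OF assms(1)])
  also have "\<dots> \<le> 2 * pair_weight_sum * r powr (- 3/2)" by (rule integral_exp_pair_weight_le[OF assms(1)])
  finally show ?thesis .
qed

lemma norm_exp_diff_le:
  assumes "Re a \<ge> m" "Re b \<ge> m"
  shows "norm (exp (- a) - exp (- b)) \<le> exp (- m) * norm (a - b)"
proof (rule field_differentiable_bound[of "{z. Re z \<ge> m}" "\<lambda>z. exp (- z)" "\<lambda>z. - exp (- z)"])
  show "convex {z. Re z \<ge> m}" by (rule convex_halfspace_Re_ge)
  fix z assume "z \<in> {z. Re z \<ge> m}"
  thus "norm (- exp (- z)) \<le> exp (- m)" by simp
  show "((\<lambda>z. exp (- z)) has_field_derivative - exp (- z)) (at z within {z. Re z \<ge> m})"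
    by (auto intro!: derivative_eq_intros)
qed (use assms in auto)

text \<open>The mean value inequality for each exponential brings out a factor
  \<open>pair_weight p\<close>, which costs one more power of \<open>r\<close>; this is the source
  of the 5/2.\<close>

lemma norm_lambert_diff_le:
  assumes r: "r > 0" "Re w \<ge> r" "Re w' \<ge> r"
  shows "norm (lambert w - lambert w') \<le> norm (w - w') * (6 * pair_weight_sum * r powr (- 5/2))"
proof -
  have i: "integrable count_pairs (\<lambda>p. exp (- w * of_real (pair_weight p)))" "integrable count_pairs (\<lambda>p. exp (- w' * of_real (pair_weight p)))"
    by (rule integrable_lambert, use r in linarith)+
  have "lambert w - lambert w' = (\<integral>p. exp (- w * of_real (pair_weight p)) - exp (- w' * of_real (pair_weight p)) \<partial>count_pairs)"
    unfolding lambert_def using i by (rule Bochner_Integration.integral_diff[symmetric])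
  also have "norm \<dots> \<le> (\<integral>p. norm (exp (- w * of_real (pair_weight p)) - exp (- w' * of_real (pair_weight p))) \<partial>count_pairs)"
    by (rule integral_norm_bound)
  also have "\<dots> \<le> (\<integral>p. norm (w - w') * (pair_weight p * exp (- r * pair_weight p)) \<partial>count_pairs)"
  proof (rule integral_mono)
    fix p
    have pw: "pair_weight p > 0" by (rule pair_weight_pos)
    have "norm (exp (- (w * of_real (pair_weight p))) - exp (- (w' * of_real (pair_weight p)))) \<le> exp (- (r * pair_weight p)) * norm (w * of_real (pair_weight p) - w' * of_real (pair_weight p))"
      using r pw by (intro norm_exp_diff_le) (auto intro!: mult_right_mono)
    also have "w * of_real (pair_weight p) - w' * of_real (pair_weight p) = (w - w') * of_real (pair_weight p)" by (simp add: algebra_simps)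
    finally show "norm (exp (- w * of_real (pair_weight p)) - exp (- w' * of_real (pair_weight p))) \<le> norm (w - w') * (pair_weight p * exp (- r * pair_weight p))"
      using pw by (simp add: norm_mult mult_ac)
  qed (use i integrable_mult_exp_pair_weight[OF r(1)] in auto)
  also have "\<dots> = norm (w - w') * (\<integral>p. pair_weight p * exp (- r * pair_weight p) \<partial>count_pairs)" by simp
  also have "\<dots> \<le> norm (w - w') * (6 * pair_weight_sum * r powr (- 5/2))"
    by (intro mult_left_mono integral_mult_exp_pair_weight_le r) auto
  finally show ?thesis .
qed

text \<open>Summing over the second factor first gives geometric series.\<close>

lemma lambert_sums:
  assumes w: "Re w > 0"
  shows "(\<lambda>n. 1 / (exp (of_nat (Suc n) * w) - 1)) sums lambert w"
proof -
  define f where "f = (\<lambda>n k. exp (- w * of_real (real (Suc n) * real (Suc k))))"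
  have summ: "Infinite_Set_Sum.abs_summable_on (\<lambda>(n, k). f n k) (UNIV \<times> UNIV)"
    using integrable_lambert[OF w] by (simp add: abs_summable_on_def f_def pair_weight_def case_prod_unfold)
  have inner: "infsetsum (f n) UNIV = 1 / (exp (of_nat (Suc n) * w) - 1)" for n
  proof -
    define E where "E = exp (- (of_nat (Suc n) * w))"
    have nE: "norm E < 1" using w by (simp add: E_def mult_pos_pos del: of_nat_Suc)
    have E0: "E \<noteq> 0" by (simp add: E_def)
    have E1: "E \<noteq> 1"
    proof
      assume "E = 1"
      with nE show False by simp
    qed
    have fE: "f n k = E * E ^ k" for k
    proof -
      have "f n k = exp (of_nat (Suc k) * (- (of_nat (Suc n) * w)))" by (simp add: f_def mult_ac)
      thus ?thesis by (simp only: exp_of_nat_mult E_def power_Suc)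
    qed
    have "(\<lambda>k. E * E ^ k) sums (E * (1 / (1 - E)))" using nE by (intro sums_mult geometric_sums)
    moreover have "f n = (\<lambda>k. E * E ^ k)" using fE by (intro ext)
    ultimately have s: "f n sums (E / (1 - E))" by simp
    have "summable (\<lambda>k. norm (f n k))"
      unfolding fE norm_mult norm_power using nE by (intro summable_mult summable_geometric) auto
    hence "Infinite_Set_Sum.abs_summable_on (f n) UNIV" by (simp add: abs_summable_on_nat_iff')
    hence "infsetsum (f n) UNIV = E / (1 - E)" using s by (simp add: infsetsum_nat' sums_iff)
    also have "E / (1 - E) = 1 / (1 / E - 1)" using E0 E1 by (simp add: field_simps)
    also have "1 / E = exp (of_nat (Suc n) * w)" by (simp add: E_def exp_minus inverse_eq_divide del: of_nat_Suc)
    finally show ?thesis .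
  qed
  have "(\<lambda>n. infsetsum (f n) UNIV) sums infsetsum (\<lambda>n. infsetsum (f n) UNIV) UNIV"
    by (intro sums_infsetsum_nat' abs_summable_on_Sigma_project1'[OF summ]) auto
  also have "infsetsum (\<lambda>n. infsetsum (f n) UNIV) UNIV = infsetsum (\<lambda>(n, k). f n k) (UNIV \<times> UNIV)"
    by (rule infsetsum_Times') (use summ in auto)
  also have "\<dots> = lambert w"
    by (simp add: infsetsum_def lambert_def f_def pair_weight_def case_prod_unfold)
  finally show ?thesis by (simp add: inner)
qed

section \<open>The two Laplace transforms near 0\<close>

definition divisor_measure :: "(nat \<times> nat) measure" where
  "divisor_measure = density count_pairs (\<lambda>_. ennreal (2 * pi))"

definition divisor_point :: "nat \<times> nat \<Rightarrow> real" where
  "divisor_point p = 2 * pi * pair_weight p"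

text \<open>The density lives on \<open>t >= 0\<close>; the observable paired with it is
  \<open>abs\<close>, since observables are required to be nonnegative everywhere.\<close>

definition zeta_measure :: "real measure" where
  "zeta_measure = density lborel (\<lambda>t. ennreal (indicator {0..} t * (norm (zeta_half t))\<^sup>2))"

lemma laplace_measure_divisor: "laplace_measure divisor_measure divisor_point"
proof
  fix s :: real assume "s > 0"
  hence "integrable count_pairs (\<lambda>p. exp (- (s * 2 * pi) * pair_weight p))" by (intro integrable_exp_pair_weight) auto
  thus "integrable divisor_measure (\<lambda>p. exp (- s * divisor_point p))"
    unfolding divisor_measure_def divisor_point_def by (subst integrable_density) (auto simp: mult_ac)
qed (use pair_weight_pos in \<open>auto simp: divisor_measure_def divisor_point_def less_imp_le\<close>)

lemma lap_divisor: "lap divisor_measure divisor_point z = 2 * of_real pi * lambert (2 * of_real pi * z)"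
proof -
  have "lap divisor_measure divisor_point z = (\<integral>p. (2 * pi) *\<^sub>R exp (- z * of_real (divisor_point p)) \<partial>count_pairs)"
    unfolding lap_def divisor_measure_def by (subst integral_density) auto
  also have "\<dots> = 2 * of_real pi * (\<integral>p. exp (- z * of_real (divisor_point p)) \<partial>count_pairs)"
    by (simp add: scaleR_conv_of_real)
  finally show ?thesis by (simp add: lambert_def divisor_point_def mult_ac)
qed

lemma integrable_zeta_square_exp:
  assumes m: "m > 0"
  shows "integrable lborel (\<lambda>t. (norm (zeta_half t))\<^sup>2 * exp (- m * \<bar>t\<bar>))"
proof -
  obtain C where C: "C > 0" "\<And>t. norm (zeta_half t) \<le> C * (1 + \<bar>t\<bar>)" using zeta_half_bound by blast
  have "integrable lborel (\<lambda>t. C\<^sup>2 * ((1 + \<bar>t\<bar>) ^ 2 * exp (- m * \<bar>t\<bar>)))"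
    using integrable_poly_exp_abs[OF m, of 2] by simp
  thus ?thesis
  proof (rule Bochner_Integration.integrable_bound)
    show "AE t in lborel. norm ((norm (zeta_half t))\<^sup>2 * exp (- m * \<bar>t\<bar>)) \<le> norm (C\<^sup>2 * ((1 + \<bar>t\<bar>) ^ 2 * exp (- m * \<bar>t\<bar>)))"
    proof (intro AE_I2)
      fix t
      have "(norm (zeta_half t))\<^sup>2 * exp (- m * \<bar>t\<bar>) \<le> (C * (1 + \<bar>t\<bar>))\<^sup>2 * exp (- m * \<bar>t\<bar>)"
        using C by (intro mult_right_mono power_mono) auto
      thus "norm ((norm (zeta_half t))\<^sup>2 * exp (- m * \<bar>t\<bar>)) \<le> norm (C\<^sup>2 * ((1 + \<bar>t\<bar>) ^ 2 * exp (- m * \<bar>t\<bar>)))"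
        by (simp add: power_mult_distrib abs_mult mult_ac)
    qed
  qed simp
qed

lemma laplace_measure_zeta: "laplace_measure zeta_measure abs"
proof
  fix s :: real assume "s > 0"
  hence "integrable lborel (\<lambda>t. indicator {0..} t *\<^sub>R ((norm (zeta_half t))\<^sup>2 * exp (- s * \<bar>t\<bar>)))"
    by (intro integrable_mult_indicator integrable_zeta_square_exp) auto
  thus "integrable zeta_measure (\<lambda>t. exp (- s * \<bar>t\<bar>))"
    unfolding zeta_measure_def by (subst integrable_density) (auto simp: mult_ac)
qed (auto simp: zeta_measure_def)

lemma lap_zeta: "lap zeta_measure abs z = (\<integral>t. of_real (indicator {0..} t * (norm (zeta_half t))\<^sup>2) * exp (- z * of_real \<bar>t\<bar>) \<partial>lborel)"
  unfolding lap_def zeta_measure_def by (subst integral_density) (auto simp: scaleR_conv_of_real)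

definition zeta_sech_integral :: "complex \<Rightarrow> complex" where
  "zeta_sech_integral s = (\<integral>t. sech_kernel s t * of_real ((norm (zeta_half t))\<^sup>2) \<partial>lborel)"

text \<open>For \<open>t >= 0\<close> the kernels differ by a factor
  \<open>exp (- 2 pi t) / (1 + exp (- 2 pi t))\<close>, and for \<open>t < 0\<close> the bound uses
  \<open>2 pi - Re s >= pi\<close>. So the difference stays bounded although both transforms grow as
  \<open>s\<close> tends to 0.\<close>

lemma lap_zeta_zeta_sech_integral_diff:
  "\<exists>C\<ge>0. \<forall>s\<in>small_sector. norm (lap zeta_measure abs s - zeta_sech_integral s) \<le> C"
proof -
  define C where "C = (\<integral>t. (norm (zeta_half t))\<^sup>2 * exp (- pi * \<bar>t\<bar>) \<partial>lborel)"
  have "norm (lap zeta_measure abs s - zeta_sech_integral s) \<le> C" if s: "s \<in> small_sector" for s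
  proof -
    have Re: "0 < Re s" "Re s \<le> 1/8" using s complex_Re_le_cmod[of s] by (auto simp: small_sector_def)
    have Re2: "Re s < 2 * pi" using Re pi_gt3 by linarith
    have i0: "integrable lborel (\<lambda>t. (norm (zeta_half t))\<^sup>2 * exp (- min (Re s) (2 * pi - Re s) * \<bar>t\<bar>))"
      using Re Re2 by (intro integrable_zeta_square_exp) auto
    have i1: "integrable lborel (\<lambda>t. sech_kernel s t * of_real ((norm (zeta_half t))\<^sup>2))"
    proof (rule Bochner_Integration.integrable_bound[OF i0])
      show "AE t in lborel. norm (sech_kernel s t * of_real ((norm (zeta_half t))\<^sup>2)) \<le> norm ((norm (zeta_half t))\<^sup>2 * exp (- min (Re s) (2 * pi - Re s) * \<bar>t\<bar>))"
      proof (intro AE_I2)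
        fix t
        have "(norm (zeta_half t))\<^sup>2 * norm (sech_kernel s t) \<le> (norm (zeta_half t))\<^sup>2 * exp (- min (Re s) (2 * pi - Re s) * \<bar>t\<bar>)"
          by (intro mult_left_mono norm_sech_kernel_le[OF Re(1) Re2]) auto
        thus "norm (sech_kernel s t * of_real ((norm (zeta_half t))\<^sup>2)) \<le> norm ((norm (zeta_half t))\<^sup>2 * exp (- min (Re s) (2 * pi - Re s) * \<bar>t\<bar>))"
          by (simp only: norm_mult norm_of_real real_norm_def abs_power2 abs_exp_cancel mult.commute)
      qed
    qed simp
    have i2: "integrable lborel (\<lambda>t. of_real (indicator {0..} t * (norm (zeta_half t))\<^sup>2) * exp (- s * of_real \<bar>t\<bar>))"
      by (rule Bochner_Integration.integrable_bound[OF integrable_zeta_square_exp[OF Re(1)]])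
         (auto simp: norm_mult norm_power indicator_def)
    have "lap zeta_measure abs s - zeta_sech_integral s = (\<integral>t. of_real (indicator {0..} t * (norm (zeta_half t))\<^sup>2) * exp (- s * of_real \<bar>t\<bar>) - sech_kernel s t * of_real ((norm (zeta_half t))\<^sup>2) \<partial>lborel)"
      unfolding lap_zeta zeta_sech_integral_def by (rule Bochner_Integration.integral_diff[symmetric, OF i2 i1])
    also have "norm \<dots> \<le> (\<integral>t. norm (of_real (indicator {0..} t * (norm (zeta_half t))\<^sup>2) * exp (- s * of_real \<bar>t\<bar>) - sech_kernel s t * of_real ((norm (zeta_half t))\<^sup>2)) \<partial>lborel)"
      by (rule integral_norm_bound)
    also have "\<dots> \<le> C" unfolding C_def
    proof (rule integral_mono)
      fix t :: real
      have k: "norm (of_real (indicator {0..} t) * exp (- s * of_real \<bar>t\<bar>) - sech_kernel s t) \<le> exp (- pi * \<bar>t\<bar>)"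
      proof (cases "t \<ge> 0")
        case True
        define e where "e = exp (- 2 * of_real pi * of_real t :: complex)"
        have e: "e = of_real (exp (- 2 * pi * t))" by (simp add: e_def flip: exp_of_real)
        have ne: "1 + e \<noteq> 0" unfolding e_def by (rule one_plus_exp_real_neq_0)
        have "exp (- s * of_real t) - sech_kernel s t = exp (- s * of_real t) * e / (1 + e)"
          unfolding sech_kernel_def e_def[symmetric] using ne by (simp add: field_simps)
        moreover have "norm (1 + e) = 1 + exp (- 2 * pi * t)"
        proof -
          have "1 + e = of_real (1 + exp (- 2 * pi * t))" by (simp add: e)
          thus ?thesis by (simp only: norm_of_real) (simp add: add_nonneg_nonneg)
        qed
        ultimately have "norm (exp (- s * of_real t) - sech_kernel s t) = exp (- Re s * t) * exp (- 2 * pi * t) / (1 + exp (- 2 * pi * t))"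
          by (simp add: norm_divide norm_mult e)
        also have "\<dots> \<le> 1 * exp (- pi * t) / 1"
          using True Re by (intro frac_le mult_mono) (auto simp: mult_nonneg_nonneg)
        finally show ?thesis using True by simp
      next
        case False
        have "norm (sech_kernel s t) \<le> exp (- min (Re s) (2 * pi - Re s) * \<bar>t\<bar>)" by (rule norm_sech_kernel_le[OF Re(1) Re2])
        have "norm (sech_kernel s t) = exp (- Re s * t) / (1 + exp (- 2 * pi * t))" by (rule norm_sech_kernel)
        also have "\<dots> \<le> exp (- Re s * t) / exp (- 2 * pi * t)"
          by (intro divide_left_mono) (auto intro!: mult_pos_pos add_pos_pos)
        also have "\<dots> = exp ((2 * pi - Re s) * t)"
          by (subst exp_diff [symmetric]) (simp add: algebra_simps)
        also have "\<dots> \<le> exp (pi * t)"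
        proof -
          have "pi \<le> 2 * pi - Re s" using Re pi_gt3 by linarith
          hence "(2 * pi - Re s) * t \<le> pi * t" using False by (intro mult_right_mono_neg) auto
          thus ?thesis by simp
        qed
        finally show ?thesis using False by simp
      qed
      have "of_real (indicator {0..} t * (norm (zeta_half t))\<^sup>2) * exp (- s * of_real \<bar>t\<bar>) - sech_kernel s t * of_real ((norm (zeta_half t))\<^sup>2) =
         of_real ((norm (zeta_half t))\<^sup>2) * (of_real (indicator {0..} t) * exp (- s * of_real \<bar>t\<bar>) - sech_kernel s t)"
        by (simp add: algebra_simps)
      hence "norm (of_real (indicator {0..} t * (norm (zeta_half t))\<^sup>2) * exp (- s * of_real \<bar>t\<bar>) - sech_kernel s t * of_real ((norm (zeta_half t))\<^sup>2)) =
         (norm (zeta_half t))\<^sup>2 * norm (of_real (indicator {0..} t) * exp (- s * of_real \<bar>t\<bar>) - sech_kernel s t)"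
        by (simp add: norm_mult norm_power)
      also have "\<dots> \<le> (norm (zeta_half t))\<^sup>2 * exp (- pi * \<bar>t\<bar>)" by (rule mult_left_mono[OF k]) simp
      finally show "norm (of_real (indicator {0..} t * (norm (zeta_half t))\<^sup>2) * exp (- s * of_real \<bar>t\<bar>) - sech_kernel s t * of_real ((norm (zeta_half t))\<^sup>2)) \<le> (norm (zeta_half t))\<^sup>2 * exp (- pi * \<bar>t\<bar>)" .
    qed (use i1 i2 integrable_zeta_square_exp[OF pi_gt_zero] in auto)
    finally show ?thesis .
  qed
  moreover have "C \<ge> 0" unfolding C_def by (intro Bochner_Integration.integral_nonneg) auto
  ultimately show ?thesis by blast
qed

lemma sin_ge_half:
  fixes x :: real
  assumes "0 < x" "x \<le> 1/8"
  shows "sin x \<ge> x / 2"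
proof -
  obtain z where z: "0 < z" "z < x" "sin x - sin 0 = (x - 0) * cos z"
    using MVT2[of 0 x sin cos] assms by (auto intro: DERIV_sin)
  have "cos (pi / 3) \<le> cos z" using z assms pi_gt3 by (intro cos_monotone_0_pi_le) auto
  hence "x * (1/2) \<le> x * cos z" using assms by (intro mult_left_mono) (auto simp: cos_60)
  thus ?thesis using z by simp
qed

text \<open>For each fixed \<open>s\<close> the end term of
  \<open>log_digamma_sum_integral_bound\<close> vanishes as \<open>N\<close> grows, which leaves a
  bound independent of \<open>s\<close>; the singular values add up to the Lambert series.\<close>

lemma zeta_sech_integral_lambert_diff:
  "\<exists>C\<ge>0. \<forall>s\<in>small_sector. norm (zeta_sech_integral s - 2 * of_real pi * exp (- \<i> * s / 2) * lambert (2 * of_real pi * \<i> * (rot_exp s - 1))) \<le> C"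
proof -
  obtain C where C: "C \<ge> 0" and b: "\<And>s N. s \<in> small_sector \<Longrightarrow>
     norm ((\<Sum>n<N. log_digamma (of_real (real (Suc n)) * rot_exp s)) -
        (LINT u:{0<..<real (Suc N)}|lborel. log_digamma (of_real u * rot_exp s))
        - (\<Sum>n<N. log_digamma_sing (of_real (real (Suc n)) * rot_exp s)))
     \<le> C + 2 * norm (Ln (1 - exp (- 2 * of_real pi * \<i> * of_real (real (Suc N)) * rot_exp s)))"
    using log_digamma_sum_integral_bound by blast
  have "norm (zeta_sech_integral s - 2 * of_real pi * exp (- \<i> * s / 2) * lambert (2 * of_real pi * \<i> * (rot_exp s - 1))) \<le> 2 * (C + 2 * 0)" if s: "s \<in> small_sector" for s
  proof -
    define q where "q = rot_exp s"
    note q = rot_exp_near_1[OF s, folded q_def]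
    define c where "c = \<i> * exp (- \<i> * s / 2)"
    define w where "w = 2 * of_real pi * \<i> * (q - 1)"
    have Rew: "Re w > 0" using q by (simp add: w_def mult_pos_neg)
    have s': "0 < Re s" "Re s < pi" using s complex_Re_le_cmod[of s] pi_gt3 by (auto simp: small_sector_def)
    define a where "a = (\<lambda>N. (\<Sum>n<N. log_digamma (of_real (real (Suc n)) * q)) - (LINT u:{0<..<real (Suc N)}|lborel. log_digamma (of_real u * q)))"
    define L where "L = (\<lambda>N. Ln (1 - exp (- 2 * of_real pi * \<i> * of_real (real (Suc N)) * q)))"
    have l1: "(\<lambda>N. c * a N) \<longlonglongrightarrow> zeta_sech_integral s"
      using sech_zeta_square_limit[OF s'] unfolding c_def a_def q_def zeta_sech_integral_def .
    have sing: "c * log_digamma_sing (of_real (real (Suc n)) * q) = 2 * of_real pi * exp (- \<i> * s / 2) * (1 / (exp (of_nat (Suc n) * w) - 1))" for n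
    proof -
      \<comment> \<open>Periodicity at work: \<open>exp (2 pi \<i> n) = 1\<close> allows
        \<open>n q\<close> to be replaced by \<open>n (q - 1)\<close>.\<close>
      have "of_nat (Suc n) * w = 2 * of_real pi * \<i> * (of_real (real (Suc n)) * q) - of_nat (Suc n) * (2 * of_real pi * \<i>)"
        by (simp add: w_def algebra_simps)
      hence "exp (of_nat (Suc n) * w) = exp (2 * of_real pi * \<i> * (of_real (real (Suc n)) * q)) / exp (2 * of_real pi * \<i>) ^ Suc n"
        by (simp only: exp_diff exp_of_nat_mult)
      hence "exp (of_nat (Suc n) * w) = exp (2 * of_real pi * \<i> * (of_real (real (Suc n)) * q))" by simp
      thus ?thesis unfolding log_digamma_sing_def c_def by (simp add: field_simps)
    qed
    have l2: "(\<lambda>N. c * (\<Sum>n<N. log_digamma_sing (of_real (real (Suc n)) * q))) \<longlonglongrightarrow> 2 * of_real pi * exp (- \<i> * s / 2) * lambert w"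
      unfolding sum_distrib_left sing unfolding sum_distrib_left[symmetric]
      by (intro tendsto_intros lambert_sums[OF Rew, unfolded sums_def])
    have l3: "L \<longlonglongrightarrow> Ln (1 - 0)"
      unfolding L_def
    proof (intro tendsto_intros)
      show "(\<lambda>N. exp (- 2 * of_real pi * \<i> * of_real (real (Suc N)) * q)) \<longlonglongrightarrow> 0"
      proof (rule tendsto_norm_zero_cancel)
        have "(\<lambda>N. exp ((2 * pi * Im q) * real (Suc N))) \<longlonglongrightarrow> 0"
        proof -
          have "(\<lambda>N. exp (x * real (Suc N))) \<longlonglongrightarrow> 0" if "x < 0" for x :: real
            using that by real_asymp
          moreover have "2 * pi * Im q < 0" using q by (simp add: mult_pos_neg)
          ultimately show ?thesis by blast
        qed
        thus "(\<lambda>N. norm (exp (- 2 * of_real pi * \<i> * of_real (real (Suc N)) * q))) \<longlonglongrightarrow> 0"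
          by (simp add: mult_ac)
      qed
    qed auto
    have "norm c \<le> 2"
    proof -
      have "norm c = exp (Im s / 2)" by (simp add: c_def norm_mult)
      also have "\<dots> \<le> exp (1/16)"
      proof -
        have "norm s \<le> 1/8" using s by (simp add: small_sector_def)
        hence "Im s / 2 \<le> 1/16" using abs_Im_le_cmod[of s] by linarith
        thus ?thesis by simp
      qed
      also have "\<dots> \<le> 2" using exp_bound_half[of "1/16::real"] by simp
      finally show ?thesis .
    qed
    have "norm (c * a N - c * (\<Sum>n<N. log_digamma_sing (of_real (real (Suc n)) * q))) \<le> 2 * (C + 2 * norm (L N))" for N
    proof -
      have "norm (c * a N - c * (\<Sum>n<N. log_digamma_sing (of_real (real (Suc n)) * q))) = norm c * norm (a N - (\<Sum>n<N. log_digamma_sing (of_real (real (Suc n)) * q)))"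
        by (simp add: norm_mult flip: right_diff_distrib)
      also have "\<dots> \<le> 2 * (C + 2 * norm (L N))"
        using b[OF s, of N] \<open>norm c \<le> 2\<close> unfolding a_def L_def q_def by (intro mult_mono) auto
      finally show ?thesis .
    qed
    moreover have "(\<lambda>N. 2 * (C + 2 * norm (L N))) \<longlonglongrightarrow> 2 * (C + 2 * norm (Ln (1 - 0)))"
      by (intro tendsto_intros l3)
    moreover have "(\<lambda>N. norm (c * a N - c * (\<Sum>n<N. log_digamma_sing (of_real (real (Suc n)) * q)))) \<longlonglongrightarrow> norm (zeta_sech_integral s - 2 * of_real pi * exp (- \<i> * s / 2) * lambert w)"
      by (intro tendsto_intros l1 l2)
    ultimately have "norm (zeta_sech_integral s - 2 * of_real pi * exp (- \<i> * s / 2) * lambert w) \<le> 2 * (C + 2 * norm (Ln (1 - 0)))"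
      by (intro LIMSEQ_le[of _ _ "\<lambda>N. 2 * (C + 2 * norm (L N))"]) auto
    thus ?thesis by (simp add: w_def q_def)
  qed
  thus ?thesis using C by (intro exI[of _ "2 * (C + 2 * 0)"]) auto
qed

text \<open>Two replacements lead from the closed form to the divisor transform:
  \<open>exp (- \<i> s / 2)\<close> by 1, and \<open>2 pi \<i> (rot_exp s - 1)\<close> by its linear
  term \<open>2 pi s\<close>. The second moves the argument by \<open>O(|s|^2)\<close> and
  determines the shape of the error; bounded errors fit in because
  \<open>|s|^2 >= (Re s) powr (5/2)\<close> on \<open>small_sector\<close>.\<close>

theorem lap_zeta_divisor_diff:
  "\<exists>C\<ge>0. \<forall>s\<in>small_sector. norm (lap zeta_measure abs s - lap divisor_measure divisor_point s) \<le> C * (norm s)\<^sup>2 / Re s powr (5/2)"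
proof -
  obtain C1 where C1: "C1 \<ge> 0" "\<And>s. s \<in> small_sector \<Longrightarrow> norm (lap zeta_measure abs s - zeta_sech_integral s) \<le> C1"
    using lap_zeta_zeta_sech_integral_diff by blast
  obtain C2 where C2: "C2 \<ge> 0" "\<And>s. s \<in> small_sector \<Longrightarrow> norm (zeta_sech_integral s - 2 * of_real pi * exp (- \<i> * s / 2) * lambert (2 * of_real pi * \<i> * (rot_exp s - 1))) \<le> C2"
    using zeta_sech_integral_lambert_diff by blast
  define W where "W = pair_weight_sum"
  have W: "W \<ge> 0" by (simp add: W_def pair_weight_sum_nonneg)
  define C where "C = C1 + C2 + 2 * pi * (2 * W) + 2 * pi * (6 * pi * (6 * W))"
  have "norm (lap zeta_measure abs s - lap divisor_measure divisor_point s) \<le> C * (norm s)\<^sup>2 / Re s powr (5/2)" if s: "s \<in> small_sector" for s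
  proof -
    define q where "q = rot_exp s"
    define w where "w = 2 * of_real pi * \<i> * (q - 1)"
    define w' where "w' = 2 * of_real pi * s"
    define r where "r = Re s"
    have r: "0 < r" "r \<le> 1/8" "r \<le> norm s" using s complex_Re_le_cmod[of s] by (auto simp: small_sector_def r_def)
    have ns: "norm s \<le> 1/8" using s by (simp add: small_sector_def)
    define M where "M = (norm s)\<^sup>2 / r powr (5/2)"
    have M: "M = (norm s)\<^sup>2 * r powr (- 5/2)" 
    proof -
      have e: "r powr (- 5/2) = inverse (r powr (5/2))" using powr_minus[of r "5/2"] by simp
      show ?thesis unfolding M_def e by (rule divide_inverse)
    qed
    have p1: "r * r powr (- 5/2) = r powr (- 3/2)" using r powr_add[of r 1 "- 5/2"] by simp
    have M1: "norm s * r powr (- 3/2) \<le> M"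
    proof -
      have "norm s * r powr (- 3/2) = norm s * (r * r powr (- 5/2))" by (simp only: p1)
      also have "\<dots> \<le> norm s * (norm s * r powr (- 5/2))" using r by (intro mult_left_mono mult_right_mono) auto
      finally show ?thesis by (simp add: M power2_eq_square)
    qed
    have M0: "1 \<le> M"
    proof -
      have "1 = r * r powr (- 1)" using r by (simp add: powr_minus)
      also have "\<dots> \<le> norm s * r powr (- 3/2)" using r by (intro mult_mono powr_mono') auto
      finally show ?thesis using M1 by linarith
    qed
    have Rew': "Re w' \<ge> r" 
    proof -
      have "1 * r \<le> (2 * pi) * r" using r pi_gt3 by (intro mult_right_mono) auto
      thus ?thesis by (simp add: w'_def r_def)
    qed
    have Rew: "Re w \<ge> r"
    proof -
      have "Re w = 2 * pi * exp (Im s) * sin (Re s)" by (simp add: w_def q_def Im_rot_exp)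
      moreover have "exp (Im s) \<ge> 7/8" using exp_ge_add_one_self[of "Im s"] abs_Im_le_cmod[of s] ns by linarith
      moreover have "sin (Re s) \<ge> r / 2" using sin_ge_half r by (simp add: r_def)
      ultimately have "Re w \<ge> 2 * 3 * (7/8) * (r / 2)"
        using r pi_gt3 by (simp only:) (intro mult_mono; simp)
      thus ?thesis using r by simp
    qed
    have dw: "norm (w - w') \<le> 6 * pi * (norm s)\<^sup>2"
    proof -
      have "w - w' = 2 * of_real pi * \<i> * (exp (- \<i> * s) - 1 - (- \<i> * s))"
        by (simp add: w_def w'_def q_def rot_exp_def algebra_simps)
      hence "norm (w - w') = 2 * pi * norm (exp (- \<i> * s) - 1 - (- \<i> * s))" by (simp add: norm_mult)
      also have "\<dots> \<le> 2 * pi * (3 * (norm (- \<i> * s))\<^sup>2)"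
        by (intro mult_left_mono exp_minus_1_bounds(2)) (use ns in \<open>auto simp: norm_mult\<close>)
      finally show ?thesis by (simp add: norm_mult)
    qed
    have t1: "norm (lap zeta_measure abs s - zeta_sech_integral s) \<le> C1 * M"
      using C1(2)[OF s] mult_left_mono[OF M0 C1(1)] by simp
    have t2: "norm (zeta_sech_integral s - 2 * of_real pi * exp (- \<i> * s / 2) * lambert w) \<le> C2 * M"
      using C2(2)[OF s] mult_left_mono[OF M0 C2(1)] by (simp add: w_def q_def)
    have t3: "norm (2 * of_real pi * exp (- \<i> * s / 2) * lambert w - 2 * of_real pi * lambert w) \<le> 2 * pi * (2 * W) * M"
    proof -
      have "2 * of_real pi * exp (- \<i> * s / 2) * lambert w - 2 * of_real pi * lambert w = 2 * of_real pi * ((exp (- \<i> * s / 2) - 1) * lambert w)"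
        by (simp add: algebra_simps)
      hence "norm (2 * of_real pi * exp (- \<i> * s / 2) * lambert w - 2 * of_real pi * lambert w) = 2 * pi * (norm (exp (- \<i> * s / 2) - 1) * norm (lambert w))"
        by (simp add: norm_mult)
      also have "\<dots> \<le> 2 * pi * ((2 * norm (- \<i> * s / 2)) * (2 * W * r powr (- 3/2)))"
        unfolding W_def using r Rew ns
        by (intro mult_left_mono mult_mono exp_minus_1_bounds(1) norm_lambert_le) (auto simp: norm_mult)
      also have "\<dots> = 2 * pi * (2 * W) * (norm s * r powr (- 3/2))" by (simp add: norm_mult)
      also have "\<dots> \<le> 2 * pi * (2 * W) * M" using M1 W by (intro mult_left_mono) auto
      finally show ?thesis .
    qed
    have t4: "norm (2 * of_real pi * lambert w - 2 * of_real pi * lambert w') \<le> 2 * pi * (6 * pi * (6 * W)) * M"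
    proof -
      have "norm (2 * of_real pi * lambert w - 2 * of_real pi * lambert w') = 2 * pi * norm (lambert w - lambert w')"
        by (simp add: norm_mult flip: right_diff_distrib)
      also have "\<dots> \<le> 2 * pi * (norm (w - w') * (6 * W * r powr (- 5/2)))"
        unfolding W_def by (intro mult_left_mono norm_lambert_diff_le r Rew Rew') auto
      also have "\<dots> \<le> 2 * pi * (6 * pi * (norm s)\<^sup>2 * (6 * W * r powr (- 5/2)))"
        using dw W by (intro mult_left_mono mult_right_mono) auto
      also have "\<dots> = 2 * pi * (6 * pi * (6 * W)) * M" by (simp add: M)
      finally show ?thesis .
    qed
    have "lap zeta_measure abs s - lap divisor_measure divisor_point s = (lap zeta_measure abs s - zeta_sech_integral s) +
       (zeta_sech_integral s - 2 * of_real pi * exp (- \<i> * s / 2) * lambert w) +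
       (2 * of_real pi * exp (- \<i> * s / 2) * lambert w - 2 * of_real pi * lambert w) +
       (2 * of_real pi * lambert w - 2 * of_real pi * lambert w')"
      unfolding lap_divisor w'_def by simp
    also have "norm \<dots> \<le> C1 * M + C2 * M + 2 * pi * (2 * W) * M + 2 * pi * (6 * pi * (6 * W)) * M"
      by (intro norm_triangle_le add_mono t1 t2 t3 t4)
    also have "\<dots> = C * M" by (simp add: C_def algebra_simps)
    finally show ?thesis by (simp add: M_def r_def)
  qed
  moreover have "C \<ge> 0" using C1 C2 W by (simp add: C_def)
  ultimately show ?thesis by blast
qed

text \<open>Deliberately crude: it is only set against \<open>exp (- (ln S)^2 / 4)\<close> and, in
  the truncation of the ladder integral, against \<open>(2 v) powr (- 7)\<close>.\<close>

lemma lap_cubic_bounds: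
  "\<exists>D\<ge>0. \<forall>s. 0 < s \<and> s \<le> 1/8 \<longrightarrow> Re (lap divisor_measure divisor_point (of_real s)) \<le> D / s ^ 3 \<and> Re (lap zeta_measure abs (of_real s)) \<le> D / s ^ 3"
proof -
  obtain C where C: "C \<ge> 0" "\<And>s. s \<in> small_sector \<Longrightarrow> norm (lap zeta_measure abs s - lap divisor_measure divisor_point s) \<le> C * (norm s)\<^sup>2 / Re s powr (5/2)"
    using lap_zeta_divisor_diff by blast
  define W where "W = pair_weight_sum"
  have W: "W \<ge> 0" by (simp add: W_def pair_weight_sum_nonneg)
  have "Re (lap divisor_measure divisor_point (of_real s)) \<le> (4 * pi * W + C) / s ^ 3 \<and> Re (lap zeta_measure abs (of_real s)) \<le> (4 * pi * W + C) / s ^ 3"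
    if s: "0 < s" "s \<le> 1/8" for s
  proof -
    have p: "s powr (- 3/2) \<le> 1 / s ^ 3" "s powr (- 1/2) \<le> 1 / s ^ 3"
    proof -
      have "s powr (- 3) = inverse (s powr 3)" by (rule powr_minus)
      hence "1 / s ^ 3 = s powr (- 3)" using s by (simp add: inverse_eq_divide)
      thus "s powr (- 3/2) \<le> 1 / s ^ 3" "s powr (- 1/2) \<le> 1 / s ^ 3" using s by (simp_all add: powr_mono')
    qed
    have d: "norm (lap divisor_measure divisor_point (of_real s)) \<le> 4 * pi * W * (1 / s ^ 3)"
    proof -
      have "s \<le> 2 * pi * s" using s pi_gt3 by simp
      hence "norm (lambert (2 * of_real pi * of_real s)) \<le> 2 * W * s powr (- 3/2)"
        unfolding W_def using s by (intro norm_lambert_le) auto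
      hence "2 * pi * norm (lambert (2 * of_real pi * of_real s)) \<le> 2 * pi * (2 * W * s powr (- 3/2))"
        by (intro mult_left_mono) auto
      also have "\<dots> \<le> 2 * pi * (2 * W * (1 / s ^ 3))" using p W by (intro mult_left_mono) auto
      finally show ?thesis by (simp add: lap_divisor norm_mult)
    qed
    have e: "norm (lap zeta_measure abs (of_real s) - lap divisor_measure divisor_point (of_real s)) \<le> C * (1 / s ^ 3)"
    proof -
      have "norm (lap zeta_measure abs (of_real s) - lap divisor_measure divisor_point (of_real s)) \<le> C * (norm (of_real s :: complex))\<^sup>2 / Re (of_real s) powr (5/2)"
        by (rule C(2)) (use s in \<open>auto simp: small_sector_def\<close>)
      also have "\<dots> = C * (s powr 2 / s powr (5/2))" using s by (simp add: powr_numeral)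
      also have "s powr 2 / s powr (5/2) = s powr (- 1/2)" by (simp flip: powr_diff)
      also have "C * s powr (- 1/2) \<le> C * (1 / s ^ 3)" using p C by (intro mult_left_mono) auto
      finally show ?thesis .
    qed
    have "Re (lap divisor_measure divisor_point (of_real s)) \<le> 4 * pi * W * (1 / s ^ 3)"
      using d complex_Re_le_cmod order_trans by blast
    moreover have "Re (lap zeta_measure abs (of_real s)) \<le> Re (lap divisor_measure divisor_point (of_real s)) + norm (lap zeta_measure abs (of_real s) - lap divisor_measure divisor_point (of_real s))"
      using complex_Re_le_cmod[of "lap zeta_measure abs (of_real s) - lap divisor_measure divisor_point (of_real s)"] by simp
    moreover have "0 \<le> C * (1 / s ^ 3)" using C s by simp
    moreover have "(4 * pi * W + C) / s ^ 3 = 4 * pi * W * (1 / s ^ 3) + C * (1 / s ^ 3)" by (simp add: add_divide_distrib)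
    ultimately show ?thesis using e by linarith
  qed
  thus ?thesis using W C by (intro exI[of _ "4 * pi * W + C"]) auto
qed

section \<open>Second order asymptotics of the mean square\<close>

text \<open>One of the two factors is at most \<open>sqrt x\<close>. By symmetry both cases count
  equally many pairs, and the pairs counted twice form a square of \<open>m * m\<close>
  points.\<close>

lemma hyperbola_count:
  fixes x :: real
  assumes x: "x \<ge> 1"
  defines "m \<equiv> nat \<lfloor>sqrt x\<rfloor>"
  shows "real (card {p. pair_weight p \<le> x}) = 2 * (\<Sum>n<m. real (nat \<lfloor>x / real (Suc n)\<rfloor>)) - (real m)\<^sup>2"
proof -
  define S where "S = {p. pair_weight p \<le> x}"
  define S1 where "S1 = {p \<in> S. fst p < m}"
  define S2 where "S2 = {p \<in> S. snd p < m}"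
  have "real m \<le> sqrt x" unfolding m_def using x by simp
  moreover have "sqrt x < real m + 1" unfolding m_def by linarith
  ultimately have mx: "real m \<le> sqrt x" "sqrt x < real m + 1" by auto
  have sq: "sqrt x * sqrt x = x" using x by simp
  have S1_eq: "S1 = Sigma {..<m} (\<lambda>n. {..<nat \<lfloor>x / real (Suc n)\<rfloor>})"
  proof -
    have "pair_weight (n, k) \<le> x \<longleftrightarrow> k < nat \<lfloor>x / real (Suc n)\<rfloor>" for n k
    proof -
      have "pair_weight (n, k) \<le> x \<longleftrightarrow> real (Suc k) \<le> x / real (Suc n)"
        by (simp add: pair_weight_def pos_le_divide_eq mult.commute del: of_nat_Suc)
      also have "\<dots> \<longleftrightarrow> int (Suc k) \<le> \<lfloor>x / real (Suc n)\<rfloor>" by (simp add: le_floor_iff)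
      also have "\<dots> \<longleftrightarrow> k < nat \<lfloor>x / real (Suc n)\<rfloor>" by linarith
      finally show ?thesis .
    qed
    thus ?thesis by (auto simp: S1_def S_def)
  qed
  have fin1: "finite S1" unfolding S1_eq by auto
  have swap: "S2 = prod.swap ` S1"
    by (auto simp: S1_def S2_def S_def pair_weight_def mult.commute image_iff)
  have fin2: "finite S2" unfolding swap using fin1 by auto
  have card2: "card S2 = card S1" unfolding swap by (intro card_image inj_swap[THEN inj_on_subset]) auto
  have un: "S = S1 \<union> S2"
  proof -
    \<comment> \<open>Shifted indices of at least \<open>m\<close> mean factors of at least
      \<open>m + 1\<close>, which exceeds \<open>sqrt x\<close>.\<close>
    have False if "p \<in> S" "fst p \<ge> m" "snd p \<ge> m" for p
    proof -
      have "sqrt x * sqrt x < (real m + 1) * (real m + 1)" using mx x by (intro mult_strict_mono) auto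
      hence "x < (real m + 1) * (real m + 1)" by (simp only: sq)
      also have "\<dots> \<le> pair_weight p" unfolding pair_weight_def using that by (intro mult_mono) auto
      finally show False using that by (simp add: S_def)
    qed
    thus ?thesis by (auto simp: S1_def S2_def not_le) (meson leI)
  qed
  have int: "S1 \<inter> S2 = {..<m} \<times> {..<m}"
  proof -
    have "pair_weight p \<le> x" if "fst p < m" "snd p < m" for p
    proof -
      have "pair_weight p \<le> real m * real m" unfolding pair_weight_def using that by (intro mult_mono) auto
      also have "\<dots> \<le> sqrt x * sqrt x" using mx x by (intro mult_mono) auto
      finally show ?thesis using sq by simp
    qed
    thus ?thesis by (auto simp: S1_def S2_def S_def)
  qed
  have "card S + m * m = card S1 + card S2"
    using card_Un_Int[OF fin1 fin2] by (simp add: un[symmetric] int)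
  hence "real (card S) = 2 * real (card S1) - (real m)\<^sup>2"
    unfolding card2 by (simp add: power2_eq_square flip: of_nat_add of_nat_mult)
  also have "real (card S1) = (\<Sum>n<m. real (nat \<lfloor>x / real (Suc n)\<rfloor>))"
    unfolding S1_eq by (simp add: card_SigmaI)
  finally show ?thesis by (simp add: S_def)
qed

lemma nat_floor_sqrt_ratio: "((\<lambda>x. real (nat \<lfloor>sqrt x\<rfloor>) / sqrt x) \<longlongrightarrow> 1) at_top"
proof (rule tendsto_sandwich[where f = "\<lambda>x. 1 - 1 / sqrt x" and h = "\<lambda>_. 1"])
  show "\<forall>\<^sub>F x in at_top. 1 - 1 / sqrt x \<le> real (nat \<lfloor>sqrt x\<rfloor>) / sqrt x"
    using eventually_gt_at_top[of 0]
  proof eventually_elim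
    case (elim x)
    have "sqrt x - 1 \<le> real (nat \<lfloor>sqrt x\<rfloor>)" by linarith
    hence "(sqrt x - 1) / sqrt x \<le> real (nat \<lfloor>sqrt x\<rfloor>) / sqrt x" using elim by (intro divide_right_mono) auto
    thus ?case using elim by (simp add: diff_divide_distrib)
  qed
  show "\<forall>\<^sub>F x in at_top. real (nat \<lfloor>sqrt x\<rfloor>) / sqrt x \<le> 1"
    using eventually_gt_at_top[of 0] by eventually_elim simp
qed real_asymp+

text \<open>\<open>U\<close> is the normalised count with the integer parts dropped, arranged so
  that each of its pieces has a limit; dropping them costs at most \<open>2 m / x\<close>, which
  tends to 0.\<close>

lemma divisor_count_asymptotics:
  "((\<lambda>x. real (card {p. pair_weight p \<le> x}) / x - ln x) \<longlongrightarrow> 2 * euler_mascheroni - 1) at_top"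
proof -
  define m where "m = (\<lambda>x::real. nat \<lfloor>sqrt x\<rfloor>)"
  have mtop: "filterlim m at_top at_top"
  proof -
    have "filterlim (\<lambda>x::real. nat \<lfloor>sqrt x\<rfloor>) at_top at_top"
      by (intro filterlim_compose[OF filterlim_nat_sequentially] filterlim_compose[OF filterlim_floor_sequentially] sqrt_at_top)
    thus ?thesis by (simp add: m_def)
  qed
  have ratio: "((\<lambda>x. real (m x) / sqrt x) \<longlongrightarrow> 1) at_top" using nat_floor_sqrt_ratio by (simp add: m_def)
  have H: "((\<lambda>x. harm (m x) - ln (real (m x))) \<longlongrightarrow> euler_mascheroni) at_top"
    by (rule filterlim_compose[OF euler_mascheroni_LIMSEQ mtop])
  define U where "U = (\<lambda>x. 2 * (harm (m x) - ln (real (m x))) + 2 * ln (real (m x) / sqrt x) - (real (m x) / sqrt x)\<^sup>2)"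
  have U: "(U \<longlongrightarrow> 2 * euler_mascheroni + 2 * ln 1 - 1\<^sup>2) at_top"
    unfolding U_def by (intro tendsto_intros H ratio) auto
  have L: "((\<lambda>x. U x - 2 / sqrt x * (real (m x) / sqrt x)) \<longlongrightarrow> (2 * euler_mascheroni + 2 * ln 1 - 1\<^sup>2) - 0 * 1) at_top"
    by (intro tendsto_diff U tendsto_mult ratio) real_asymp
  have ev: "\<forall>\<^sub>F x in at_top. real (card {p. pair_weight p \<le> x}) / x - ln x \<le> U x \<and>
                           U x - 2 / sqrt x * (real (m x) / sqrt x) \<le> real (card {p. pair_weight p \<le> x}) / x - ln x"
    using eventually_ge_at_top[of 1]
  proof eventually_elim
    case (elim x)
    define M where "M = m x"
    have M1: "M \<ge> 1" unfolding M_def m_def using elim by (simp add: le_nat_iff le_floor_iff)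
    have sx: "sqrt x > 0" "sqrt x * sqrt x = x" using elim by auto
    define F where "F = (\<Sum>n<M. real (nat \<lfloor>x / real (Suc n)\<rfloor>))"
    have F1: "F \<le> x * harm M"
    proof -
      have "F \<le> (\<Sum>n<M. x / real (Suc n))"
        unfolding F_def using elim by (intro sum_mono) (simp add: of_nat_nat)
      thus ?thesis by (simp add: harm_altdef sum_distrib_left divide_inverse)
    qed
    have F2: "x * harm M - real M \<le> F"
    proof -
      have "(\<Sum>n<M. x / real (Suc n) - 1) \<le> F" unfolding F_def by (intro sum_mono) linarith
      thus ?thesis by (simp add: harm_altdef sum_distrib_left divide_inverse sum_subtractf)
    qed
    have D: "real (card {p. pair_weight p \<le> x}) = 2 * F - (real M)\<^sup>2"
      using hyperbola_count[OF elim] by (simp add: F_def M_def m_def)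
    have lx: "ln x = 2 * ln (sqrt x)" using elim by (simp add: ln_sqrt)
    have Ux: "U x = (2 * (x * harm M) - (real M)\<^sup>2) / x - ln x"
    proof -
      have "ln (real M / sqrt x) = ln (real M) - ln (sqrt x)" using M1 elim by (subst ln_div) auto
      moreover have "(real M / sqrt x)\<^sup>2 = (real M)\<^sup>2 / x" using elim by (simp add: power_divide)
      moreover have "(2 * (x * harm M) - (real M)\<^sup>2) / x = 2 * harm M - (real M)\<^sup>2 / x"
        using elim by (simp add: diff_divide_distrib)
      ultimately show ?thesis by (simp add: U_def M_def lx)
    qed
    have "(2 * F - (real M)\<^sup>2) / x \<le> (2 * (x * harm M) - (real M)\<^sup>2) / x"
      using F1 elim by (intro divide_right_mono) auto
    moreover have "(2 * (x * harm M - real M) - (real M)\<^sup>2) / x \<le> (2 * F - (real M)\<^sup>2) / x"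
      using F2 elim by (intro divide_right_mono) auto
    moreover have "(2 * (x * harm M - real M) - (real M)\<^sup>2) / x = (2 * (x * harm M) - (real M)\<^sup>2) / x - 2 * real M / x"
      by (simp add: diff_divide_distrib)
    moreover have "2 / sqrt x * (real M / sqrt x) = 2 * real M / x" using sx by simp
    ultimately show ?case unfolding D Ux M_def[symmetric] by linarith
  qed
  show ?thesis
  proof (rule tendsto_sandwich)
    show "\<forall>\<^sub>F x in at_top. U x - 2 / sqrt x * (real (m x) / sqrt x) \<le> real (card {p. pair_weight p \<le> x}) / x - ln x"
      using ev by eventually_elim auto
    show "\<forall>\<^sub>F x in at_top. real (card {p. pair_weight p \<le> x}) / x - ln x \<le> U x"
      using ev by eventually_elim auto
  qed (use U L in simp_all)
qed

lemma cumul_divisor_asymptotics: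
  "((\<lambda>T. cumul divisor_measure divisor_point T / T - ln T) \<longlongrightarrow> 2 * euler_mascheroni - 1 - ln (2 * pi)) at_top"
proof -
  interpret laplace_measure divisor_measure divisor_point by (rule laplace_measure_divisor)
  have c: "cumul divisor_measure divisor_point T = 2 * pi * real (card {p. pair_weight p \<le> T / (2 * pi)})" for T
  proof -
    have "cumul divisor_measure divisor_point T = (\<integral>p. (2 * pi) *\<^sub>R indicator {p. divisor_point p \<le> T} p \<partial>count_pairs)"
    proof -
      have "space divisor_measure = UNIV" by (simp add: divisor_measure_def)
      hence "cumul divisor_measure divisor_point T = (\<integral>p. indicator {p. divisor_point p \<le> T} p \<partial>divisor_measure)"
        unfolding cumul_eq_integral by simp
      also have "\<dots> = (\<integral>p. (2 * pi) *\<^sub>R indicator {p. divisor_point p \<le> T} p \<partial>count_pairs)"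
        unfolding divisor_measure_def by (rule integral_density) auto
      finally show ?thesis .
    qed
    also have "\<dots> = 2 * pi * measure count_pairs {p. divisor_point p \<le> T}" by simp
    also have "measure count_pairs {p. divisor_point p \<le> T} = real (card {p. divisor_point p \<le> T})"
      by (simp add: Sigma_Algebra.measure_def emeasure_count_space)
    also have "{p. divisor_point p \<le> T} = {p. pair_weight p \<le> T / (2 * pi)}"
      by (auto simp: divisor_point_def pos_le_divide_eq mult_ac)
    finally show ?thesis .
  qed
  have "((\<lambda>T. real (card {p. pair_weight p \<le> T / (2 * pi)}) / (T / (2 * pi)) - ln (T / (2 * pi)) - ln (2 * pi)) \<longlongrightarrow> 2 * euler_mascheroni - 1 - ln (2 * pi)) at_top"
  proof -
    have f: "filterlim (\<lambda>T::real. T / (2 * pi)) at_top at_top" by real_asymp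
    show ?thesis by (intro tendsto_diff tendsto_const filterlim_compose[OF divisor_count_asymptotics f])
  qed
  moreover have "\<forall>\<^sub>F T in at_top. real (card {p. pair_weight p \<le> T / (2 * pi)}) / (T / (2 * pi)) - ln (T / (2 * pi)) - ln (2 * pi) = cumul divisor_measure divisor_point T / T - ln T"
    using eventually_gt_at_top[of 0] by eventually_elim (simp add: c ln_div mult_ac)
  ultimately show ?thesis by (rule Lim_transform_eventually)
qed

text \<open>The linear coefficient in the classical mean value theorem for zeta on the critical
  line. Its value cancels when the ladder equation is solved.\<close>

definition mean_const :: real where
  "mean_const = 2 * euler_mascheroni - 1 - ln (2 * pi)"

theorem cumul_zeta_asymptotics:
  "((\<lambda>T. cumul zeta_measure abs T / T - ln T) \<longlongrightarrow> mean_const) at_top"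
proof -
  obtain C where C: "C \<ge> 0" "\<And>s. s \<in> small_sector \<Longrightarrow> norm (lap zeta_measure abs s - lap divisor_measure divisor_point s) \<le> C * (norm s)\<^sup>2 / Re s powr (5/2)"
    using lap_zeta_divisor_diff by blast
  obtain D where D: "D \<ge> 0" "\<And>s. 0 < s \<Longrightarrow> s \<le> 1/8 \<Longrightarrow> Re (lap divisor_measure divisor_point (of_real s)) \<le> D / s ^ 3"
    "\<And>s. 0 < s \<Longrightarrow> s \<le> 1/8 \<Longrightarrow> Re (lap zeta_measure abs (of_real s)) \<le> D / s ^ 3"
    using lap_cubic_bounds by blast
  show ?thesis unfolding mean_const_def
    by (rule cumul_asymptotics_transfer[where ?s0.0 = "1/8", OF laplace_measure_zeta laplace_measure_divisor _ C(1) _ D(3) D(2) D(1) cumul_divisor_asymptotics])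
       (use C(2) in \<open>auto simp: small_sector_def\<close>)
qed

section \<open>From distribution functions back to Laplace transforms\<close>

context laplace_measure
begin

lemma sigma_finite: "sigma_finite_measure M"
proof
  show "\<exists>A. countable A \<and> A \<subseteq> sets M \<and> \<Union> A = space M \<and> (\<forall>a\<in>A. emeasure M a \<noteq> \<infinity>)"
  proof (intro exI[of _ "range (\<lambda>n::nat. {x \<in> space M. X x \<le> real n})"] conjI ballI)
    show "\<Union> (range (\<lambda>n::nat. {x \<in> space M. X x \<le> real n})) = space M"
      using real_arch_simple by auto
    fix a assume "a \<in> range (\<lambda>n::nat. {x \<in> space M. X x \<le> real n})"
    then obtain n :: nat where "a = {x \<in> space M. X x \<le> real n}" by auto
    thus "emeasure M a \<noteq> \<infinity>" using emeasure_le_finite[of "real n"] by simp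
  qed auto
qed

lemma cumul_mono: "T \<le> T' \<Longrightarrow> cumul M X T \<le> cumul M X T'"
  unfolding cumul_eq_integral by (intro integral_mono integrable_indicator_le) (auto simp: indicator_def)

lemma cumul_nonneg: "cumul M X T \<ge> 0"
  by (simp add: cumul_def)

text \<open>Integration by parts in the form of an exchange of integrals: \<open>exp (- s X)\<close>
  is the integral of \<open>s exp (- s t)\<close> over \<open>t >= X\<close>.\<close>

lemma
  assumes s: "s > 0"
  shows integrable_exp_cumul: "integrable lborel (\<lambda>t. indicator {0..} t * (s * exp (- s * t) * cumul M X t))"
    and integral_exp_cumul: "(\<integral>t. indicator {0..} t * (s * exp (- s * t) * cumul M X t) \<partial>lborel) = (\<integral>x. exp (- s * X x) \<partial>M)"
proof -
  interpret sigma_finite_measure M by (rule sigma_finite)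
  interpret P: pair_sigma_finite M "lborel :: real measure" ..
  have em: "emeasure M {x \<in> space M. X x \<le> t} = ennreal (cumul M X t)" for t
    unfolding cumul_def using emeasure_le_finite[of t] by (intro emeasure_eq_ennreal_measure) auto
  define f where "f = (\<lambda>(x, t). ennreal (s * exp (- s * t)) * (if X x \<le> t then 1 else 0))"
  have f_meas: "f \<in> borel_measurable (M \<Otimes>\<^sub>M lborel)" unfolding f_def by measurable
  have inner1: "(\<integral>\<^sup>+t. f (x, t) \<partial>lborel) = ennreal (exp (- s * X x))" for x
  proof -
    have "(\<integral>\<^sup>+t. ennreal (s * exp (- s * t)) * indicator {X x ..} t \<partial>lborel) = ennreal (0 - (- exp (- s * X x)))"
    proof (rule nn_integral_FTC_atLeast)
      show "((\<lambda>t. - exp (- s * t)) \<longlongrightarrow> 0) at_top" using s by real_asymp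
    qed (use s in \<open>auto intro!: derivative_eq_intros\<close>)
    moreover have "f (x, t) = ennreal (s * exp (- s * t)) * indicator {X x ..} t" for t
      by (simp add: f_def indicator_def)
    ultimately show ?thesis by simp
  qed
  have inner2: "(\<integral>\<^sup>+x. f (x, t) \<partial>M) = ennreal (indicator {0..} t * (s * exp (- s * t) * cumul M X t))" for t
  proof -
    have "(\<integral>\<^sup>+x. f (x, t) \<partial>M) = (\<integral>\<^sup>+x. ennreal (s * exp (- s * t)) * indicator {x \<in> space M. X x \<le> t} x \<partial>M)"
      by (intro nn_integral_cong) (auto simp: f_def indicator_def)
    also have "\<dots> = ennreal (s * exp (- s * t)) * ennreal (cumul M X t)"
      by (subst nn_integral_cmult) (auto simp: em)
    also have "\<dots> = ennreal (s * exp (- s * t) * cumul M X t)" using s by (subst ennreal_mult) (auto simp: cumul_nonneg)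
    also have "s * exp (- s * t) * cumul M X t = indicator {0..} t * (s * exp (- s * t) * cumul M X t)"
    proof (cases "t \<ge> 0")
      case False
      hence "{x \<in> space M. X x \<le> t} = {}" using X_nonneg by (auto simp: not_le intro: less_le_trans)
      hence "cumul M X t = 0" unfolding cumul_def by (simp only: measure_empty)
      thus ?thesis by simp
    qed simp
    finally show ?thesis .
  qed
  have cm [measurable]: "cumul M X \<in> borel_measurable borel"
    by (intro borel_measurable_mono monoI cumul_mono)
  have "(\<integral>\<^sup>+t. ennreal (indicator {0..} t * (s * exp (- s * t) * cumul M X t)) \<partial>lborel) = (\<integral>\<^sup>+x. ennreal (exp (- s * X x)) \<partial>M)"
    using P.Fubini[OF f_meas] by (simp add: inner1 inner2)
  also have "\<dots> = ennreal (\<integral>x. exp (- s * X x) \<partial>M)"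
    by (intro nn_integral_eq_integral int_exp s) auto
  finally have nn: "(\<integral>\<^sup>+t. ennreal (indicator {0..} t * (s * exp (- s * t) * cumul M X t)) \<partial>lborel) = ennreal (\<integral>x. exp (- s * X x) \<partial>M)" .
  have nonneg: "indicator {0..} t * (s * exp (- s * t) * cumul M X t) \<ge> 0" for t
    using s cumul_nonneg by (auto simp: indicator_def)
  show int: "integrable lborel (\<lambda>t. indicator {0..} t * (s * exp (- s * t) * cumul M X t))"
    by (intro integrableI_nonneg) (use nn nonneg in auto)
  have "ennreal (\<integral>t. indicator {0..} t * (s * exp (- s * t) * cumul M X t) \<partial>lborel) = ennreal (\<integral>x. exp (- s * X x) \<partial>M)"
    using nn_integral_eq_integral[OF int] nonneg nn by simp
  thus "(\<integral>t. indicator {0..} t * (s * exp (- s * t) * cumul M X t) \<partial>lborel) = (\<integral>x. exp (- s * X x) \<partial>M)"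
    using nonneg by (subst (asm) ennreal_inj) (auto intro!: Bochner_Integration.integral_nonneg)
qed

end

lemma
  fixes s :: real assumes s: "s > 0"
  shows integrable_exp_linear: "integrable lborel (\<lambda>t. indicator {0..} t * (s * exp (- s * t) * t))"
    and integral_exp_linear: "(\<integral>t. indicator {0..} t * (s * exp (- s * t) * t) \<partial>lborel) = 1 / s"
    and integrable_exp_const: "integrable lborel (\<lambda>t. indicator {0..} t * (s * exp (- s * t)))"
    and integral_exp_const: "(\<integral>t. indicator {0..} t * (s * exp (- s * t)) \<partial>lborel) = 1"
proof -
  have "(\<integral>\<^sup>+t. ennreal (s * exp (- s * t) * t) * indicator {0 ..} t \<partial>lborel) = ennreal (0 - (- (0 + 1 / s) * exp (- s * 0)))"
  proof (rule nn_integral_FTC_atLeast[where F = "\<lambda>t. - (t + 1 / s) * exp (- s * t)"])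
    show "((\<lambda>t. - (t + 1 / s) * exp (- s * t)) \<longlongrightarrow> 0) at_top" using s by real_asymp
  qed (use s in \<open>auto intro!: derivative_eq_intros simp: field_simps\<close>)
  moreover have "ennreal (s * exp (- s * t) * t) * indicator {0 ..} t = ennreal (indicator {0..} t * (s * exp (- s * t) * t))" for t
    by (auto simp: indicator_def)
  ultimately have nn: "(\<integral>\<^sup>+t. ennreal (indicator {0..} t * (s * exp (- s * t) * t)) \<partial>lborel) = ennreal (1 / s)"
    by simp
  have pos: "indicator {0..} t * (s * exp (- s * t) * t) \<ge> 0" for t using s by (auto simp: indicator_def)
  show int: "integrable lborel (\<lambda>t. indicator {0..} t * (s * exp (- s * t) * t))"
    by (intro integrableI_nonneg) (use nn pos in auto)
  show "(\<integral>t. indicator {0..} t * (s * exp (- s * t) * t) \<partial>lborel) = 1 / s"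
    using integral_eq_nn_integral[of "\<lambda>t. indicator {0..} t * (s * exp (- s * t) * t)" lborel] nn pos s by simp
  have "(\<integral>\<^sup>+t. ennreal (s * exp (- s * t)) * indicator {0 ..} t \<partial>lborel) = ennreal (0 - (- exp (- s * 0)))"
  proof (rule nn_integral_FTC_atLeast[where F = "\<lambda>t. - exp (- s * t)"])
    show "((\<lambda>t. - exp (- s * t)) \<longlongrightarrow> 0) at_top" using s by real_asymp
  qed (use s in \<open>auto intro!: derivative_eq_intros simp: field_simps\<close>)
  moreover have "ennreal (s * exp (- s * t)) * indicator {0 ..} t = ennreal (indicator {0..} t * (s * exp (- s * t)))" for t
    by (auto simp: indicator_def)
  ultimately have nn': "(\<integral>\<^sup>+t. ennreal (indicator {0..} t * (s * exp (- s * t))) \<partial>lborel) = ennreal 1"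
    by simp
  have pos': "indicator {0..} t * (s * exp (- s * t)) \<ge> 0" for t using s by (auto simp: indicator_def)
  show int': "integrable lborel (\<lambda>t. indicator {0..} t * (s * exp (- s * t)))"
    by (intro integrableI_nonneg) (use nn' pos' in auto)
  show "(\<integral>t. indicator {0..} t * (s * exp (- s * t)) \<partial>lborel) = 1"
    using integral_eq_nn_integral[of "\<lambda>t. indicator {0..} t * (s * exp (- s * t))" lborel] nn' pos' s by simp
qed

text \<open>Two measures are compared so that the terms \<open>T ln T\<close> cancel and only a
  difference close to \<open>k T\<close> has to be averaged. Below a threshold this difference is
  bounded by a constant, which the factor \<open>s\<close> removes in the limit.\<close>

lemma cumul_abelian:
  assumes A: "laplace_measure M1 X1" and B: "laplace_measure M2 X2"
    and lim: "((\<lambda>T. (cumul M1 X1 T - cumul M2 X2 T) / T) \<longlongrightarrow> k) at_top"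
  shows "((\<lambda>s. s * ((\<integral>x. exp (- s * X1 x) \<partial>M1) - (\<integral>x. exp (- s * X2 x) \<partial>M2))) \<longlongrightarrow> k) (at_right 0)"
proof -
  interpret A: laplace_measure M1 X1 by fact
  interpret B: laplace_measure M2 X2 by fact
  define g where "g = (\<lambda>t. cumul M1 X1 t - cumul M2 X2 t - k * t)"
  show ?thesis
  proof (rule tendstoI)
    fix e :: real assume e: "e > 0"
    define d where "d = e / 2"
    have d: "d > 0" using e by (simp add: d_def)
    have "\<forall>\<^sub>F T in at_top. dist ((cumul M1 X1 T - cumul M2 X2 T) / T) k < d"
      using lim d by (rule tendstoD)
    then obtain T0 where T0: "\<And>T. T \<ge> T0 \<Longrightarrow> \<bar>(cumul M1 X1 T - cumul M2 X2 T) / T - k\<bar> < d"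
      by (auto simp: eventually_at_top_linorder dist_real_def)
    define T1 where "T1 = max T0 1"
    define K where "K = cumul M1 X1 T1 + cumul M2 X2 T1 + \<bar>k\<bar> * T1"
    have K: "K \<ge> 0" unfolding K_def using A.cumul_nonneg B.cumul_nonneg by (auto simp: T1_def)
    have gb: "\<bar>g t\<bar> \<le> K + d * t" if t: "t \<ge> 0" for t
    proof (cases "t \<ge> T1")
      case True
      hence t0: "t > 0" "t \<ge> T0" by (auto simp: T1_def)
      have "g t = t * ((cumul M1 X1 t - cumul M2 X2 t) / t - k)" 
      proof -
        have "D - k * t = t * (D / t - k)" for D using t0 by (simp add: field_simps)
        thus ?thesis by (simp add: g_def)
      qed
      hence "\<bar>g t\<bar> = t * \<bar>(cumul M1 X1 t - cumul M2 X2 t) / t - k\<bar>" using t0 by (simp add: abs_mult)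
      also have "\<dots> \<le> t * d" using T0[OF t0(2)] t0 by (intro mult_left_mono) auto
      finally show ?thesis using K by (simp add: mult.commute)
    next
      case False
      have "cumul M1 X1 t \<le> cumul M1 X1 T1" "cumul M2 X2 t \<le> cumul M2 X2 T1"
        using False by (intro A.cumul_mono B.cumul_mono; simp)+
      moreover have "\<bar>k * t\<bar> \<le> \<bar>k\<bar> * T1" using False t by (auto simp: abs_mult intro!: mult_left_mono)
      moreover have "cumul M1 X1 t \<ge> 0" "cumul M2 X2 t \<ge> 0" by (rule A.cumul_nonneg B.cumul_nonneg)+
      moreover have "d * t \<ge> 0" using d t by simp
      ultimately show ?thesis unfolding g_def K_def by linarith
    qed
    have bound: "\<bar>s * ((\<integral>x. exp (- s * X1 x) \<partial>M1) - (\<integral>x. exp (- s * X2 x) \<partial>M2)) - k\<bar> \<le> s * K + d" if s: "s > 0" for s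
    proof -
      let ?w = "\<lambda>t. indicator {0..} t * (s * exp (- s * t))"
      note ints = A.integrable_exp_cumul[OF s] B.integrable_exp_cumul[OF s] integrable_exp_linear[OF s] integrable_exp_const[OF s]
      have eq: "?w t * g t = indicator {0..} t * (s * exp (- s * t) * cumul M1 X1 t) - indicator {0..} t * (s * exp (- s * t) * cumul M2 X2 t) - k * (indicator {0..} t * (s * exp (- s * t) * t))" for t
        by (simp add: g_def algebra_simps)
      have i1: "integrable lborel (\<lambda>t. ?w t * g t)" unfolding eq using ints by simp
      have "(\<integral>t. ?w t * g t \<partial>lborel) = (\<integral>x. exp (- s * X1 x) \<partial>M1) - (\<integral>x. exp (- s * X2 x) \<partial>M2) - k * (1 / s)"
        unfolding eq using ints A.integral_exp_cumul[OF s] B.integral_exp_cumul[OF s] integral_exp_linear[OF s] by simp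
      moreover have "\<bar>\<integral>t. ?w t * g t \<partial>lborel\<bar> \<le> (\<integral>t. K * ?w t + d * (indicator {0..} t * (s * exp (- s * t) * t)) \<partial>lborel)"
      proof (rule order_trans[OF integral_abs_bound], rule integral_mono)
        fix t :: real
        show "\<bar>?w t * g t\<bar> \<le> K * ?w t + d * (indicator {0..} t * (s * exp (- s * t) * t))"
        proof (cases "t \<ge> 0")
          case True
          have "s * exp (- s * t) * \<bar>g t\<bar> \<le> s * exp (- s * t) * (K + d * t)"
            using gb[OF True] s by (intro mult_left_mono) auto
          thus ?thesis using True s by (simp add: abs_mult algebra_simps)
        qed simp
      qed (use i1 ints in auto)
      moreover have "(\<integral>t. K * ?w t + d * (indicator {0..} t * (s * exp (- s * t) * t)) \<partial>lborel) = K + d * (1 / s)"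
        using ints integral_exp_linear[OF s] integral_exp_const[OF s] by simp
      ultimately have "\<bar>(\<integral>x. exp (- s * X1 x) \<partial>M1) - (\<integral>x. exp (- s * X2 x) \<partial>M2) - k * (1 / s)\<bar> \<le> K + d * (1 / s)" by simp
      hence "s * \<bar>(\<integral>x. exp (- s * X1 x) \<partial>M1) - (\<integral>x. exp (- s * X2 x) \<partial>M2) - k * (1 / s)\<bar> \<le> s * (K + d * (1 / s))"
        using s by (intro mult_left_mono) auto
      also have "s * \<bar>(\<integral>x. exp (- s * X1 x) \<partial>M1) - (\<integral>x. exp (- s * X2 x) \<partial>M2) - k * (1 / s)\<bar> =
          \<bar>s * ((\<integral>x. exp (- s * X1 x) \<partial>M1) - (\<integral>x. exp (- s * X2 x) \<partial>M2) - k * (1 / s))\<bar>"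
        using s by (simp add: abs_mult)
      also have "s * ((\<integral>x. exp (- s * X1 x) \<partial>M1) - (\<integral>x. exp (- s * X2 x) \<partial>M2) - k * (1 / s)) = s * ((\<integral>x. exp (- s * X1 x) \<partial>M1) - (\<integral>x. exp (- s * X2 x) \<partial>M2)) - k"
        using s by (simp add: right_diff_distrib)
      also have "s * (K + d * (1 / s)) = s * K + d" using s by (simp add: distrib_left)
      finally show ?thesis .
    qed
    have "((\<lambda>s. s * K + d) \<longlongrightarrow> 0 * K + d) (at_right 0)" by (intro tendsto_intros)
    hence "\<forall>\<^sub>F s in at_right 0. s * K + d < e" by (rule order_tendstoD) (use e in \<open>simp add: d_def\<close>)
    moreover have "\<forall>\<^sub>F s::real in at_right 0. s > 0" by (rule eventually_at_right_less)
    ultimately show "\<forall>\<^sub>F s in at_right 0. dist (s * ((\<integral>x. exp (- s * X1 x) \<partial>M1) - (\<integral>x. exp (- s * X2 x) \<partial>M2))) k < e"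
    proof eventually_elim
      case (elim s)
      thus ?case using bound[of s] by (simp add: dist_real_def)
    qed
  qed
qed

section \<open>The harmonic numbers as reference measure\<close>

text \<open>A measure of leading order \<open>T ln T\<close> whose distribution function and Laplace
  transform are both explicit. Their constants are \<open>c - 1\<close> and 0; this gap of
  \<open>1 - c\<close> passes to the zeta function without any evaluation of the integral of
  \<open>u ln u exp (- u)\<close>.\<close>

definition harmonic_measure :: "nat measure" where
  "harmonic_measure = density (count_space UNIV) (\<lambda>n. ennreal (harm n))"

lemma harm_le: "harm n \<le> real n"
proof (induction n)
  case (Suc n)
  have "inverse (real (Suc n)) \<le> 1" by (simp add: field_simps)
  thus ?case using Suc by (simp add: harm_Suc)
qed (simp add: harm_expand)

text \<open>The recurrence of \<open>harm\<close> turns the sum \<open>S\<close> into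
  \<open>S = z S - ln (1 - z)\<close>; the index shift is free because
  \<open>harm 0 = 0\<close>.\<close>

lemma harm_power_series:
  fixes z :: real assumes z: "0 < z" "z < 1"
  shows "summable (\<lambda>n. harm n * z ^ n)" and "(\<Sum>n. harm n * z ^ n) = - ln (1 - z) / (1 - z)"
proof -
  show sm: "summable (\<lambda>n. harm n * z ^ n)"
  proof (rule summable_comparison_test)
    show "summable (\<lambda>n. of_nat (Suc n) * z ^ n)" using geometric_deriv_sums[of z] z by (auto simp: sums_iff)
    show "\<exists>N. \<forall>n\<ge>N. norm (harm n * z ^ n) \<le> of_nat (Suc n) * z ^ n"
      using z harm_le by (auto simp: abs_mult harm_nonneg intro!: mult_right_mono order_trans[OF harm_le])
  qed
  define S where "S = (\<Sum>n. harm n * z ^ n)"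
  have sl: "(\<lambda>n. z ^ Suc n / real (Suc n)) sums (- ln (1 - z))"
  proof -
    have smm: "summable (\<lambda>n. z ^ Suc n / real (Suc n))"
    proof (rule summable_comparison_test)
      show "summable (\<lambda>n. z ^ n)" using z by (intro summable_geometric) auto
      have "z ^ Suc n / real (Suc n) \<le> z ^ n / 1" for n
        using z by (intro frac_le) (auto simp: mult_left_le_one_le)
      thus "\<exists>N. \<forall>n\<ge>N. norm (z ^ Suc n / real (Suc n)) \<le> z ^ n" using z by (auto simp del: of_nat_Suc power_Suc)
    qed
    have "ln (1 - z) = (\<Sum>n. (-1) ^ n * (1 / real (n + 1)) * ((1 - z) - 1) ^ Suc n)"
      using z by (intro ln_series) auto
    also have "(\<lambda>n. (-1) ^ n * (1 / real (n + 1)) * ((1 - z) - 1) ^ Suc n) = (\<lambda>n. - (z ^ Suc n / real (Suc n)))"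
    proof
      fix n
      have "((1 - z) - 1) ^ Suc n = (-1) ^ Suc n * z ^ Suc n" 
      proof -
        have "(1 - z) - 1 = - z" by simp
        thus ?thesis by (simp only: power_minus[of z])
      qed
      moreover have "(-1) ^ n * (-1::real) ^ Suc n = -1" by (induction n) auto
      moreover have "a * (1 / d) * (b * c) = (a * b) * (c / d)" for a b c d :: real by simp
      ultimately show "(-1) ^ n * (1 / real (n + 1)) * ((1 - z) - 1) ^ Suc n = - (z ^ Suc n / real (Suc n))"
        by (simp only: Suc_eq_plus1[symmetric] mult_minus1)
    qed
    finally show ?thesis using smm by (simp add: suminf_minus sums_iff del: power_Suc of_nat_Suc)
  qed
  have "(\<Sum>n. harm (Suc n) * z ^ Suc n) = S - harm 0 * z ^ 0"
    using suminf_split_head[OF sm] by (simp add: S_def)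
  moreover have "(\<lambda>n. harm (Suc n) * z ^ Suc n) = (\<lambda>n. z * (harm n * z ^ n) + z ^ Suc n / real (Suc n))"
  proof
    fix n
    have "(h + inverse d) * z ^ Suc n = z * (h * z ^ n) + z ^ Suc n / d" for h d :: real
      by (simp add: field_simps)
    thus "harm (Suc n) * z ^ Suc n = z * (harm n * z ^ n) + z ^ Suc n / real (Suc n)"
      by (simp only: harm_Suc)
  qed
  moreover have "(\<lambda>n. z * (harm n * z ^ n) + z ^ Suc n / real (Suc n)) sums (z * S + (- ln (1 - z)))"
    by (intro sums_add sums_mult sl) (use sm in \<open>simp add: S_def summable_sums\<close>)
  ultimately have "S = z * S - ln (1 - z)" by (simp add: sums_iff harm_expand)
  hence "S * (1 - z) = - ln (1 - z)" by (simp add: algebra_simps)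
  thus "(\<Sum>n. harm n * z ^ n) = - ln (1 - z) / (1 - z)" using z by (simp add: S_def field_simps)
qed

lemma exp_power_real: "exp (- (s * real n)) = exp (- s) ^ n"
  by (subst exp_of_nat_mult [symmetric]) (simp add: mult.commute)

lemma laplace_measure_harmonic: "laplace_measure harmonic_measure real"
proof
  fix s :: real assume s: "s > 0"
  have "summable (\<lambda>n. norm (harm n *\<^sub>R exp (- s * real n)))"
    using harm_power_series(1)[of "exp (- s)"] s by (simp add: abs_mult harm_nonneg exp_power_real)
  hence "integrable (count_space UNIV) (\<lambda>n. harm n *\<^sub>R exp (- s * real n))"
    by (subst integrable_count_space_nat_iff)
  thus "integrable harmonic_measure (\<lambda>n. exp (- s * real n))"
    unfolding harmonic_measure_def by (subst integrable_density) (auto simp: harm_nonneg)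
qed (auto simp: harmonic_measure_def)

lemma laplace_harmonic:
  assumes s: "s > 0"
  shows "(\<integral>n. exp (- s * real n) \<partial>harmonic_measure) = - ln (1 - exp (- s)) / (1 - exp (- s))"
proof -
  have "(\<integral>n. exp (- s * real n) \<partial>harmonic_measure) = (\<integral>n. harm n *\<^sub>R exp (- s * real n) \<partial>count_space UNIV)"
    unfolding harmonic_measure_def by (subst integral_density) (auto simp: harm_nonneg)
  also have "\<dots> = (\<Sum>n. harm n *\<^sub>R exp (- s * real n))"
  proof (rule integral_count_space_nat)
    show "integrable (count_space UNIV) (\<lambda>n. harm n *\<^sub>R exp (- s * real n))"
      using laplace_measure.int_exp[OF laplace_measure_harmonic s] unfolding harmonic_measure_def
      by (subst (asm) integrable_density) (auto simp: harm_nonneg)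
  qed
  also have "\<dots> = (\<Sum>n. harm n * exp (- s) ^ n)" by (simp add: exp_power_real)
  also have "\<dots> = - ln (1 - exp (- s)) / (1 - exp (- s))" using s by (intro harm_power_series(2)) auto
  finally show ?thesis .
qed

lemma sum_harm: "(\<Sum>k\<le>n. harm k) = (real n + 1) * harm n - real n"
proof (induction n)
  case (Suc n)
  have "harm (Suc n) = harm n + 1 / (real n + 1)" by (simp add: harm_Suc inverse_eq_divide add.commute)
  hence "(real n + 1) * harm (Suc n) = (real n + 1) * harm n + 1"
    by (simp add: distrib_left del: harm_Suc)
  thus ?case using Suc by (simp add: algebra_simps)
qed (simp add: harm_expand)

lemma cumul_harmonic:
  assumes T: "T \<ge> 0"
  shows "cumul harmonic_measure real T = (real (nat \<lfloor>T\<rfloor>) + 1) * harm (nat \<lfloor>T\<rfloor>) - real (nat \<lfloor>T\<rfloor>)"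
proof -
  interpret laplace_measure harmonic_measure real by (rule laplace_measure_harmonic)
  have set: "{n. real n \<le> T} = {..nat \<lfloor>T\<rfloor>}" using T by (auto simp: le_nat_iff le_floor_iff)
  have "cumul harmonic_measure real T = (\<integral>n. harm n *\<^sub>R indicator {n. real n \<le> T} n \<partial>count_space UNIV)"
    unfolding cumul_eq_integral unfolding harmonic_measure_def by (subst integral_density) (auto simp: harm_nonneg)
  also have "\<dots> = (\<Sum>n\<in>{..nat \<lfloor>T\<rfloor>}. harm n *\<^sub>R indicator {n. real n \<le> T} n)"
    unfolding set by (subst lebesgue_integral_count_space_finite_support) (auto simp: indicator_def intro!: sum.mono_neutral_left finite_subset[of _ "{..nat \<lfloor>T\<rfloor>}"])
  also have "\<dots> = (\<Sum>n\<le>nat \<lfloor>T\<rfloor>. harm n)" unfolding set by (intro sum.cong) auto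
  finally show ?thesis by (simp add: sum_harm)
qed

text \<open>Taking the integer part changes \<open>T\<close> by less than 1; the only delicate term
  is this change times \<open>ln T / T\<close>, and that still tends to 0.\<close>

lemma cumul_harmonic_asymptotics:
  "((\<lambda>T. cumul harmonic_measure real T / T - ln T) \<longlongrightarrow> euler_mascheroni - 1) at_top"
proof -
  define N where "N = (\<lambda>T::real. nat \<lfloor>T\<rfloor>)"
  have Ntop: "filterlim N at_top at_top"
    unfolding N_def by (intro filterlim_compose[OF filterlim_nat_sequentially] filterlim_floor_sequentially)
  have H: "((\<lambda>T. harm (N T) - ln (real (N T))) \<longlongrightarrow> euler_mascheroni) at_top"
    by (rule filterlim_compose[OF euler_mascheroni_LIMSEQ Ntop])
  have r1: "((\<lambda>T. real (N T) / T) \<longlongrightarrow> 1) at_top"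
  proof (rule tendsto_sandwich[where f = "\<lambda>x. 1 - 1 / x" and h = "\<lambda>_. 1"])
    show "\<forall>\<^sub>F T in at_top. 1 - 1 / T \<le> real (N T) / T"
      using eventually_gt_at_top[of 0]
    proof eventually_elim
      case (elim T)
      have "T - 1 \<le> real (N T)" unfolding N_def by linarith
      hence "(T - 1) / T \<le> real (N T) / T" using elim by (intro divide_right_mono) auto
      thus ?case using elim by (simp add: diff_divide_distrib)
    qed
    show "\<forall>\<^sub>F T in at_top. real (N T) / T \<le> 1"
      using eventually_gt_at_top[of 0] by eventually_elim (simp add: N_def)
  qed real_asymp+
  have r2: "((\<lambda>T. (real (N T) + 1) / T) \<longlongrightarrow> 1) at_top"
  proof -
    have "((\<lambda>T. real (N T) / T + 1 / T) \<longlongrightarrow> 1 + 0) at_top" by (intro tendsto_add r1) real_asymp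
    thus ?thesis by (simp add: add_divide_distrib)
  qed
  have r3: "((\<lambda>T. ((real (N T) + 1) / T - 1) * ln (real (N T))) \<longlongrightarrow> 0) at_top"
  proof (rule tendsto_sandwich[where f = "\<lambda>_. 0" and h = "\<lambda>x. 1 / x * ln x"])
    have ev: "\<forall>\<^sub>F T in at_top. 0 \<le> (real (N T) + 1) / T - 1 \<and> (real (N T) + 1) / T - 1 \<le> 1 / T \<and> 0 \<le> ln (real (N T)) \<and> ln (real (N T)) \<le> ln T"
      using eventually_ge_at_top[of 1]
    proof eventually_elim
      case (elim T)
      have "real (N T) \<le> T" unfolding N_def using elim by simp
      moreover have "T < real (N T) + 1" unfolding N_def by linarith
      moreover have "real (N T) \<ge> 1" unfolding N_def using elim by (simp add: le_nat_iff le_floor_iff)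
      ultimately show ?case using elim by (auto simp: field_simps)
    qed
    show "\<forall>\<^sub>F T in at_top. 0 \<le> ((real (N T) + 1) / T - 1) * ln (real (N T))"
      using ev by eventually_elim auto
    show "\<forall>\<^sub>F T in at_top. ((real (N T) + 1) / T - 1) * ln (real (N T)) \<le> 1 / T * ln T"
      using ev eventually_gt_at_top[of 0] by eventually_elim (intro mult_mono; simp)
  qed real_asymp+
  have "((\<lambda>T. (real (N T) + 1) / T * (harm (N T) - ln (real (N T))) + ((real (N T) + 1) / T - 1) * ln (real (N T)) + ln (real (N T) / T) - real (N T) / T)
     \<longlongrightarrow> 1 * euler_mascheroni + 0 + ln 1 - 1) at_top"
    by (intro tendsto_intros r1 r2 r3 H) auto
  moreover have "\<forall>\<^sub>F T in at_top. (real (N T) + 1) / T * (harm (N T) - ln (real (N T))) + ((real (N T) + 1) / T - 1) * ln (real (N T)) + ln (real (N T) / T) - real (N T) / T = cumul harmonic_measure real T / T - ln T"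
    using eventually_ge_at_top[of 1]
  proof eventually_elim
    case (elim T)
    have N1: "real (N T) \<ge> 1" unfolding N_def using elim by (simp add: le_nat_iff le_floor_iff)
    have "ln (real (N T) / T) = ln (real (N T)) - ln T" using N1 elim by (subst ln_div) auto
    moreover have "cumul harmonic_measure real T / T = (real (N T) + 1) / T * harm (N T) - real (N T) / T"
      using elim by (simp add: cumul_harmonic N_def diff_divide_distrib)
    ultimately show ?case by (simp add: algebra_simps)
  qed
  ultimately have "((\<lambda>T. cumul harmonic_measure real T / T - ln T) \<longlongrightarrow> 1 * euler_mascheroni + 0 + ln 1 - 1) at_top"
    by (rule Lim_transform_eventually)
  thus ?thesis by simp
qed

text \<open>By the comparison, \<open>s\<close> times the difference of the two transforms tends to
  \<open>mean_const - (c - 1)\<close>, and for the harmonic measure \<open>s\<close> times the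
  transform is \<open>- ln s + o(1)\<close>; then \<open>s = 1 / v\<close>.\<close>

theorem laplace_zeta_asymptotics:
  "((\<lambda>v. (\<integral>t. exp (- (1 / v) * \<bar>t\<bar>) \<partial>zeta_measure) / v - ln v) \<longlongrightarrow> mean_const + 1 - euler_mascheroni) at_top"
proof -
  have "((\<lambda>T. (cumul zeta_measure abs T / T - ln T) - (cumul harmonic_measure real T / T - ln T)) \<longlongrightarrow> mean_const - (euler_mascheroni - 1)) at_top"
    by (intro tendsto_diff cumul_zeta_asymptotics cumul_harmonic_asymptotics)
  hence "((\<lambda>T. (cumul zeta_measure abs T - cumul harmonic_measure real T) / T) \<longlongrightarrow> mean_const - (euler_mascheroni - 1)) at_top"
    by (simp add: diff_divide_distrib)
  from cumul_abelian[OF laplace_measure_zeta laplace_measure_harmonic this]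
  have 1: "((\<lambda>s. s * ((\<integral>t. exp (- s * \<bar>t\<bar>) \<partial>zeta_measure) - (\<integral>n. exp (- s * real n) \<partial>harmonic_measure))) \<longlongrightarrow> mean_const - (euler_mascheroni - 1)) (at_right 0)" .
  have 2: "((\<lambda>s::real. s * (- ln (1 - exp (- s)) / (1 - exp (- s))) + ln s) \<longlongrightarrow> 0) (at_right 0)" by real_asymp
  have "((\<lambda>s. s * ((\<integral>t. exp (- s * \<bar>t\<bar>) \<partial>zeta_measure) - (\<integral>n. exp (- s * real n) \<partial>harmonic_measure)) + (s * (- ln (1 - exp (- s)) / (1 - exp (- s))) + ln s)) \<longlongrightarrow> mean_const - (euler_mascheroni - 1) + 0) (at_right 0)"
    by (intro tendsto_add 1 2)
  moreover have "\<forall>\<^sub>F s in at_right 0. s * ((\<integral>t. exp (- s * \<bar>t\<bar>) \<partial>zeta_measure) - (\<integral>n. exp (- s * real n) \<partial>harmonic_measure)) + (s * (- ln (1 - exp (- s)) / (1 - exp (- s))) + ln s) =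
      s * (\<integral>t. exp (- s * \<bar>t\<bar>) \<partial>zeta_measure) + ln s"
    using eventually_at_right_less[of 0]
  proof eventually_elim
    case (elim s)
    have "s * (A - B) + (s * B + ln s) = s * A + ln s" for A B :: real by (simp add: algebra_simps)
    thus ?case unfolding laplace_harmonic[OF elim] .
  qed
  ultimately have 3: "((\<lambda>s. s * (\<integral>t. exp (- s * \<bar>t\<bar>) \<partial>zeta_measure) + ln s) \<longlongrightarrow> mean_const - (euler_mascheroni - 1) + 0) (at_right 0)"
    by (rule Lim_transform_eventually)
  have inv: "filterlim (\<lambda>v::real. 1 / v) (at_right 0) at_top" by real_asymp
  have "((\<lambda>v. 1 / v * (\<integral>t. exp (- (1 / v) * \<bar>t\<bar>) \<partial>zeta_measure) + ln (1 / v)) \<longlongrightarrow> mean_const - (euler_mascheroni - 1) + 0) at_top"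
    by (rule filterlim_compose[OF 3 inv])
  moreover have "\<forall>\<^sub>F v in at_top. 1 / v * (\<integral>t. exp (- (1 / v) * \<bar>t\<bar>) \<partial>zeta_measure) + ln (1 / v) = (\<integral>t. exp (- (1 / v) * \<bar>t\<bar>) \<partial>zeta_measure) / v - ln v"
    using eventually_gt_at_top[of 0] by eventually_elim (simp add: ln_div)
  ultimately have "((\<lambda>v. (\<integral>t. exp (- (1 / v) * \<bar>t\<bar>) \<partial>zeta_measure) / v - ln v) \<longlongrightarrow> mean_const - (euler_mascheroni - 1) + 0) at_top"
    by (rule Lim_transform_eventually)
  thus ?thesis by (simp add: algebra_simps)
qed

section \<open>Jacob's ladder\<close>

definition mean_square :: "real \<Rightarrow> real" where
  "mean_square T = integral {0..T} (\<lambda>t. (norm (zeta_half t))\<^sup>2)"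

definition damped_mean_square :: "real \<Rightarrow> real \<Rightarrow> real" where
  "damped_mean_square X M = integral {0..M} (\<lambda>t. (norm (zeta_half t))\<^sup>2 * exp (- 2 * t / X))"

lemma ladder_equation_iff:
  "ladder_equation \<mu> T X \<longleftrightarrow> damped_mean_square X (\<mu> X) = mean_square T"
proof -
  have "riemann_zeta (Complex (1/2) t) = zeta_half t" for t
    by (simp add: zeta_half_def Complex_eq)
  thus ?thesis by (simp add: ladder_equation_def damped_mean_square_def mean_square_def)
qed

lemma continuous_on_zeta_square: "continuous_on A (\<lambda>t. (norm (zeta_half t))\<^sup>2)"
  by (intro continuous_intros continuous_on_zeta_half)

lemma mean_square_eq_cumul:
  "mean_square T = cumul zeta_measure abs T"
proof -
  interpret laplace_measure zeta_measure abs by (rule laplace_measure_zeta)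
  have "space zeta_measure = UNIV" by (simp add: zeta_measure_def)
  hence "cumul zeta_measure abs T = (\<integral>t. indicator {t. \<bar>t\<bar> \<le> T} t \<partial>zeta_measure)"
    unfolding cumul_eq_integral by simp
  also have "\<dots> = (\<integral>t. (indicator {0..} t * (norm (zeta_half t))\<^sup>2) *\<^sub>R indicator {t. \<bar>t\<bar> \<le> T} t \<partial>lborel)"
    unfolding zeta_measure_def by (rule integral_density) auto
  also have "\<dots> = (LINT t:{0..T}|lborel. (norm (zeta_half t))\<^sup>2)"
    unfolding set_lebesgue_integral_def by (intro Bochner_Integration.integral_cong) (auto simp: indicator_def)
  also have "\<dots> = mean_square T"
    unfolding mean_square_def
    by (intro set_borel_integral_eq_integral(2) borel_integrable_atLeastAtMost' continuous_on_zeta_square)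
  finally show ?thesis ..
qed

lemma mean_square_asymptotics: "((\<lambda>T. mean_square T / T - ln T) \<longlongrightarrow> mean_const) at_top"
  using cumul_zeta_asymptotics by (simp add: mean_square_eq_cumul)

lemma mean_square_strict_mono:
  assumes "0 \<le> T" "T < T'"
  shows "mean_square T < mean_square T'"
proof -
  have int: "(\<lambda>t. (norm (zeta_half t))\<^sup>2) integrable_on {a..b}" for a b
    by (intro integrable_continuous_real continuous_on_zeta_square)
  have "mean_square T' = mean_square T + integral {T..T'} (\<lambda>t. (norm (zeta_half t))\<^sup>2)"
    unfolding mean_square_def using assms int by (intro Henstock_Kurzweil_Integration.integral_combine[symmetric]) auto
  moreover have "integral {T..T'} (\<lambda>t. (norm (zeta_half t))\<^sup>2) \<noteq> 0"
    using integral_eq_0_iff[OF continuous_on_zeta_square assms(2)] zeta_half_not_const_0[OF assms(2)] by auto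
  moreover have "integral {T..T'} (\<lambda>t. (norm (zeta_half t))\<^sup>2) \<ge> 0"
    by (intro integral_nonneg int) auto
  ultimately show ?thesis by linarith
qed

lemma mean_square_surj:
  assumes "c > 0"
  shows "\<exists>T>0. mean_square T = c"
proof -
  have "filterlim (\<lambda>T. (mean_square T / T - ln T) + ln T) at_top at_top"
    by (rule filterlim_tendsto_add_at_top[OF mean_square_asymptotics ln_at_top])
  hence "filterlim (\<lambda>T. T * ((mean_square T / T - ln T) + ln T)) at_top at_top"
    by (intro filterlim_at_top_mult_at_top filterlim_ident)
  moreover have "\<forall>\<^sub>F T in at_top. T * ((mean_square T / T - ln T) + ln T) = mean_square T"
    using eventually_gt_at_top[of 0] by eventually_elim simp
  ultimately have "filterlim mean_square at_top at_top" by (subst (asm) filterlim_cong[OF refl refl])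
  hence "\<forall>\<^sub>F T in at_top. mean_square T \<ge> c" by (simp add: filterlim_at_top)
  moreover have "\<forall>\<^sub>F T::real in at_top. T \<ge> 0" by (rule eventually_ge_at_top)
  ultimately have "\<forall>\<^sub>F T in at_top. mean_square T \<ge> c \<and> T \<ge> 0" by eventually_elim auto
  then obtain b where b: "mean_square b \<ge> c" "b \<ge> 0" by (auto simp: eventually_at_top_linorder)
  have "continuous_on {0..b} mean_square"
    unfolding mean_square_def[abs_def]
    by (intro indefinite_integral_continuous_1 integrable_continuous_real continuous_on_zeta_square)
  moreover have z: "mean_square 0 = 0" by (simp add: mean_square_def)
  ultimately obtain T where T: "0 \<le> T" "T \<le> b" "mean_square T = c"
    using IVT'[of mean_square 0 c b] b assms by auto
  moreover have "T \<noteq> 0" using T z assms by auto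
  ultimately show ?thesis by (intro exI[of _ T]) auto
qed

text \<open>For \<open>t > 0\<close> the weight grows strictly with \<open>X\<close>, the range does
  not shrink, and zeta is not identically 0 on it. Positivity rules out an empty range
  \<open>M <= 0\<close>, where both integrals could be 0.\<close>

lemma damped_mean_square_strict_mono:
  assumes X: "0 < X" "X < X'" and M: "M \<le> M'" and pos: "damped_mean_square X M > 0"
  shows "damped_mean_square X M < damped_mean_square X' M'"
proof -
  have M0: "M > 0"
  proof (rule ccontr)
    assume "\<not> M > 0"
    hence "damped_mean_square X M = 0" by (cases "M = 0") (auto simp: damped_mean_square_def)
    thus False using pos by simp
  qed
  have cont: "continuous_on A (\<lambda>t. (norm (zeta_half t))\<^sup>2 * exp (- 2 * t / Y))" if "Y > 0" for A Y
    using that by (intro continuous_intros continuous_on_zeta_half) auto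
  have int: "(\<lambda>t. (norm (zeta_half t))\<^sup>2 * exp (- 2 * t / Y)) integrable_on {a..b}" if "Y > 0" for a b Y
    by (intro integrable_continuous_real cont that)
  have le: "exp (- 2 * t / X) \<le> exp (- 2 * t / X')" if "t \<ge> 0" for t
    using that X by (auto intro!: divide_left_mono mult_pos_pos)
  have lt: "exp (- 2 * t / X) < exp (- 2 * t / X')" if "t > 0" for t
    using that X by (auto intro!: divide_strict_left_mono mult_pos_pos)
  let ?d = "\<lambda>t. (norm (zeta_half t))\<^sup>2 * exp (- 2 * t / X') - (norm (zeta_half t))\<^sup>2 * exp (- 2 * t / X)"
  have dnn: "?d t \<ge> 0" if "t \<in> {0..M}" for t using le[of t] that by (simp add: mult_left_mono)
  have "integral {0..M} ?d \<noteq> 0"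
  proof
    assume "integral {0..M} ?d = 0"
    hence *: "\<forall>t\<in>{0..M}. ?d t = 0"
      using X M0 dnn by (subst (asm) integral_eq_0_iff) (auto intro!: continuous_intros continuous_on_zeta_half)
    have "M / 2 < M" using M0 by simp
    from zeta_half_not_const_0[OF this] obtain t where t: "t \<in> {M/2..M}" "zeta_half t \<noteq> 0" by blast
    hence "t > 0" "t \<in> {0..M}" using M0 by auto
    have "(norm (zeta_half t))\<^sup>2 * exp (- 2 * t / X) < (norm (zeta_half t))\<^sup>2 * exp (- 2 * t / X')"
      using lt[OF \<open>t > 0\<close>] t(2) by (intro mult_strict_left_mono) auto
    thus False using *[rule_format, OF \<open>t \<in> {0..M}\<close>] by linarith
  qed
  moreover have "integral {0..M} ?d \<ge> 0"
    using X dnn by (intro integral_nonneg Henstock_Kurzweil_Integration.integrable_diff int) auto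
  moreover have "integral {0..M} ?d = damped_mean_square X' M - damped_mean_square X M"
    unfolding damped_mean_square_def using X by (intro Henstock_Kurzweil_Integration.integral_diff int) auto
  moreover have "damped_mean_square X' M \<le> damped_mean_square X' M'"
    unfolding damped_mean_square_def using X M M0 by (intro integral_subset_le int) auto
  ultimately show ?thesis by linarith
qed

definition zeta_laplace :: "real \<Rightarrow> real" where
  "zeta_laplace s = (\<integral>t. exp (- s * \<bar>t\<bar>) \<partial>zeta_measure)"

lemma zeta_laplace_eq: "zeta_laplace s = (\<integral>t. indicator {0..} t * ((norm (zeta_half t))\<^sup>2 * exp (- s * \<bar>t\<bar>)) \<partial>lborel)"
  unfolding zeta_laplace_def zeta_measure_def by (subst integral_density) (auto simp: mult_ac)

lemma integrable_zeta_laplace: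
  assumes "s > 0"
  shows "integrable lborel (\<lambda>t. indicator {0..} t * ((norm (zeta_half t))\<^sup>2 * exp (- s * \<bar>t\<bar>)))"
  using integrable_mult_indicator[OF _ integrable_zeta_square_exp[OF assms], of "{0..}"] by simp

text \<open>Beyond \<open>M\<close> one factor \<open>exp (- t / X)\<close> is bounded by
  \<open>exp (- M / X)\<close>, and the other one remains as a convergent Laplace transform.\<close>

lemma damped_mean_square_bounds:
  assumes X: "X > 0" and M: "M \<ge> 0"
  shows "damped_mean_square X M \<le> zeta_laplace (2 / X)"
    and "zeta_laplace (2 / X) \<le> damped_mean_square X M + exp (- M / X) * zeta_laplace (1 / X)"
proof -
  let ?g = "\<lambda>s t. indicator {0..} t * ((norm (zeta_half t))\<^sup>2 * exp (- s * \<bar>t\<bar>))"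
  have i2: "integrable lborel (?g (2 / X))" and i1: "integrable lborel (?g (1 / X))"
    using X by (intro integrable_zeta_laplace; simp)+
  have si: "set_integrable lborel {0..M} (\<lambda>t. (norm (zeta_half t))\<^sup>2 * exp (- 2 * t / X))"
    using X by (intro borel_integrable_atLeastAtMost' continuous_intros continuous_on_zeta_half) auto
  have i0: "integrable lborel (\<lambda>t. indicator {0..M} t * ((norm (zeta_half t))\<^sup>2 * exp (- 2 * t / X)))"
    using si by (simp add: set_integrable_def)
  have eq: "damped_mean_square X M = (\<integral>t. indicator {0..M} t * ((norm (zeta_half t))\<^sup>2 * exp (- 2 * t / X)) \<partial>lborel)"
    unfolding damped_mean_square_def set_borel_integral_eq_integral(2)[OF si, symmetric] by (simp add: set_lebesgue_integral_def)
  have e: "- (2 / X) * t = - 2 * t / X" for t by simp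
  show "damped_mean_square X M \<le> zeta_laplace (2 / X)"
    unfolding eq zeta_laplace_eq by (rule integral_mono[OF i0 i2]) (auto simp: indicator_def)
  have "zeta_laplace (2 / X) \<le> (\<integral>t. indicator {0..M} t * ((norm (zeta_half t))\<^sup>2 * exp (- 2 * t / X)) + exp (- M / X) * ?g (1 / X) t \<partial>lborel)"
    unfolding zeta_laplace_eq
  proof (rule integral_mono[OF i2])
    fix t :: real
    show "?g (2 / X) t \<le> indicator {0..M} t * ((norm (zeta_half t))\<^sup>2 * exp (- 2 * t / X)) + exp (- M / X) * ?g (1 / X) t"
    proof (cases "t \<le> M")
      case True thus ?thesis by (auto simp: indicator_def)
    next
      case False
      hence t: "t > M" "t \<ge> 0" using M by auto
      have "exp (- (2 / X) * \<bar>t\<bar>) = exp (- (1 / X) * t) * exp (- (1 / X) * t)"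
        using t by (simp flip: exp_add)
      also have "\<dots> \<le> exp (- M / X) * exp (- (1 / X) * t)"
        using t X by (intro mult_right_mono) (auto simp: divide_right_mono)
      finally have "(norm (zeta_half t))\<^sup>2 * exp (- (2 / X) * \<bar>t\<bar>) \<le> (norm (zeta_half t))\<^sup>2 * (exp (- M / X) * exp (- (1 / X) * \<bar>t\<bar>))"
        using t by (intro mult_left_mono) auto
      thus ?thesis using t by (simp add: mult_ac)
    qed
  qed (use i0 i1 in simp)
  also have "\<dots> = damped_mean_square X M + exp (- M / X) * zeta_laplace (1 / X)"
    unfolding eq zeta_laplace_eq using i0 i1 by simp
  finally show "zeta_laplace (2 / X) \<le> damped_mean_square X M + exp (- M / X) * zeta_laplace (1 / X)" .
qed

lemma zeta_laplace_cubic_bound: "\<exists>D\<ge>0. \<forall>s. 0 < s \<and> s \<le> 1/8 \<longrightarrow> zeta_laplace s \<le> D / s ^ 3"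
proof -
  interpret laplace_measure zeta_measure abs by (rule laplace_measure_zeta)
  show ?thesis using lap_cubic_bounds unfolding lap_of_real zeta_laplace_def by auto
qed

lemma zeta_laplace_asymptotics: "((\<lambda>v. zeta_laplace (1 / v) / v - ln v) \<longlongrightarrow> mean_const + 1 - euler_mascheroni) at_top"
  using laplace_zeta_asymptotics by (simp add: zeta_laplace_def)

section \<open>Inverting the ladder\<close>

locale ladder_setting =
  fixes y0 :: real and \<mu> :: "real \<Rightarrow> real"
  assumes y0: "y0 > 0"
    and mu_mono: "mono_on {y0..} \<mu>"
    and mu_ge: "\<And>y. y \<ge> y0 \<Longrightarrow> \<mu> y \<ge> 7 * y * ln y"
begin

abbreviation "Lam X \<equiv> damped_mean_square X (\<mu> X)"
abbreviation "rev_it \<equiv> reverse_iterate y0 \<mu>"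

text \<open>With \<open>X = 2 v\<close> the weight is \<open>exp (- t / v)\<close>. The growth of
  \<open>\<mu>\<close> bounds the truncation factor by \<open>(2 v) powr (- 7)\<close>, which
  outweighs the cubic bound for the transform at \<open>1 / (2 v)\<close>.\<close>

lemma Lam_asymptotics: "((\<lambda>v. Lam (2 * v) / v - ln v) \<longlongrightarrow> mean_const + 1 - euler_mascheroni) at_top"
proof -
  obtain D where D: "D \<ge> 0" "\<And>s. 0 < s \<Longrightarrow> s \<le> 1/8 \<Longrightarrow> zeta_laplace s \<le> D / s ^ 3"
    using zeta_laplace_cubic_bound by blast
  define err where "err = (\<lambda>v::real. D * (exp (- 7 * ln (2 * v)) * (2 * v) ^ 3 / v))"
  have "((\<lambda>v::real. exp (- 7 * ln (2 * v)) * (2 * v) ^ 3 / v) \<longlongrightarrow> 0) at_top" by real_asymp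
  hence "(err \<longlongrightarrow> D * 0) at_top" unfolding err_def by (intro tendsto_intros)
  hence err: "((\<lambda>v. (zeta_laplace (1 / v) / v - ln v) - err v) \<longlongrightarrow> (mean_const + 1 - euler_mascheroni) - D * 0) at_top"
    by (intro tendsto_diff zeta_laplace_asymptotics)
  have ev: "\<forall>\<^sub>F v in at_top. (zeta_laplace (1 / v) / v - ln v) - err v \<le> Lam (2 * v) / v - ln v \<and>
        Lam (2 * v) / v - ln v \<le> zeta_laplace (1 / v) / v - ln v"
    using eventually_ge_at_top[of "max 4 y0"]
  proof eventually_elim
    case (elim v)
    hence v: "v \<ge> 4" "2 * v \<ge> y0" by auto
    have mu: "\<mu> (2 * v) \<ge> 7 * (2 * v) * ln (2 * v)" by (rule mu_ge[OF v(2)])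
    have "7 * (2 * v) * ln (2 * v) \<ge> 0" using v by simp
    with mu have mu0: "\<mu> (2 * v) \<ge> 0" by linarith
    have X: "2 * v > 0" "2 / (2 * v) = 1 / v" using v by auto
    note b = damped_mean_square_bounds[OF X(1) mu0, unfolded X(2)]
    have "exp (- \<mu> (2 * v) / (2 * v)) * zeta_laplace (1 / (2 * v)) \<le> exp (- 7 * ln (2 * v)) * (D * (2 * v) ^ 3)"
    proof (intro mult_mono)
      have "7 * ln (2 * v) \<le> \<mu> (2 * v) / (2 * v)" using mu v by (simp add: field_simps)
      thus "exp (- \<mu> (2 * v) / (2 * v)) \<le> exp (- 7 * ln (2 * v))" by simp
      have "zeta_laplace (1 / (2 * v)) \<le> D / (1 / (2 * v)) ^ 3" using v by (intro D) (auto simp: field_simps)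
      thus "zeta_laplace (1 / (2 * v)) \<le> D * (2 * v) ^ 3" by (simp add: power_divide)
      show "0 \<le> zeta_laplace (1 / (2 * v))" unfolding zeta_laplace_def by (intro Bochner_Integration.integral_nonneg) auto
    qed auto
    also have "\<dots> = err v * v" using v by (simp add: err_def)
    finally have "zeta_laplace (1 / v) \<le> Lam (2 * v) + err v * v" using b by linarith
    hence "zeta_laplace (1 / v) / v \<le> (Lam (2 * v) + err v * v) / v" using v by (intro divide_right_mono) auto
    moreover have "(Lam (2 * v) + err v * v) / v = Lam (2 * v) / v + err v" using v by (simp add: add_divide_distrib)
    moreover have "Lam (2 * v) / v \<le> zeta_laplace (1 / v) / v" using b v by (intro divide_right_mono) auto
    ultimately show ?case by simp
  qed
  show ?thesis
  proof (rule tendsto_sandwich[OF _ _ _ zeta_laplace_asymptotics])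
    show "\<forall>\<^sub>F v in at_top. (zeta_laplace (1 / v) / v - ln v) - err v \<le> Lam (2 * v) / v - ln v"
      using ev by eventually_elim auto
    show "\<forall>\<^sub>F v in at_top. Lam (2 * v) / v - ln v \<le> zeta_laplace (1 / v) / v - ln v"
      using ev by eventually_elim auto
  qed (use err in simp)
qed

lemma Lam_inj:
  assumes "X \<ge> y0" "X' \<ge> y0" "Lam X = Lam X'" "Lam X > 0"
  shows "X = X'"
proof -
  have "Lam X < Lam X'" if "y0 \<le> X" "X < X'" "Lam X > 0" for X X'
    using that y0 mono_onD[OF mu_mono, of X X'] by (intro damped_mean_square_strict_mono) auto
  from this[of X X'] this[of X' X] show ?thesis using assms by (metis less_irrefl linorder_neqE_linordered_idom)
qed

lemma mean_square_inj:
  assumes "T > 0" "T' > 0" "mean_square T = mean_square T'"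
  shows "T = T'"
  using mean_square_strict_mono[of T T'] mean_square_strict_mono[of T' T] assms
  by (cases T T' rule: linorder_cases) auto

text \<open>\<open>the_inv_into\<close> is controlled only if the ladder is injective on its whole
  domain, not merely for large arguments. It is, since the value of the ladder determines
  \<open>mean_square T\<close> through the ladder equation, and \<open>mean_square\<close> is
  injective on positive numbers.\<close>

lemma reverse_iterate_eqI:
  assumes v: "2 * v \<ge> y0" and pos: "Lam (2 * v) > 0" and T: "T > 0" "mean_square T = Lam (2 * v)"
  shows "rev_it v = T"
proof -
  have phi: "X = 2 * v" if "X \<ge> y0 \<and> ladder_equation \<mu> T X" for X
  proof -
    have "Lam X = mean_square T" using that by (simp only: ladder_equation_iff)
    hence "Lam (2 * v) = Lam X" by (simp only: T)
    from Lam_inj[OF v conjunct1[OF that] this pos] show ?thesis by (rule sym)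
  qed
  have sol: "2 * v \<ge> y0 \<and> ladder_equation \<mu> T (2 * v)" using v T by (simp add: ladder_equation_iff)
  have dom: "T \<in> ladder_domain y0 \<mu>" unfolding ladder_domain_def using T(1) sol phi by blast
  have "ladder_phi y0 \<mu> T = 2 * v" unfolding ladder_phi_def by (rule the_equality) (use sol phi in blast)+
  hence val: "jacobs_ladder y0 \<mu> T = v" by (simp add: jacobs_ladder_def)
  have "inj_on (jacobs_ladder y0 \<mu>) (ladder_domain y0 \<mu>)"
  proof (rule inj_onI)
    fix S S' assume S: "S \<in> ladder_domain y0 \<mu>" "S' \<in> ladder_domain y0 \<mu>" and eq: "jacobs_ladder y0 \<mu> S = jacobs_ladder y0 \<mu> S'"
    have "ladder_equation \<mu> U (ladder_phi y0 \<mu> U)" if "U \<in> ladder_domain y0 \<mu>" for U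
      using that theI'[of "\<lambda>X. X \<ge> y0 \<and> ladder_equation \<mu> U X"] by (simp add: ladder_domain_def ladder_phi_def)
    from this[OF S(1)] this[OF S(2)] eq have ms: "mean_square S = mean_square S'"
      by (simp add: ladder_equation_iff jacobs_ladder_def)
    show "S = S'" by (rule mean_square_inj[OF _ _ ms]) (use S in \<open>auto simp: ladder_domain_def\<close>)
  qed
  thus ?thesis unfolding reverse_iterate_def using val dom by (intro the_inv_into_f_eq)
qed

lemma eventually_reverse_iterate:
  "\<forall>\<^sub>F v in at_top. rev_it v > 0 \<and> mean_square (rev_it v) = Lam (2 * v)"
proof -
  have "filterlim (\<lambda>v. (Lam (2 * v) / v - ln v) + ln v) at_top at_top"
    by (rule filterlim_tendsto_add_at_top[OF Lam_asymptotics ln_at_top])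
  hence "\<forall>\<^sub>F v in at_top. (Lam (2 * v) / v - ln v) + ln v > 0" by (simp add: filterlim_at_top_dense)
  thus ?thesis using eventually_gt_at_top[of 0] eventually_ge_at_top[of y0]
  proof eventually_elim
    case (elim v)
    hence pos: "Lam (2 * v) > 0" by (simp add: zero_less_divide_iff)
    from mean_square_surj[OF this] obtain T where T: "T > 0" "mean_square T = Lam (2 * v)" by blast
    have "rev_it v = T" using elim pos T by (intro reverse_iterate_eqI) auto
    thus ?case using T by simp
  qed
qed

text \<open>\<open>T ln T\<close> has a derivative of order \<open>ln T\<close>, so moving the
  argument by \<open>k v / ln v\<close> changes the mean square by
  \<open>k v + o(v)\<close>.\<close>

lemma mean_square_shift:
  "((\<lambda>v. mean_square (v * (1 + k / ln v)) / v - ln v) \<longlongrightarrow> mean_const + k) at_top"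
proof -
  define g where "g = (\<lambda>T. mean_square T / T - ln T)"
  have g: "(g \<longlongrightarrow> mean_const) at_top" using mean_square_asymptotics by (simp add: g_def)
  have top: "filterlim (\<lambda>v. v * (1 + k / ln v)) at_top at_top" by real_asymp
  have k1: "((\<lambda>v. 1 + k / ln v) \<longlongrightarrow> 1) at_top" by real_asymp
  have pos: "\<forall>\<^sub>F v in at_top. 1 + k / ln v > 0" using k1 by (rule order_tendstoD) auto
  have lim: "((\<lambda>v. (1 + k / ln v) * (ln (1 + k / ln v) + g (v * (1 + k / ln v))) + ((1 + k / ln v) * ln v - ln v)) \<longlongrightarrow> 1 * (ln 1 + mean_const) + k) at_top"
  proof (intro tendsto_add tendsto_mult k1 tendsto_ln filterlim_compose[OF g top])
    show "((\<lambda>v. (1 + k / ln v) * ln v - ln v) \<longlongrightarrow> k) at_top" by real_asymp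
  qed auto
  have "\<forall>\<^sub>F v in at_top. (1 + k / ln v) * (ln (1 + k / ln v) + g (v * (1 + k / ln v))) + ((1 + k / ln v) * ln v - ln v) =
     mean_square (v * (1 + k / ln v)) / v - ln v"
    using pos eventually_gt_at_top[of 0]
  proof eventually_elim
    case (elim v)
    define q where "q = 1 + k / ln v"
    have q: "q > 0" using elim by (simp add: q_def)
    have "mean_square (v * q) = (v * q) * (g (v * q) + (ln v + ln q))"
      using elim q by (simp add: g_def ln_mult)
    hence "mean_square (v * q) / v = q * (g (v * q) + (ln v + ln q))" using elim by simp
    thus ?case unfolding q_def[symmetric] by (simp add: algebra_simps)
  qed
  from Lim_transform_eventually[OF lim this] show ?thesis by simp
qed

text \<open>At \<open>[v]^1\<close> the mean square is larger than at \<open>v\<close> by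
  \<open>(1 - c) v + o(v)\<close>. For \<open>k\<close> on either side of \<open>1 - c\<close> it is
  compared with its value at \<open>v (1 + k / ln v)\<close>, and strict monotonicity turns the
  comparison of values into one of arguments.\<close>

lemma reverse_iterate_shift:
  "((\<lambda>v. (rev_it v - v) * ln v / v) \<longlongrightarrow> 1 - euler_mascheroni) at_top"
proof (rule order_tendstoI)
  fix k :: real assume k: "k < 1 - euler_mascheroni"
  \<comment> \<open>A level strictly between the limits of the two normalised mean squares, which
    eventually lie on opposite sides of it.\<close>
  obtain c where c: "mean_const + k < c" "c < mean_const + 1 - euler_mascheroni"
    using dense[of "mean_const + k" "mean_const + 1 - euler_mascheroni"] k by auto
  have top: "\<forall>\<^sub>F v::real in at_top. 1 + k / ln v > 0"
    by (rule order_tendstoD[of _ 1]) (real_asymp, simp)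
  show "\<forall>\<^sub>F v in at_top. k < (rev_it v - v) * ln v / v"
    using order_tendstoD(2)[OF mean_square_shift c(1)] order_tendstoD(1)[OF Lam_asymptotics c(2)]
      eventually_reverse_iterate eventually_gt_at_top[of 1] top
  proof eventually_elim
    case (elim v)
    have lv: "ln v > 0" using elim by simp
    have e: "mean_square (rev_it v) = Lam (2 * v)" using elim by simp
    have "mean_square (v * (1 + k / ln v)) / v < mean_square (rev_it v) / v" unfolding e using elim by linarith
    hence ms: "mean_square (v * (1 + k / ln v)) < mean_square (rev_it v)" using elim by (simp add: divide_less_cancel)
    have "v * (1 + k / ln v) < rev_it v"
    proof (rule ccontr)
      assume "\<not> ?thesis"
      hence "mean_square (rev_it v) \<le> mean_square (v * (1 + k / ln v))"
        using mean_square_strict_mono[of "rev_it v" "v * (1 + k / ln v)"] elim by (cases "rev_it v = v * (1 + k / ln v)") auto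
      thus False using ms by simp
    qed
    hence "v * k / ln v < rev_it v - v" by (simp add: distrib_left)
    thus ?case using lv elim by (simp add: field_simps)
  qed
next
  fix k :: real assume k: "1 - euler_mascheroni < k"
  obtain c where c: "mean_const + 1 - euler_mascheroni < c" "c < mean_const + k"
    using dense[of "mean_const + 1 - euler_mascheroni" "mean_const + k"] k by auto
  have top: "\<forall>\<^sub>F v::real in at_top. 1 + k / ln v > 0"
    by (rule order_tendstoD[of _ 1]) (real_asymp, simp)
  show "\<forall>\<^sub>F v in at_top. (rev_it v - v) * ln v / v < k"
    using order_tendstoD(1)[OF mean_square_shift c(2)] order_tendstoD(2)[OF Lam_asymptotics c(1)]
      eventually_reverse_iterate eventually_gt_at_top[of 1] top
  proof eventually_elim
    case (elim v)
    have lv: "ln v > 0" using elim by simp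
    have e: "mean_square (rev_it v) = Lam (2 * v)" using elim by simp
    have "mean_square (rev_it v) / v < mean_square (v * (1 + k / ln v)) / v" unfolding e using elim by linarith
    hence ms: "mean_square (rev_it v) < mean_square (v * (1 + k / ln v))" using elim by (simp add: divide_less_cancel)
    have "rev_it v < v * (1 + k / ln v)"
    proof (rule ccontr)
      assume "\<not> ?thesis"
      hence "mean_square (v * (1 + k / ln v)) \<le> mean_square (rev_it v)"
        using mean_square_strict_mono[of "v * (1 + k / ln v)" "rev_it v"] elim by (cases "rev_it v = v * (1 + k / ln v)") auto
      thus False using ms by simp
    qed
    hence "rev_it v - v < v * k / ln v" by (simp add: distrib_left)
    thus ?case using lv elim by (simp add: field_simps)
  qed
qed

end

section \<open>Gamma quotients and the limit\<close>

text \<open>\<open>ln Gamma\<close> is convex, so its slope over \<open>[v, w]\<close> lies between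
  those over \<open>[v - 1, v]\<close> and \<open>[w, w + 1]\<close>, which the functional equation
  evaluates to \<open>ln (v - 1)\<close> and \<open>ln w\<close>.\<close>

lemma ln_Gamma_diff_bounds:
  fixes v w :: real
  assumes "1 < v" "v < w"
  shows "(w - v) * ln (v - 1) \<le> ln (Gamma w) - ln (Gamma v)" and "ln (Gamma w) - ln (Gamma v) \<le> (w - v) * ln w"
proof -
  define f where "f = (ln \<circ> Gamma :: real \<Rightarrow> real)"
  have cvx: "convex_on {0<..} f" unfolding f_def by (rule log_convex_Gamma_real)
  have step: "f (x + 1) - f x = ln x" if "x > 0" for x
  proof -
    have "x \<notin> \<int>\<^sub>\<le>\<^sub>0" using that by (auto elim!: nonpos_Ints_cases)
    hence "Gamma (x + 1) = x * Gamma x" by (rule Gamma_plus1)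
    moreover have "ln (x * Gamma x) = ln x + ln (Gamma x)"
      by (rule ln_mult_pos[OF that Gamma_real_pos[OF that]])
    ultimately show ?thesis by (simp add: f_def)
  qed
  have "(f (v - 1) - f v) / (v - 1 - v) \<le> (f v - f w) / (v - w)"
    using order_trans[OF convex_on_slope_le(1)[OF cvx, of "v - 1" w v] convex_on_slope_le(2)[OF cvx, of "v - 1" w v]] assms by auto
  hence "ln (v - 1) \<le> (f w - f v) / (w - v)"
    using step[of "v - 1"] assms by (simp add: minus_divide_divide[symmetric, of "f v - f w"])
  thus "(w - v) * ln (v - 1) \<le> ln (Gamma w) - ln (Gamma v)"
    using assms by (simp add: pos_le_divide_eq mult.commute f_def)
  have "(f v - f w) / (v - w) \<le> (f w - f (w + 1)) / (w - (w + 1))"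
    using order_trans[OF convex_on_slope_le(1)[OF cvx, of v "w + 1" w] convex_on_slope_le(2)[OF cvx, of v "w + 1" w]] assms by auto
  hence "(f w - f v) / (w - v) \<le> ln w"
    using step[of w] assms by (simp add: minus_divide_divide[symmetric, of "f v - f w"])
  thus "ln (Gamma w) - ln (Gamma v) \<le> (w - v) * ln w"
    using assms by (simp add: pos_divide_le_eq mult.commute f_def)
qed

lemma one_minus_euler_mascheroni_pos: "1 - euler_mascheroni > (0::real)"
  using euler_mascheroni_less_13_over_22 by simp

context ladder_setting
begin

text \<open>Both Gamma bounds multiply \<open>[v]^1 - v\<close> by a logarithm that is asymptotic to
  \<open>ln v\<close>, because \<open>[v]^1 / v\<close> tends to 1; this cancels the logarithm in
  the shift.\<close>

lemma ln_Gamma_ratio_asymptotics: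
  "((\<lambda>v. (ln (Gamma (rev_it v)) - ln (Gamma v)) / v) \<longlongrightarrow> 1 - euler_mascheroni) at_top"
proof -
  define d where "d = (\<lambda>v. (rev_it v - v) * ln v / v)"
  have d: "(d \<longlongrightarrow> 1 - euler_mascheroni) at_top" unfolding d_def by (rule reverse_iterate_shift)
  \<comment> \<open>Positivity of the limit places \<open>rev_it v\<close> above \<open>v\<close>,
    as the Gamma bounds require.\<close>
  have dpos: "\<forall>\<^sub>F v in at_top. d v > 0" using d one_minus_euler_mascheroni_pos by (rule order_tendstoD)
  have il: "((\<lambda>v::real. 1 / ln v) \<longlongrightarrow> 0) at_top" by real_asymp
  have r1: "((\<lambda>v. 1 + d v * (1 / ln v)) \<longlongrightarrow> 1 + (1 - euler_mascheroni) * 0) at_top"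
    by (intro tendsto_intros d il)
  have r2: "((\<lambda>v. 1 + ln (1 + d v * (1 / ln v)) * (1 / ln v)) \<longlongrightarrow> 1 + ln (1 + (1 - euler_mascheroni) * 0) * 0) at_top"
    by (intro tendsto_intros r1 il) auto
  have lo: "((\<lambda>v. d v * (ln (v - 1) / ln v)) \<longlongrightarrow> (1 - euler_mascheroni) * 1) at_top"
    by (intro tendsto_mult d) real_asymp
  have up: "((\<lambda>v. d v * (1 + ln (1 + d v * (1 / ln v)) * (1 / ln v))) \<longlongrightarrow> (1 - euler_mascheroni) * (1 + ln (1 + (1 - euler_mascheroni) * 0) * 0)) at_top"
    by (intro tendsto_mult d r2)
  have ev: "\<forall>\<^sub>F v in at_top. d v * (ln (v - 1) / ln v) \<le> (ln (Gamma (rev_it v)) - ln (Gamma v)) / v \<and>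
     (ln (Gamma (rev_it v)) - ln (Gamma v)) / v \<le> d v * (1 + ln (1 + d v * (1 / ln v)) * (1 / ln v))"
    using dpos eventually_gt_at_top[of 2]
  proof eventually_elim
    case (elim v)
    have v: "v > 2" "ln v > 0" using elim by auto
    have w: "rev_it v > v" using elim v by (auto simp: d_def zero_less_divide_iff zero_less_mult_iff)
    have dv: "(rev_it v - v) / v = d v / ln v" using v by (simp add: d_def)
    have wv: "rev_it v = v * (1 + d v * (1 / ln v))" using v by (simp add: d_def field_simps)
    have p: "1 + d v * (1 / ln v) > 0" using elim v by (simp add: add_pos_pos)
    have lw: "ln (rev_it v) = ln v + ln (1 + d v * (1 / ln v))" unfolding wv using v p by (subst ln_mult) auto
    have "(rev_it v - v) * ln (v - 1) / v \<le> (ln (Gamma (rev_it v)) - ln (Gamma v)) / v"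
      using ln_Gamma_diff_bounds(1)[of v "rev_it v"] v w by (intro divide_right_mono) auto
    moreover have "(rev_it v - v) * ln (v - 1) / v = d v * (ln (v - 1) / ln v)"
    proof -
      have "(rev_it v - v) * ln (v - 1) / v = (rev_it v - v) / v * ln (v - 1)" by simp
      thus ?thesis unfolding dv by simp
    qed
    moreover have "(ln (Gamma (rev_it v)) - ln (Gamma v)) / v \<le> (rev_it v - v) * ln (rev_it v) / v"
      using ln_Gamma_diff_bounds(2)[of v "rev_it v"] v w by (intro divide_right_mono) auto
    moreover have "(rev_it v - v) * ln (rev_it v) / v = d v * (1 + ln (1 + d v * (1 / ln v)) * (1 / ln v))"
    proof -
      have "(rev_it v - v) * ln (rev_it v) / v = ((rev_it v - v) / v) * (ln v + ln (1 + d v * (1 / ln v)))"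
        by (simp add: lw)
      also have "\<dots> = d v * ((ln v + ln (1 + d v * (1 / ln v))) / ln v)" unfolding dv by simp
      also have "(ln v + ln (1 + d v * (1 / ln v))) / ln v = 1 + ln (1 + d v * (1 / ln v)) * (1 / ln v)"
        using v by (simp add: add_divide_distrib)
      finally show ?thesis .
    qed
    ultimately show ?case by simp
  qed
  show ?thesis
  proof (rule tendsto_sandwich)
    show "\<forall>\<^sub>F v in at_top. d v * (ln (v - 1) / ln v) \<le> (ln (Gamma (rev_it v)) - ln (Gamma v)) / v"
      using ev by eventually_elim auto
    show "\<forall>\<^sub>F v in at_top. (ln (Gamma (rev_it v)) - ln (Gamma v)) / v \<le> d v * (1 + ln (1 + d v * (1 / ln v)) * (1 / ln v))"
      using ev by eventually_elim auto
  qed (use lo up in simp_all)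
qed

theorem Gamma_ratio_limit:
  assumes r: "r > 0"
  shows "((\<lambda>\<tau>. (Gamma (rev_it (r * (\<tau> / (1 - euler_mascheroni)))) / Gamma (r * (\<tau> / (1 - euler_mascheroni)))) powr (1 / \<tau>)) \<longlongrightarrow> exp r) at_top"
proof -
  define a :: real where "a = 1 - euler_mascheroni"
  have a: "a > 0" using one_minus_euler_mascheroni_pos by (simp add: a_def)
  have top: "filterlim (\<lambda>\<tau>. r * (\<tau> / a)) at_top at_top" using r a by real_asymp
  have "((\<lambda>\<tau>. (ln (Gamma (rev_it (r * (\<tau> / a)))) - ln (Gamma (r * (\<tau> / a)))) / (r * (\<tau> / a))) \<longlongrightarrow> a) at_top"
    unfolding a_def by (rule filterlim_compose[OF ln_Gamma_ratio_asymptotics top[unfolded a_def]])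
  hence "((\<lambda>\<tau>. exp ((r / a) * ((ln (Gamma (rev_it (r * (\<tau> / a)))) - ln (Gamma (r * (\<tau> / a)))) / (r * (\<tau> / a))))) \<longlongrightarrow> exp ((r / a) * a)) at_top"
    by (intro tendsto_intros)
  moreover have "\<forall>\<^sub>F \<tau> in at_top. exp ((r / a) * ((ln (Gamma (rev_it (r * (\<tau> / a)))) - ln (Gamma (r * (\<tau> / a)))) / (r * (\<tau> / a)))) =
      (Gamma (rev_it (r * (\<tau> / a))) / Gamma (r * (\<tau> / a))) powr (1 / \<tau>)"
    using eventually_compose_filterlim[OF eventually_reverse_iterate top] eventually_gt_at_top[of 0]
  proof eventually_elim
    case (elim \<tau>)
    have G1: "Gamma (rev_it (r * (\<tau> / a))) > 0" using elim by (intro Gamma_real_pos) auto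
    have G2: "Gamma (r * (\<tau> / a)) > 0" using elim r a by (intro Gamma_real_pos) auto
    have "(r / a) * (Y / (r * (\<tau> / a))) = 1 / \<tau> * Y" for Y using elim r a by (simp add: field_simps)
    thus ?case using G1 G2 by (simp add: powr_def ln_div)
  qed
  ultimately show ?thesis using a unfolding a_def[symmetric] by (auto intro: Lim_transform_eventually)
qed

end

text \<open>For every quadruple the limit exists and equals \<open>exp r\<close>, with
  \<open>r\<close> the Fermat rational. Demanding existence together with a value other than
  \<open>exp 1\<close> therefore says just \<open>r \<noteq> 1\<close>, and the equivalence holds
  for each quadruple separately.\<close>

theorem corollary1:
  fixes y0 :: real and \<mu> :: "real \<Rightarrow> real"
  assumes "y0 > 0"
    and "smooth_on_half_line y0 \<mu>"
    and "mono_on {y0..} \<mu>"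
    and "\<not> bdd_above (\<mu> ` {y0..})"
    and "\<And>y. y \<ge> y0 \<Longrightarrow> \<mu> y \<ge> 7 * y * ln y"
  shows "(\<forall>(x::nat) (y::nat) (z::nat) (n::nat). x \<ge> 1 \<and> y \<ge> 1 \<and> z \<ge> 1 \<and> n \<ge> 3 \<longrightarrow> x ^ n + y ^ n \<noteq> z ^ n) \<longleftrightarrow>
    (\<forall>(x::nat) (y::nat) (z::nat) (n::nat). x \<ge> 1 \<and> y \<ge> 1 \<and> z \<ge> 1 \<and> n \<ge> 3 \<longrightarrow>
      (\<exists>L :: real.
        ((\<lambda>\<tau>. (Gamma (reverse_iterate y0 \<mu> (fermat_rational x y z n * (\<tau> / (1 - euler_mascheroni)))) /
               Gamma (fermat_rational x y z n * (\<tau> / (1 - euler_mascheroni)))) powr (1 / \<tau>))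
          \<longlongrightarrow> L) at_top \<and> L \<noteq> exp 1))"
proof -
  interpret ladder_setting y0 \<mu> by unfold_locales (use assms in auto)
  have "x ^ n + y ^ n \<noteq> z ^ n \<longleftrightarrow> (\<exists>L :: real.
        ((\<lambda>\<tau>. (Gamma (reverse_iterate y0 \<mu> (fermat_rational x y z n * (\<tau> / (1 - euler_mascheroni)))) /
               Gamma (fermat_rational x y z n * (\<tau> / (1 - euler_mascheroni)))) powr (1 / \<tau>))
          \<longlongrightarrow> L) at_top \<and> L \<noteq> exp 1)"
    if "x \<ge> 1 \<and> y \<ge> 1 \<and> z \<ge> 1 \<and> n \<ge> 3" for x y z n :: nat
  proof -
    define r where "r = fermat_rational x y z n"
    have "r > 0" unfolding r_def fermat_rational_def using that by (intro divide_pos_pos add_pos_pos) auto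
    note lim = Gamma_ratio_limit[OF this]
    have "r = 1 \<longleftrightarrow> real (x ^ n + y ^ n) = real (z ^ n)"
      unfolding r_def fermat_rational_def using that by (auto simp: divide_eq_1_iff)
    hence r1: "r = 1 \<longleftrightarrow> x ^ n + y ^ n = z ^ n" by (simp only: of_nat_eq_iff)
    show ?thesis unfolding r_def[symmetric]
    proof
      assume "x ^ n + y ^ n \<noteq> z ^ n"
      thus "\<exists>L. ((\<lambda>\<tau>. (Gamma (reverse_iterate y0 \<mu> (r * (\<tau> / (1 - euler_mascheroni)))) / Gamma (r * (\<tau> / (1 - euler_mascheroni)))) powr (1 / \<tau>)) \<longlongrightarrow> L) at_top \<and> L \<noteq> exp 1"
        using lim r1 by (intro exI[of _ "exp r"]) simp
    next
      assume "\<exists>L. ((\<lambda>\<tau>. (Gamma (reverse_iterate y0 \<mu> (r * (\<tau> / (1 - euler_mascheroni)))) / Gamma (r * (\<tau> / (1 - euler_mascheroni)))) powr (1 / \<tau>)) \<longlongrightarrow> L) at_top \<and> L \<noteq> exp 1"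
      then obtain L where L: "((\<lambda>\<tau>. (Gamma (reverse_iterate y0 \<mu> (r * (\<tau> / (1 - euler_mascheroni)))) / Gamma (r * (\<tau> / (1 - euler_mascheroni)))) powr (1 / \<tau>)) \<longlongrightarrow> L) at_top" "L \<noteq> exp 1" by blast
      have "L = exp r" by (rule tendsto_unique[OF _ L(1) lim]) simp
      thus "x ^ n + y ^ n \<noteq> z ^ n" using L(2) r1 by auto
    qed
  qed
  thus ?thesis by blast
qed

end
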